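(* There exists a zeta element for $(x_U,\mathfrak H,L)$ (with coefficients in $\Phi$) if and only if there exist classes $x_{V_\alpha}\in M_{H,\mathcal O}(V_\alpha)$ for all $\alpha\in H\backslash H\cdot\mathrm{supp}(\mathfrak H)/K$ such that $$\mathfrak h_\alpha^t\cdot j_U(x_U)=j_{H_\alpha}\circ\mathrm{pr}_{V_\alpha,H_\alpha,*}(x_{V_\alpha})$$ in $\widehat M_{H,\Phi}$. Moreover, if $y_L$ is an associated class for a given zeta element under $\iota_*$ and $M_{H,\mathcal O}$ is $\mathcal O$-torsion free, the classes $x_{V_\alpha}$ satisfying $\mathfrak h_\alpha^t\cdot j_U(x_U)=j_{H_\alpha}\circ\mathrm{pr}_{V_\alpha,H_\alpha,*}(x_{V_\alpha})$ for all $\alpha\in H\backslash H\cdot\mathrm{supp}(\mathfrak H)/K$ can be picked so that $\mathrm{pr}_{L,K,*}(y_L)=\sum_\alpha[V_\alpha g_\alpha K]_*(x_{V_\alpha})$, where the sum runs over $\alpha\in H\backslash H\cdot\mathrm{supp}(\mathfrak H)/K$.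
   Context: **RIC functors.** For a locally profinite group $G$, collections $\Upsilon$ of compact open subgroups are required to be non-empty and satisfy (T1) stability under conjugation; (T2) for $K,L\in\Upsilon$ there is $K'\in\Upsilon$, $K'\triangleleft K$, $K'\subset L$; (T3) stability under pairwise intersection. $\mathcal P(G,\Upsilon)$ has objects $\Upsilon$, $\mathrm{Hom}(L,K)=\{g\in G:g^{-1}Lg\subset K\}$, composition $(L\xrightarrow{g}K)\circ(L'\xrightarrow{h}L)=(L'\xrightarrow{hg}K)$. A RIC functor $M$ valued in $\mathcal O$-modules is a pair of functors $M^*:\mathcal P(G,\Upsilon)^{op}\to\mathcal O\text{-Mod}$, $M_*:\mathcal P(G,\Upsilon)\to\mathcal O\text{-Mod}$ agreeing on objects (value $M(K)$), with maps $[g]^*_{L,K}:M(K)\to M(L)$, $[g]_{L,K,*}:M(L)\to M(K)$ ($\mathrm{pr}_{L,K}$ for $g=e$), such that $[g]^*_{L,K}=[g^{-1}]_{K,L,*}$ if $g^{-1}Lg=K$ and $[\gamma]_{K,K,*}=\mathrm{id}$ for $\gamma\in K$. *CoMack* means cohomological ($\mathrm{pr}_{L,K,*}\mathrm{pr}_{L,K}^*=[K:L]$) and Mackey ($\mathrm{pr}_{L,K}^*\mathrm{pr}_{L',K,*}=\sum_{\gamma\in L\backslash K/L'}\mathrm{pr}_{L_\gamma,L,*}[\gamma]^*_{L_\gamma,L'}$, $L_\gamma=L\cap\gamma L'\gamma^{-1}$, for $L,L'\subset K$). $\mathcal O$-torsion free means each $M(K)$ is. **Setup.** $\iota:H\hookrightarrow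 G$ is a closed immersion of unimodular locally profinite groups; $\Upsilon_H,\Upsilon_G$ are non-empty collections of compact open subgroups of $H$ and $G$ respectively, each satisfying (T1) stability under conjugation (by $H$, resp. $G$), (T2) for any two members $K_1,K_2$ there is a member $K_3$ with $K_3\triangleleft K_1$ and $K_3\subset K_2$, and (T3) stability under pairwise intersection, with $\{K\cap H:K\in\Upsilon_G\}\subset\Upsilon_H$; $\mathcal O$ is an integral domain whose fraction field is a $\mathbb Q$-algebra and $\Phi$ a field containing $\mathcal O$; $M_{H,\mathcal O}$, $M_{G,\mathcal O}$ are CoMack functors on $(H,\Upsilon_H)$, $(G,\Upsilon_G)$ valued in $\mathcal O$-modules; $\iota_*:M_{H,\mathcal O}\to M_{G,\mathcal O}$ is a pushforward, i.e. a family $\iota_{V,K',*}:M_{H,\mathcal O}(V)\to M_{G,\mathcal O}(K')$ for $V\in\Upsilon_H$, $K'\in\Upsilon_G$, $V\subset K'$, commuting with the maps $[h]_*$ on both sides for $h\in H$ (whenever $h^{-1}V'h\subset V$, $h^{-1}L'h\subset K'$, $V'\subset L'$). $K\in\Upsilon_G$, $U=K\cap H$, $x_U\in M_{H,\mathcal O}(U)$; $\mathfrak H$ is a non-zero finite $\mathcal O$-linear combination of characteristic functions of double cosets in $K\backslash G/K$; $L\in\Upsilon_G$, $L\triangleleft K$. The mixed Hecke correspondence $[V\sigma K']_*:M_{H,\mathcal O}(V)\to M_{G,\mathcal O}(K')$ is $[\sigma]_{\sigma K'\sigma^{-1},K',*}\circ\iota_{V',\sigma K'\sigma^{-1},*}\circ\mathrm{pr}^*_{V',V}$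 with $V'=V\cap\sigma K'\sigma^{-1}$. **Completion.** $\widehat M_{H,\Phi}=\varinjlim_{V\in\Upsilon_H}M_{H,\mathcal O}(V)\otimes_{\mathcal O}\Phi$ under restrictions, with maps $j_V:M_{H,\mathcal O}(V)\to\widehat M_{H,\Phi}$ and smooth $H$-action $h\cdot j_V(x)=j_{hVh^{-1}}([h]^*_{hVh^{-1},V}x)$. **Zeta elements.** $\mathcal C(G/K,\widehat M_{H,\Phi})$ is the space of right $K$-invariant compactly supported functions $\xi:G\to\widehat M_{H,\Phi}$, with $H$-action $(h\xi)(g)=h\,\xi(h^{-1}g)$; $x\otimes\phi$ denotes $g\mapsto\phi(g)x$. Put $[V_1:V_2]=\mu_H(V_1)/\mu_H(V_2)$ for a Haar measure $\mu_H$. $\xi$ is $\mathcal O$-integral at level $L$ if for each $g\in G$ there are finitely many $V_i\in\Upsilon_H$, $V_i\subset gLg^{-1}$, and $x_{V_i}\in M_{H,\mathcal O}(V_i)$ with $\xi(g)=\sum_i[U:V_i]j_{V_i}(x_{V_i})$. A zeta element for $(x_U,\mathfrak H,L)$ is a $\zeta\in\mathcal C(G/K,\widehat M_{H,\Phi})$ that is $\mathcal O$-integral at level $L$ and has the same class as $j_U(x_U)\otimes\mathfrak H$ in the $H$-coinvariants. Given a presentation $\zeta=\sum_\beta[U:V_\beta]\,j_{V_\beta}(x_{V_\beta})\otimes\mathrm{ch}(g_\beta K)$ (finite, $V_\beta\subset g_\beta Lg_\beta^{-1}$, $x_{V_\beta}\in M_{H,\mathcal O}(V_\beta)$), the class $y_L=\sum_\beta[V_\beta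 g_\beta L]_*(x_{V_\beta})\in M_{G,\mathcal O}(L)$ is called an associated class for $\zeta$ under $\iota_*$. **Twisted restrictions.** For each $\alpha\in H\backslash H\cdot\mathrm{supp}(\mathfrak H)/K$ fix a representative $g_\alpha\in G$; $H_\alpha=H\cap g_\alpha Kg_\alpha^{-1}$, $V_\alpha=H\cap g_\alpha Lg_\alpha^{-1}$, and $\mathfrak h_\alpha:H\to\mathcal O$, $h\mapsto\mathfrak H(hg_\alpha)$, which is of the form $\sum_jc_j\,\mathrm{ch}(Uh_jH_\alpha)$ (finite sum, distinct double cosets). Its transpose is $\mathfrak h_\alpha^t=\sum_jc_j\,\mathrm{ch}(H_\alpha h_j^{-1}U)$, acting on a $U$-invariant vector $x$ by $\mathfrak h_\alpha^t\cdot x=\sum_jc_j\sum_{\beta\in H_\alpha h_j^{-1}U/U}\beta\cdot x$. *)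

theory Defs
  imports
    "HOL-Analysis.Analysis"
    "HOL-Algebra.Coset"
    "HOL-Library.Poly_Mapping"
    "HOL-Library.Function_Algebras"
begin

section \<open>Locally profinite groups and Haar measures\<close>

locale locally_profinite_group = group G for G :: "'g monoid" (structure) +
  fixes T :: "'g topology"
  assumes topspace: "topspace T = carrier G"
    and continuous_mult: "continuous_map (prod_topology T T) T (\<lambda>(x, y). x \<otimes> y)"
    and continuous_inv: "continuous_map T T (\<lambda>x. inv x)"
    and hausdorff: "Hausdorff_space T"
    and compact_open_subgroups:
      "\<lbrakk>openin T N; \<one> \<in> N\<rbrakk> \<Longrightarrow> \<exists>K\<subseteq>N. subgroup K G \<and> openin T K \<and> compactin T K"

text \<open>Left Haar measures are the nontrivial left invariant Radon measures on the Borel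
  \<open>\<sigma>\<close>-algebra.  The library's \<open>borel\<close> is tied to a type class, so the
  \<open>\<sigma>\<close>-algebra is generated here from the open sets of \<open>T\<close>.\<close>

definition left_haar_measure :: "'g monoid \<Rightarrow> 'g topology \<Rightarrow> 'g measure \<Rightarrow> bool" where
  "left_haar_measure G T \<mu> \<longleftrightarrow>
     sets \<mu> = sigma_sets (topspace T) {S. openin T S} \<and>
     emeasure \<mu> (topspace T) \<noteq> 0 \<and>
     (\<forall>g\<in>carrier G. \<forall>A\<in>sets \<mu>. emeasure \<mu> (g <#\<^bsub>G\<^esub> A) = emeasure \<mu> A) \<and>
     (\<forall>C. compactin T C \<longrightarrow> emeasure \<mu> C < \<infinity>) \<and>
     (\<forall>A\<in>sets \<mu>. emeasure \<mu> A = (INF S\<in>{S. openin T S \<and> A \<subseteq> S}. emeasure \<mu> S)) \<and>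
     (\<forall>S. openin T S \<longrightarrow> emeasure \<mu> S = (SUP C\<in>{C. compactin T C \<and> C \<subseteq> S}. emeasure \<mu> C))"

definition unimodular :: "'g monoid \<Rightarrow> 'g topology \<Rightarrow> bool" where
  "unimodular G T \<longleftrightarrow>
     (\<forall>\<mu>. left_haar_measure G T \<mu> \<longrightarrow>
        (\<forall>g\<in>carrier G. \<forall>A\<in>sets \<mu>. emeasure \<mu> (A #>\<^bsub>G\<^esub> g) = emeasure \<mu> A))"

text \<open>On compact open subgroups the ratio of volumes is a rational number; it is recorded as such
  because it has to be mapped to an arbitrary field of characteristic zero.\<close>

definition haar_index :: "'g measure \<Rightarrow> 'g set \<Rightarrow> 'g set \<Rightarrow> rat" where
  "haar_index \<mu> V W = (THE q. real_of_rat q = measure \<mu> V / measure \<mu> W)"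

definition closed_immersion ::
    "'h monoid \<Rightarrow> 'h topology \<Rightarrow> 'g monoid \<Rightarrow> 'g topology \<Rightarrow> ('h \<Rightarrow> 'g) \<Rightarrow> bool" where
  "closed_immersion H TH G TG \<iota> \<longleftrightarrow>
     \<iota> \<in> hom H G \<and> embedding_map TH TG \<iota> \<and> closedin TG (\<iota> ` carrier H)"

text \<open>\<open>trace_on H \<iota> K\<close> is the subset \<open>K \<inter> H\<close> of \<open>H\<close>; dually, an inclusion
  \<open>V \<subseteq> K\<close> with \<open>V\<close> in \<open>H\<close> and \<open>K\<close> in \<open>G\<close>
  is written \<open>\<iota> ` V \<subseteq> K\<close>.\<close>

definition trace_on :: "'h monoid \<Rightarrow> ('h \<Rightarrow> 'g) \<Rightarrow> 'g set \<Rightarrow> 'h set" where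
  "trace_on H \<iota> K = {h \<in> carrier H. \<iota> h \<in> K}"

definition conj_by :: "'g monoid \<Rightarrow> 'g \<Rightarrow> 'g set \<Rightarrow> 'g set" where
  "conj_by G g K = (g <#\<^bsub>G\<^esub> K) #>\<^bsub>G\<^esub> (inv\<^bsub>G\<^esub> g)"

definition dcoset :: "'g monoid \<Rightarrow> 'g set \<Rightarrow> 'g \<Rightarrow> 'g set \<Rightarrow> 'g set" where
  "dcoset G P g Q = (P #>\<^bsub>G\<^esub> g) <#>\<^bsub>G\<^esub> Q"

definition dcoset_reps :: "'g monoid \<Rightarrow> 'g set \<Rightarrow> 'g set \<Rightarrow> 'g set \<Rightarrow> 'g set \<Rightarrow> bool" where
  "dcoset_reps G P K Q R \<longleftrightarrow> R \<subseteq> K \<and> (\<forall>\<gamma>\<in>K. \<exists>!r. r \<in> R \<and> r \<in> dcoset G P \<gamma> Q)"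


section \<open>RIC and CoMack functors\<close>

locale level_collection = locally_profinite_group G T
  for G :: "'g monoid" (structure) and T :: "'g topology" +
  fixes \<Upsilon> :: "'g set set"
  assumes nonempty: "\<Upsilon> \<noteq> {}"
    and compact_open: "K \<in> \<Upsilon> \<Longrightarrow> subgroup K G \<and> openin T K \<and> compactin T K"
    and T1: "\<lbrakk>K \<in> \<Upsilon>; g \<in> carrier G\<rbrakk> \<Longrightarrow> conj_by G g K \<in> \<Upsilon>"
    and T2: "\<lbrakk>K \<in> \<Upsilon>; L \<in> \<Upsilon>\<rbrakk> \<Longrightarrow> \<exists>K'\<in>\<Upsilon>. K' \<lhd> G\<lparr>carrier := K\<rparr> \<and> K' \<subseteq> L"
    and T3: "\<lbrakk>K \<in> \<Upsilon>; L \<in> \<Upsilon>\<rbrakk> \<Longrightarrow> K \<inter> L \<in> \<Upsilon>"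

definition is_mor :: "'g monoid \<Rightarrow> 'g set \<Rightarrow> 'g set \<Rightarrow> 'g \<Rightarrow> bool" where
  "is_mor G L K g \<longleftrightarrow> g \<in> carrier G \<and> conj_by G (inv\<^bsub>G\<^esub> g) L \<subseteq> K"

text \<open>The modules \<open>M(K)\<close> of a functor are given as submodules \<open>val M K\<close> of one
  ambient module; this loses no generality, since any family of modules embeds in its direct sum.
  For \<open>g\<close> a morphism from \<open>L\<close> to \<open>K\<close>, \<open>pull M L K g\<close> is
  \<open>[g]\<^sup>*\<close> from \<open>M(K)\<close> to \<open>M(L)\<close>, and
  \<open>push M L K g\<close> is \<open>[g]\<^sub>*\<close> from \<open>M(L)\<close> to \<open>M(K)\<close>.\<close>

record ('g, 'o, 'm) ric =
  smul :: "'o \<Rightarrow> 'm \<Rightarrow> 'm"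
  val :: "'g set \<Rightarrow> 'm set"
  pull :: "'g set \<Rightarrow> 'g set \<Rightarrow> 'g \<Rightarrow> 'm \<Rightarrow> 'm"
  push :: "'g set \<Rightarrow> 'g set \<Rightarrow> 'g \<Rightarrow> 'm \<Rightarrow> 'm"

definition linear_between ::
    "('o \<Rightarrow> 'm \<Rightarrow> 'm) \<Rightarrow> ('o \<Rightarrow> 'n \<Rightarrow> 'n) \<Rightarrow> 'm set \<Rightarrow> 'n set \<Rightarrow>
     ('m::ab_group_add \<Rightarrow> 'n::ab_group_add) \<Rightarrow> bool" where
  "linear_between s t A B f \<longleftrightarrow>
     (\<forall>x\<in>A. f x \<in> B) \<and> (\<forall>x\<in>A. \<forall>y\<in>A. f (x + y) = f x + f y) \<and>
     (\<forall>c. \<forall>x\<in>A. f (s c x) = t c (f x))"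

locale ric_functor = level_collection G T \<Upsilon>
  for G :: "'g monoid" (structure) and T :: "'g topology" and \<Upsilon> :: "'g set set" +
  fixes M :: "('g, 'o::comm_ring_1, 'm::ab_group_add) ric"
  assumes ambient_module: "Modules.module (smul M)"
    and submodule: "K \<in> \<Upsilon> \<Longrightarrow> module.subspace (smul M) (val M K)"
    and pull_linear: "\<lbrakk>L \<in> \<Upsilon>; K \<in> \<Upsilon>; is_mor G L K g\<rbrakk> \<Longrightarrow>
          linear_between (smul M) (smul M) (val M K) (val M L) (pull M L K g)"
    and push_linear: "\<lbrakk>L \<in> \<Upsilon>; K \<in> \<Upsilon>; is_mor G L K g\<rbrakk> \<Longrightarrow>
          linear_between (smul M) (smul M) (val M L) (val M K) (push M L K g)"
    and pull_id: "\<lbrakk>K \<in> \<Upsilon>; x \<in> val M K\<rbrakk> \<Longrightarrow> pull M K K \<one> x = x"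
    and push_id: "\<lbrakk>K \<in> \<Upsilon>; x \<in> val M K\<rbrakk> \<Longrightarrow> push M K K \<one> x = x"
    and pull_comp: "\<lbrakk>L' \<in> \<Upsilon>; L \<in> \<Upsilon>; K \<in> \<Upsilon>; is_mor G L' L h; is_mor G L K g; x \<in> val M K\<rbrakk> \<Longrightarrow>
          pull M L' K (h \<otimes> g) x = pull M L' L h (pull M L K g x)"
    and push_comp: "\<lbrakk>L' \<in> \<Upsilon>; L \<in> \<Upsilon>; K \<in> \<Upsilon>; is_mor G L' L h; is_mor G L K g; x \<in> val M L'\<rbrakk> \<Longrightarrow>
          push M L' K (h \<otimes> g) x = push M L K g (push M L' L h x)"
    and pull_eq_push: "\<lbrakk>L \<in> \<Upsilon>; K \<in> \<Upsilon>; g \<in> carrier G; conj_by G (inv g) L = K; x \<in> val M K\<rbrakk> \<Longrightarrow>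
          pull M L K g x = push M K L (inv g) x"
    and push_inner: "\<lbrakk>K \<in> \<Upsilon>; \<gamma> \<in> K; x \<in> val M K\<rbrakk> \<Longrightarrow> push M K K \<gamma> x = x"

text \<open>The summands in the Mackey formula do not depend on the chosen representatives, so it is
  required for every system of representatives.\<close>

locale comack_functor = ric_functor G T \<Upsilon> M
  for G :: "'g monoid" (structure) and T :: "'g topology" and \<Upsilon> :: "'g set set"
    and M :: "('g, 'o::comm_ring_1, 'm::ab_group_add) ric" +
  assumes cohomological: "\<lbrakk>L \<in> \<Upsilon>; K \<in> \<Upsilon>; L \<subseteq> K; x \<in> val M K\<rbrakk> \<Longrightarrow>
      push M L K \<one> (pull M L K \<one> x) =
      smul M (of_nat (card (rcosets\<^bsub>G\<lparr>carrier := K\<rparr>\<^esub> L))) x"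
    and mackey: "\<lbrakk>L \<in> \<Upsilon>; L' \<in> \<Upsilon>; K \<in> \<Upsilon>; L \<subseteq> K; L' \<subseteq> K; x \<in> val M L'; dcoset_reps G L K L' R\<rbrakk> \<Longrightarrow>
      pull M L K \<one> (push M L' K \<one> x) =
      (\<Sum>\<gamma>\<in>R. push M (L \<inter> conj_by G \<gamma> L') L \<one> (pull M (L \<inter> conj_by G \<gamma> L') L' \<gamma> x))"

definition torsion_free :: "'g set set \<Rightarrow> ('g, 'o::comm_ring_1, 'm::ab_group_add) ric \<Rightarrow> bool" where
  "torsion_free \<Upsilon> M \<longleftrightarrow> (\<forall>K\<in>\<Upsilon>. \<forall>x\<in>val M K. \<forall>a. smul M a x = 0 \<longrightarrow> a = 0 \<or> x = 0)"

definition pushforward ::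
    "'h monoid \<Rightarrow> 'h set set \<Rightarrow> ('h, 'o, 'm) ric \<Rightarrow> 'g set set \<Rightarrow> 'g monoid \<Rightarrow> ('g, 'o, 'n) ric \<Rightarrow>
     ('h \<Rightarrow> 'g) \<Rightarrow> ('h set \<Rightarrow> 'g set \<Rightarrow> 'm::ab_group_add \<Rightarrow> 'n::ab_group_add) \<Rightarrow> bool" where
  "pushforward H \<Upsilon>H MH \<Upsilon>G G MG \<iota> p \<longleftrightarrow>
     (\<forall>V\<in>\<Upsilon>H. \<forall>K\<in>\<Upsilon>G. \<iota> ` V \<subseteq> K \<longrightarrow>
        linear_between (smul MH) (smul MG) (val MH V) (val MG K) (p V K)) \<and>
     (\<forall>V'\<in>\<Upsilon>H. \<forall>V\<in>\<Upsilon>H. \<forall>L\<in>\<Upsilon>G. \<forall>K\<in>\<Upsilon>G. \<forall>h.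
        is_mor H V' V h \<longrightarrow> is_mor G L K (\<iota> h) \<longrightarrow> \<iota> ` V' \<subseteq> L \<longrightarrow> \<iota> ` V \<subseteq> K \<longrightarrow>
        (\<forall>x\<in>val MH V'. push MG L K (\<iota> h) (p V' L x) = p V K (push MH V' V h x)))"

definition mixed_hecke ::
    "'h monoid \<Rightarrow> ('h, 'o, 'm) ric \<Rightarrow> 'g monoid \<Rightarrow> ('g, 'o, 'n) ric \<Rightarrow> ('h \<Rightarrow> 'g) \<Rightarrow>
     ('h set \<Rightarrow> 'g set \<Rightarrow> 'm \<Rightarrow> 'n) \<Rightarrow> 'h set \<Rightarrow> 'g \<Rightarrow> 'g set \<Rightarrow> 'm \<Rightarrow> 'n" where
  "mixed_hecke H MH G MG \<iota> p V \<sigma> K x =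
     (let K\<sigma> = conj_by G \<sigma> K; V' = V \<inter> trace_on H \<iota> K\<sigma>
      in push MG K\<sigma> K \<sigma> (p V' K\<sigma> (pull MH V' V \<one>\<^bsub>H\<^esub> x)))"


section \<open>The completion\<close>

text \<open>The direct limit of the spaces \<open>M(V) \<otimes> \<Phi>\<close> is presented by generators and
  relations: the generators are the symbols \<open>x \<otimes> 1\<close> with
  \<open>x \<in> M(V)\<close>, i.e. the pairs \<open>(V, x)\<close>; the relations in
  \<open>tensor_relations\<close> cut out the direct sum over \<open>V\<close> of the tensor products
  (along the embedding \<open>\<phi>\<close> of the base ring into \<open>\<Phi>\<close>), and those in
  \<open>limit_relations\<close> identify elements along restriction maps.\<close>

definition free_scale :: "'f::field \<Rightarrow> ('a \<Rightarrow>\<^sub>0 'f) \<Rightarrow> ('a \<Rightarrow>\<^sub>0 'f)" where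
  "free_scale c = Poly_Mapping.map ((*) c)"

definition tensor_relations ::
    "('o \<Rightarrow> 'f::field) \<Rightarrow> 'h set set \<Rightarrow> ('h, 'o, 'm::ab_group_add) ric \<Rightarrow> ('h set \<times> 'm \<Rightarrow>\<^sub>0 'f) set" where
  "tensor_relations \<phi> \<Upsilon> M =
     {Poly_Mapping.single (V, x + y) 1 - Poly_Mapping.single (V, x) 1 - Poly_Mapping.single (V, y) 1
        | V x y. V \<in> \<Upsilon> \<and> x \<in> val M V \<and> y \<in> val M V} \<union>
     {Poly_Mapping.single (V, smul M a x) 1 - Poly_Mapping.single (V, x) (\<phi> a)
        | V a x. V \<in> \<Upsilon> \<and> x \<in> val M V}"

definition limit_relations ::
    "'h monoid \<Rightarrow> 'h set set \<Rightarrow> ('h, 'o, 'm::ab_group_add) ric \<Rightarrow> ('h set \<times> 'm \<Rightarrow>\<^sub>0 'f::field) set" where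
  "limit_relations H \<Upsilon> M =
     {Poly_Mapping.single (V', pull M V' V \<one>\<^bsub>H\<^esub> x) 1 - Poly_Mapping.single (V, x) 1
        | V V' x. V \<in> \<Upsilon> \<and> V' \<in> \<Upsilon> \<and> V' \<subseteq> V \<and> x \<in> val M V}"

text \<open>A realisation of the limit consists of a vector space over \<open>\<Phi>\<close> and maps
  \<open>j\<^sub>V\<close>, such that the induced linear map from the free space on the generators has
  exactly the relations as its kernel.  The limit is then the image of that map, \<open>limit_space\<close>;
  the vector space containing it may be bigger.\<close>

record ('h, 'm, 'f, 'w) realisation =
  vscale :: "'f \<Rightarrow> 'w \<Rightarrow> 'w"
  jmap :: "'h set \<Rightarrow> 'm \<Rightarrow> 'w"

definition free_eval ::
    "('h, 'm, 'f::field, 'w::ab_group_add) realisation \<Rightarrow> ('h set \<times> 'm \<Rightarrow>\<^sub>0 'f) \<Rightarrow> 'w" where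
  "free_eval W a = (\<Sum>(V, x)\<in>Poly_Mapping.keys a. vscale W (Poly_Mapping.lookup a (V, x)) (jmap W V x))"

definition is_completion ::
    "'h monoid \<Rightarrow> 'h set set \<Rightarrow> ('h, 'o, 'm::ab_group_add) ric \<Rightarrow> ('o \<Rightarrow> 'f::field) \<Rightarrow>
     ('h, 'm, 'f, 'w::ab_group_add) realisation \<Rightarrow> bool" where
  "is_completion H \<Upsilon> M \<phi> W \<longleftrightarrow>
     vector_space (vscale W) \<and>
     (\<forall>a. Poly_Mapping.keys a \<subseteq> Sigma \<Upsilon> (val M) \<longrightarrow>
        (free_eval W a = 0 \<longleftrightarrow>
         a \<in> module.span free_scale (tensor_relations \<phi> \<Upsilon> M \<union> limit_relations H \<Upsilon> M)))"

definition limit_space ::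
    "'h set set \<Rightarrow> ('h, 'o, 'm::ab_group_add) ric \<Rightarrow>
     ('h, 'm, 'f::field, 'w::ab_group_add) realisation \<Rightarrow> 'w set" where
  "limit_space \<Upsilon> M W = free_eval W ` {a. Poly_Mapping.keys a \<subseteq> Sigma \<Upsilon> (val M)}"

text \<open>The linear action of \<open>H\<close> determined by
  \<open>h \<cdot> j\<^sub>V(x) = j\<^sub>V\<^sub>'([h]\<^sup>* x)\<close> with \<open>V' = h V h\<^sup>-\<^sup>1\<close>; the
  choice of the presentation \<open>a\<close> of \<open>w\<close> is immaterial.\<close>

definition limit_act ::
    "'h monoid \<Rightarrow> 'h set set \<Rightarrow> ('h, 'o, 'm::ab_group_add) ric \<Rightarrow>
     ('h, 'm, 'f::field, 'w::ab_group_add) realisation \<Rightarrow> 'h \<Rightarrow> 'w \<Rightarrow> 'w" where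
  "limit_act H \<Upsilon> M W h w =
     (let a = (SOME a. Poly_Mapping.keys a \<subseteq> Sigma \<Upsilon> (val M) \<and> free_eval W a = w)
      in \<Sum>(V, x)\<in>Poly_Mapping.keys a. vscale W (Poly_Mapping.lookup a (V, x))
           (jmap W (conj_by H h V) (pull M (conj_by H h V) V h x)))"


section \<open>Zeta elements\<close>

text \<open>Functions on \<open>G\<close> are extended by zero outside the carrier.\<close>

definition cc_functions ::
    "'g monoid \<Rightarrow> 'g topology \<Rightarrow> 'g set \<Rightarrow> 'w::zero set \<Rightarrow> ('g \<Rightarrow> 'w) set" where
  "cc_functions G T K E =
     {\<xi>. (\<forall>g\<in>carrier G. \<xi> g \<in> E) \<and> (\<forall>g. g \<notin> carrier G \<longrightarrow> \<xi> g = 0) \<and>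
         (\<forall>g\<in>carrier G. \<forall>k\<in>K. \<xi> (g \<otimes>\<^bsub>G\<^esub> k) = \<xi> g) \<and>
         compactin T (T closure_of {g. \<xi> g \<noteq> 0})}"

definition translate ::
    "'g monoid \<Rightarrow> ('h \<Rightarrow> 'g) \<Rightarrow> ('h \<Rightarrow> 'w \<Rightarrow> 'w) \<Rightarrow> 'h \<Rightarrow> ('g \<Rightarrow> 'w::zero) \<Rightarrow> 'g \<Rightarrow> 'w" where
  "translate G \<iota> act h \<xi> g =
     (if g \<in> carrier G then act h (\<xi> (inv\<^bsub>G\<^esub> (\<iota> h) \<otimes>\<^bsub>G\<^esub> g)) else 0)"

text \<open>Kernel of the projection of \<open>C\<close> onto its \<open>H\<close>-coinvariants.\<close>

definition coinvariant_kernel ::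
    "'h monoid \<Rightarrow> 'g monoid \<Rightarrow> ('h \<Rightarrow> 'g) \<Rightarrow> ('f::field \<Rightarrow> 'w \<Rightarrow> 'w) \<Rightarrow> ('h \<Rightarrow> 'w \<Rightarrow> 'w) \<Rightarrow>
     ('g \<Rightarrow> 'w::ab_group_add) set \<Rightarrow> ('g \<Rightarrow> 'w) set" where
  "coinvariant_kernel H G \<iota> s act C =
     module.span (\<lambda>c \<xi> g. s c (\<xi> g)) {translate G \<iota> act h \<xi> - \<xi> | h \<xi>. h \<in> carrier H \<and> \<xi> \<in> C}"

definition is_integral ::
    "'g monoid \<Rightarrow> ('h \<Rightarrow> 'g) \<Rightarrow> 'h set set \<Rightarrow> ('h, 'o, 'm) ric \<Rightarrow>
     ('h, 'm, 'f::field_char_0, 'w::ab_group_add) realisation \<Rightarrow> 'h measure \<Rightarrow>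
     'h set \<Rightarrow> 'g set \<Rightarrow> ('g \<Rightarrow> 'w) \<Rightarrow> bool" where
  "is_integral G \<iota> \<Upsilon> M W \<mu> U L \<xi> \<longleftrightarrow>
     (\<forall>g\<in>carrier G. \<exists>vs.
        (\<forall>(V, x)\<in>set vs. V \<in> \<Upsilon> \<and> \<iota> ` V \<subseteq> conj_by G g L \<and> x \<in> val M V) \<and>
        \<xi> g = (\<Sum>(V, x)\<leftarrow>vs. vscale W (of_rat (haar_index \<mu> U V)) (jmap W V x)))"

definition is_zeta_element ::
    "'h monoid \<Rightarrow> 'g monoid \<Rightarrow> 'g topology \<Rightarrow> ('h \<Rightarrow> 'g) \<Rightarrow> 'h set set \<Rightarrow>
     ('h, 'o, 'm::ab_group_add) ric \<Rightarrow> ('o \<Rightarrow> 'f) \<Rightarrow>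
     ('h, 'm, 'f::field_char_0, 'w::ab_group_add) realisation \<Rightarrow> 'h measure \<Rightarrow>
     'g set \<Rightarrow> 'm \<Rightarrow> ('g \<Rightarrow> 'o) \<Rightarrow> 'g set \<Rightarrow> ('g \<Rightarrow> 'w) \<Rightarrow> bool" where
  "is_zeta_element H G T \<iota> \<Upsilon> M \<phi> W \<mu> K x \<hh> L \<zeta> \<longleftrightarrow>
     (let U = trace_on H \<iota> K; C = cc_functions G T K (limit_space \<Upsilon> M W)
      in \<zeta> \<in> C \<and> is_integral G \<iota> \<Upsilon> M W \<mu> U L \<zeta> \<and>
         \<zeta> - (\<lambda>g. vscale W (\<phi> (\<hh> g)) (jmap W U x))
           \<in> coinvariant_kernel H G \<iota> (vscale W) (limit_act H \<Upsilon> M W) C)"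

definition is_associated_class ::
    "'h monoid \<Rightarrow> 'g monoid \<Rightarrow> ('h \<Rightarrow> 'g) \<Rightarrow> 'h set set \<Rightarrow>
     ('h, 'o, 'm::ab_group_add) ric \<Rightarrow> ('g, 'o, 'n::ab_group_add) ric \<Rightarrow>
     ('h set \<Rightarrow> 'g set \<Rightarrow> 'm \<Rightarrow> 'n) \<Rightarrow>
     ('h, 'm, 'f::field_char_0, 'w::ab_group_add) realisation \<Rightarrow> 'h measure \<Rightarrow>
     'g set \<Rightarrow> 'g set \<Rightarrow> ('g \<Rightarrow> 'w) \<Rightarrow> 'n \<Rightarrow> bool" where
  "is_associated_class H G \<iota> \<Upsilon> MH MG p W \<mu> K L \<zeta> y \<longleftrightarrow>
     (\<exists>bs. (\<forall>(V, x, g)\<in>set bs. V \<in> \<Upsilon> \<and> g \<in> carrier G \<and> \<iota> ` V \<subseteq> conj_by G g L \<and> x \<in> val MH V) \<and>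
        \<zeta> = (\<lambda>g'. \<Sum>(V, x, g)\<leftarrow>bs.
               if g' \<in> g <#\<^bsub>G\<^esub> K
               then vscale W (of_rat (haar_index \<mu> (trace_on H \<iota> K) V)) (jmap W V x) else 0) \<and>
        y = (\<Sum>(V, x, g)\<leftarrow>bs. mixed_hecke H MH G MG \<iota> p V g L x))"


section \<open>Twisted restrictions\<close>

definition is_hecke_function :: "'g monoid \<Rightarrow> 'g set \<Rightarrow> ('g \<Rightarrow> 'o::comm_ring_1) \<Rightarrow> bool" where
  "is_hecke_function G K \<hh> \<longleftrightarrow>
     (\<exists>S c. finite S \<and> S \<subseteq> {dcoset G K g K | g. g \<in> carrier G} \<and>
        \<hh> = (\<lambda>g. \<Sum>D\<in>S. c D * of_bool (g \<in> D)))"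

definition support_dcosets ::
    "'h monoid \<Rightarrow> 'g monoid \<Rightarrow> ('h \<Rightarrow> 'g) \<Rightarrow> 'g set \<Rightarrow> ('g \<Rightarrow> 'o::zero) \<Rightarrow> 'g set set" where
  "support_dcosets H G \<iota> K \<hh> =
     {dcoset G (\<iota> ` carrier H) g K | g. g \<in> (\<iota> ` carrier H) <#>\<^bsub>G\<^esub> {g \<in> carrier G. \<hh> g \<noteq> 0}}"

definition twisted_restriction ::
    "'h monoid \<Rightarrow> 'g monoid \<Rightarrow> ('h \<Rightarrow> 'g) \<Rightarrow> ('g \<Rightarrow> 'o::zero) \<Rightarrow> 'g \<Rightarrow> 'h \<Rightarrow> 'o" where
  "twisted_restriction H G \<iota> \<hh> g h = (if h \<in> carrier H then \<hh> (\<iota> h \<otimes>\<^bsub>G\<^esub> g) else 0)"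

definition transpose_fun :: "'h monoid \<Rightarrow> ('h \<Rightarrow> 'o::zero) \<Rightarrow> 'h \<Rightarrow> 'o" where
  "transpose_fun H f h = (if h \<in> carrier H then f (inv\<^bsub>H\<^esub> h) else 0)"

text \<open>The action of \<open>f = \<Sum> c\<^sub>D ch(D)\<close>, the sum being over double cosets
  \<open>D\<close> in \<open>P\H/U\<close>, on a \<open>U\<close>-invariant vector.
  The coefficient \<open>c\<^sub>D\<close> is the value of \<open>f\<close> on \<open>D\<close>.\<close>

definition dcoset_act ::
    "'h monoid \<Rightarrow> ('f \<Rightarrow> 'w \<Rightarrow> 'w) \<Rightarrow> ('h \<Rightarrow> 'w \<Rightarrow> 'w) \<Rightarrow> ('o \<Rightarrow> 'f) \<Rightarrow> 'h set \<Rightarrow> 'h set \<Rightarrow>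
     ('h \<Rightarrow> 'o::zero) \<Rightarrow> 'w::ab_group_add \<Rightarrow> 'w" where
  "dcoset_act H s act \<phi> P U f w =
     (\<Sum>D\<in>{dcoset H P h U | h. h \<in> carrier H \<and> f h \<noteq> 0}.
        s (\<phi> (f (SOME h. h \<in> D)))
          (\<Sum>B\<in>{\<beta> <#\<^bsub>H\<^esub> U | \<beta>. \<beta> \<in> D}. act (SOME \<beta>. \<beta> \<in> B) w))"

text \<open>The identity relating the Hecke function to a class \<open>y\<close> of level
  \<open>V = H \<inter> g L g\<^sup>-\<^sup>1\<close>, for a representative \<open>g\<close>.\<close>

definition restriction_identity ::
    "'h monoid \<Rightarrow> 'g monoid \<Rightarrow> ('h \<Rightarrow> 'g) \<Rightarrow> 'h set set \<Rightarrow> ('h, 'o, 'm::ab_group_add) ric \<Rightarrow>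
     ('o::zero \<Rightarrow> 'f::field) \<Rightarrow> ('h, 'm, 'f, 'w::ab_group_add) realisation \<Rightarrow>
     'g set \<Rightarrow> 'm \<Rightarrow> ('g \<Rightarrow> 'o) \<Rightarrow> 'g set \<Rightarrow> 'g \<Rightarrow> 'm \<Rightarrow> bool" where
  "restriction_identity H G \<iota> \<Upsilon> M \<phi> W K x \<hh> L g y \<longleftrightarrow>
     (let U = trace_on H \<iota> K; Hg = trace_on H \<iota> (conj_by G g K); V = trace_on H \<iota> (conj_by G g L)
      in dcoset_act H (vscale W) (limit_act H \<Upsilon> M W) \<phi> Hg U
           (transpose_fun H (twisted_restriction H G \<iota> \<hh> g)) (jmap W U x)
         = jmap W Hg (push M V Hg \<one>\<^bsub>H\<^esub> y))"

end

theory Submission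
  imports Defs
begin

text \<open>The \<open>H\<close>-coinvariants of \<open>C(G/K, E)\<close> are the direct sum over \<open>H\G/K\<close> of the
  coinvariants of \<open>E\<close> under the stabilisers \<open>H \<inter> g K g\<^sup>-\<^sup>1\<close>, and in characteristic zero
  averaging identifies these with invariants.  The class of a function is therefore determined by the
  coordinates \<open>\<Sum> e (h\<^sup>-\<^sup>1 \<xi>(h g))\<close>, with \<open>h\<close> running over \<open>H/H\<^sub>g\<close> and \<open>e\<close>
  the averaging operator of \<open>H\<^sub>g\<close>.  For \<open>j\<^sub>U(x) \<otimes> \<hh>\<close> the coordinate is the Hecke
  translate \<open>\<hh>\<^sub>g\<^sup>t j\<^sub>U(x)\<close> up to the factor \<open>[U : H\<^sub>g]\<close>, by unimodularity; for an element
  integral at level \<open>L\<close> it is, up to the same factor, a trace from level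
  \<open>H \<inter> g L g\<^sup>-\<^sup>1\<close>, because \<open>e j\<^sub>V(y) = [V : H\<^sub>g] j(pr\<^sub>* y)\<close> by the Mackey formula.
  Comparing coordinates gives the equivalence, and the traces obtained from a presentation are those
  that compute the associated class; over the double cosets outside the support they vanish, since a
  torsion-free functor embeds into its completion.\<close>

section \<open>Cosets and Haar measure\<close>

text \<open>The weights \<open>[U : V_i]\<close> in the definition of integrality are what makes the
  comparison of coordinates possible. An entry \<open>[U : V] j_V(y)\<close> placed at
  \<open>h g k\<close> has \<open>g\<close>-coordinate \<open>[U : V] [V : H_g] = [U : H_g]\<close>
  times the trace of its transported class. The level \<open>V\<close> of the entry drops out, and
  all entries over one double coset add up inside a single module of level
  \<open>H \<inter> g L g\<^sup>-\<^sup>1\<close>. In the coordinate of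
  \<open>j_U(x) \<otimes> \<hh>\<close> the same factor has another origin: inversion turns a sum
  over \<open>H/H_g\<close> into one over \<open>H/U\<close>, and since it exchanges left and right
  cosets, volumes have to be compared. Before averaging, a summand over \<open>H/H_g\<close> is
  determined only up to the action of \<open>H_g\<close>; hence the average stands inside the sum.
  The completion is known only through generators and relations, so a map out of it is a formula on
  generators together with a proof that the relations are respected; the action and the averages are
  both obtained in this way.\<close>

locale plain_group = group G for G :: "'a monoid" (structure)

text \<open>Makes the coset calculus, with its simp rules, available for \<open>H\<close> and for
  \<open>G\<close> without adding anything to \<open>group\<close> itself.\<close>

sublocale locally_profinite_group \<subseteq> plain_group ..

section \<open>Cosets and conjugates in a bare group\<close>

context plain_group begin

lemma inv_cancel_left [simp]:
  assumes "x \<in> carrier G" "y \<in> carrier G"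
  shows "inv x \<otimes> (x \<otimes> y) = y" "x \<otimes> (inv x \<otimes> y) = y"
  using assms by (simp_all flip: m_assoc)

lemma mem_l_coset_iff:
  assumes "g \<in> carrier G" "A \<subseteq> carrier G"
  shows "x \<in> g <#\<^bsub>G\<^esub> A \<longleftrightarrow> x \<in> carrier G \<and> inv g \<otimes> x \<in> A"
  using assms by (force simp: l_coset_def)

lemma mem_r_coset_iff:
  assumes "g \<in> carrier G" "A \<subseteq> carrier G"
  shows "x \<in> A #> g \<longleftrightarrow> x \<in> carrier G \<and> x \<otimes> inv g \<in> A"
  using assms by (force simp: r_coset_def m_assoc)

lemma mem_conj_by_iff:
  assumes "g \<in> carrier G" "A \<subseteq> carrier G"
  shows "x \<in> conj_by G g A \<longleftrightarrow> x \<in> carrier G \<and> inv g \<otimes> x \<otimes> g \<in> A"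
  using assms by (simp add: conj_by_def mem_r_coset_iff l_coset_subset_G mem_l_coset_iff m_assoc
      cong: conj_cong)

lemma mem_dcoset_iff:
  assumes "g \<in> carrier G" "P \<subseteq> carrier G" "Q \<subseteq> carrier G"
  shows "x \<in> dcoset G P g Q \<longleftrightarrow> (\<exists>p\<in>P. \<exists>q\<in>Q. x = p \<otimes> g \<otimes> q)"
  by (auto simp: dcoset_def r_coset_def set_mult_def)

lemma is_mor_iff:
  assumes "A \<subseteq> carrier G"
  shows "is_mor G A B g \<longleftrightarrow> g \<in> carrier G \<and> (\<forall>a\<in>A. inv g \<otimes> a \<otimes> g \<in> B)"
  using assms by (auto simp: is_mor_def conj_by_def l_coset_def r_coset_def)

lemma conj_by_mult:
  assumes "g \<in> carrier G" "h \<in> carrier G" "A \<subseteq> carrier G"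
  shows "conj_by G (g \<otimes> h) A = conj_by G g (conj_by G h A)"
proof -
  have "conj_by G h A \<subseteq> carrier G" using assms by (auto simp: mem_conj_by_iff)
  then show ?thesis using assms
    by (intro Set.set_eqI) (auto simp: mem_conj_by_iff inv_mult_group m_assoc)
qed

lemma conj_by_one: "A \<subseteq> carrier G \<Longrightarrow> conj_by G \<one> A = A"
  by (intro Set.set_eqI) (auto simp: mem_conj_by_iff)

lemma conj_by_subset_carrier:
  "g \<in> carrier G \<Longrightarrow> A \<subseteq> carrier G \<Longrightarrow> conj_by G g A \<subseteq> carrier G"
  by (auto simp: mem_conj_by_iff)

lemma conj_by_mono: "A \<subseteq> B \<Longrightarrow> conj_by G g A \<subseteq> conj_by G g B"
  by (auto simp: conj_by_def l_coset_def r_coset_def)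

lemma conj_by_inv_cancel:
  assumes "g \<in> carrier G" "A \<subseteq> carrier G"
  shows "conj_by G (inv g) (conj_by G g A) = A" "conj_by G g (conj_by G (inv g) A) = A"
  using assms by (simp_all flip: conj_by_mult add: conj_by_one)

lemma conj_by_self:
  assumes "subgroup A G" "g \<in> A"
  shows "conj_by G g A = A"
proof -
  interpret A: subgroup A G by fact
  have g: "g \<in> carrier G" using assms by auto
  show ?thesis
  proof (intro Set.set_eqI iffI)
    fix x assume "x \<in> conj_by G g A"
    then have x: "x \<in> carrier G" "inv g \<otimes> x \<otimes> g \<in> A" using g by (auto simp: mem_conj_by_iff A.subset)
    have "g \<otimes> (inv g \<otimes> x \<otimes> g) \<otimes> inv g \<in> A" 
      by (intro A.m_closed[OF A.m_closed[OF assms(2) x(2)] A.m_inv_closed[OF assms(2)]])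
    moreover have "g \<otimes> (inv g \<otimes> x \<otimes> g) \<otimes> inv g = x" using x g by (simp add: m_assoc)
    ultimately show "x \<in> A" by simp
  qed (use assms g in \<open>auto simp: mem_conj_by_iff A.subset\<close>)
qed

lemma conj_by_normal:
  assumes "subgroup A G" "N \<lhd> G\<lparr>carrier := A\<rparr>" "g \<in> A"
  shows "conj_by G g N = N"
proof -
  interpret A: subgroup A G by fact
  interpret N: normal N "G\<lparr>carrier := A\<rparr>" by fact
  have sub: "N \<subseteq> A" using N.subset by simp
  have g: "g \<in> carrier G" using assms by auto
  have "N #> g = g <#\<^bsub>G\<^esub> N" using N.coset_eq assms by (simp add: r_coset_def l_coset_def)
  then have "conj_by G g N = (N #> g) #> inv g" by (simp add: conj_by_def)
  also have "\<dots> = N" using g sub A.subset by (subst coset_mult_assoc) (auto simp: coset_mult_one)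
  finally show ?thesis .
qed

lemma l_coset_eq_iff:
  assumes "subgroup P G" "g \<in> carrier G" "h \<in> carrier G"
  shows "g <#\<^bsub>G\<^esub> P = h <#\<^bsub>G\<^esub> P \<longleftrightarrow> inv h \<otimes> g \<in> P"
proof -
  interpret P: subgroup P G by fact
  note mem = mem_l_coset_iff[OF _ P.subset]
  show ?thesis
  proof
    assume "g <#\<^bsub>G\<^esub> P = h <#\<^bsub>G\<^esub> P"
    moreover have "g \<in> g <#\<^bsub>G\<^esub> P" using assms by (simp add: mem)
    ultimately show "inv h \<otimes> g \<in> P" using assms by (simp add: mem)
  next
    assume *: "inv h \<otimes> g \<in> P"
    show "g <#\<^bsub>G\<^esub> P = h <#\<^bsub>G\<^esub> P"
    proof (intro Set.set_eqI)
      fix x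
      have 1: "inv h \<otimes> x = (inv h \<otimes> g) \<otimes> (inv g \<otimes> x)" if "x \<in> carrier G"
        using that assms by (simp add: m_assoc)
      have 2: "inv g \<otimes> x = inv (inv h \<otimes> g) \<otimes> (inv h \<otimes> x)" if "x \<in> carrier G"
        using that assms by (simp add: m_assoc inv_mult_group)
      show "x \<in> g <#\<^bsub>G\<^esub> P \<longleftrightarrow> x \<in> h <#\<^bsub>G\<^esub> P"
        using assms * by (auto simp: mem) (metis 1 2 P.m_closed P.m_inv_closed)+
    qed
  qed
qed

lemma l_coset_self: "subgroup P G \<Longrightarrow> g \<in> carrier G \<Longrightarrow> g \<in> g <#\<^bsub>G\<^esub> P"
  by (simp add: mem_l_coset_iff subgroup.subset subgroup.one_closed)

text \<open>Sums over cosets are evaluated at \<open>SOME\<close> representatives; all that is ever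
  known about such a choice is that it differs from \<open>g\<close> by a right factor in
  \<open>P\<close>.\<close>

lemma l_coset_rep:
  assumes "subgroup P G" "g \<in> carrier G"
  obtains p where "p \<in> P" "(SOME x. x \<in> g <#\<^bsub>G\<^esub> P) = g \<otimes> p"
proof -
  have "(SOME x. x \<in> g <#\<^bsub>G\<^esub> P) \<in> g <#\<^bsub>G\<^esub> P" using l_coset_self[OF assms] by (rule someI)
  then show ?thesis using that by (auto simp: l_coset_def)
qed

end

text \<open>The sum of \<open>F\<close> over \<open>G/P\<close>, meaningful when \<open>F\<close> is right
  \<open>P\<close>-invariant with support finite modulo \<open>P\<close>.\<close>

definition coset_supp :: "'g monoid \<Rightarrow> 'g set \<Rightarrow> ('g \<Rightarrow> 'w::zero) \<Rightarrow> 'g set set" where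
  "coset_supp G P F = (\<lambda>g. g <#\<^bsub>G\<^esub> P) ` {g \<in> carrier G. F g \<noteq> 0}"

definition coset_sum :: "'g monoid \<Rightarrow> 'g set \<Rightarrow> ('g \<Rightarrow> 'w::ab_group_add) \<Rightarrow> 'w" where
  "coset_sum G P F = (\<Sum>B\<in>coset_supp G P F. F (SOME g. g \<in> B))"

definition right_inv :: "'g monoid \<Rightarrow> 'g set \<Rightarrow> ('g \<Rightarrow> 'w) \<Rightarrow> bool" where
  "right_inv G P F \<longleftrightarrow> (\<forall>g\<in>carrier G. \<forall>p\<in>P. F (g \<otimes>\<^bsub>G\<^esub> p) = F g)"

context plain_group begin

lemma right_inv_rep:
  assumes "right_inv G P F" "subgroup P G" "g \<in> carrier G"
  shows "F (SOME x. x \<in> g <#\<^bsub>G\<^esub> P) = F g"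
  using l_coset_rep[OF assms(2,3)] assms(1,3) by (metis right_inv_def)

text \<open>Functions with different supports are compared on a common finite index set: on a coset
  outside the support an invariant function vanishes at whichever representative is chosen.\<close>

lemma coset_sum_superset:
  assumes "right_inv G P F" "subgroup P G" "finite C" "coset_supp G P F \<subseteq> C"
    "C \<subseteq> (\<lambda>g. g <#\<^bsub>G\<^esub> P) ` carrier G"
  shows "coset_sum G P F = (\<Sum>B\<in>C. F (SOME g. g \<in> B))"
  unfolding coset_sum_def
proof (rule sum.mono_neutral_left[OF assms(3,4)], safe)
  fix B assume B: "B \<in> C" "B \<notin> coset_supp G P F"
  then obtain g where g: "g \<in> carrier G" "B = g <#\<^bsub>G\<^esub> P" using assms(5) by auto
  with B have "F g = 0" by (auto simp: coset_supp_def)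
  then show "F (SOME g. g \<in> B) = 0" using right_inv_rep[OF assms(1,2) g(1)] g(2) by simp
qed

lemma coset_supp_subset: "coset_supp G P F \<subseteq> (\<lambda>g. g <#\<^bsub>G\<^esub> P) ` carrier G"
  by (auto simp: coset_supp_def)

lemma coset_supp_mono:
  assumes "\<And>g. g \<in> carrier G \<Longrightarrow> F' g \<noteq> 0 \<Longrightarrow> F g \<noteq> 0"
  shows "coset_supp G P F' \<subseteq> coset_supp G P F"
  using assms by (auto simp: coset_supp_def)

lemma coset_supp_add:
  "coset_supp G P (\<lambda>g. F g + F' g) \<subseteq> coset_supp G P F \<union> coset_supp G P (F' :: _ \<Rightarrow> 'w::ab_group_add)"
  by (auto simp: coset_supp_def)

lemma coset_sum_add:
  fixes F F' :: "'a \<Rightarrow> 'w::ab_group_add"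
  assumes "right_inv G P F" "right_inv G P F'" "subgroup P G"
    "finite (coset_supp G P F)" "finite (coset_supp G P F')"
  shows "coset_sum G P (\<lambda>g. F g + F' g) = coset_sum G P F + coset_sum G P F'"
proof -
  let ?C = "coset_supp G P F \<union> coset_supp G P F'"
  have C: "finite ?C" "?C \<subseteq> (\<lambda>g. g <#\<^bsub>G\<^esub> P) ` carrier G"
    using assms coset_supp_subset by auto
  have "right_inv G P (\<lambda>g. F g + F' g)" using assms by (simp add: right_inv_def)
  from coset_sum_superset[OF this assms(3) C(1) coset_supp_add C(2)]
  show ?thesis
    using coset_sum_superset[OF assms(1,3) C(1) _ C(2)] coset_sum_superset[OF assms(2,3) C(1) _ C(2)]
    by (simp add: sum.distrib)
qed

text \<open>The set \<open>S\<close> is the domain on which \<open>t\<close> is additive. The maps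
  to which this is applied, such as the action and the averages, are known to be additive on the
  limit space only.\<close>

lemma coset_sum_additive:
  assumes "right_inv G P F" "subgroup P G" "finite (coset_supp G P F)"
    and S: "\<And>g. g \<in> carrier G \<Longrightarrow> F g \<in> S" "0 \<in> S" "\<And>x y. x \<in> S \<Longrightarrow> y \<in> S \<Longrightarrow> x + y \<in> S"
    and t: "t 0 = 0" "\<And>x y. x \<in> S \<Longrightarrow> y \<in> S \<Longrightarrow> t (x + y) = t x + t y"
  shows "coset_sum G P (\<lambda>g. t (F g)) = t (coset_sum G P F)" and "coset_sum G P F \<in> S"
proof -
  have *: "sum f A \<in> S \<and> t (sum f A) = (\<Sum>a\<in>A. t (f a))" if "\<And>a. a \<in> A \<Longrightarrow> f a \<in> S"
    for f and A :: "'a set set"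
    using that by (induction A rule: infinite_finite_induct) (auto simp: S t)
  have F: "F (SOME g. g \<in> B) \<in> S" if "B \<in> coset_supp G P F" for B
    using that S(1) by (auto simp: coset_supp_def right_inv_rep[OF assms(1,2)])
  have "right_inv G P (\<lambda>g. t (F g))" using assms by (simp add: right_inv_def)
  then have "coset_sum G P (\<lambda>g. t (F g)) = (\<Sum>B\<in>coset_supp G P F. t (F (SOME g. g \<in> B)))"
    by (rule coset_sum_superset[OF _ assms(2,3) coset_supp_mono coset_supp_subset]) (auto simp: t)
  then show "coset_sum G P (\<lambda>g. t (F g)) = t (coset_sum G P F)" "coset_sum G P F \<in> S"
    using *[OF F] by (simp_all add: coset_sum_def)
qed

lemma coset_sum_single:
  assumes "right_inv G P F" "subgroup P G" "h \<in> carrier G"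
    "\<And>g. g \<in> carrier G \<Longrightarrow> F g \<noteq> 0 \<Longrightarrow> inv h \<otimes> g \<in> P"
  shows "coset_sum G P F = F h"
proof -
  have "coset_sum G P F = (\<Sum>B\<in>{h <#\<^bsub>G\<^esub> P}. F (SOME g. g \<in> B))"
  proof (rule coset_sum_superset[OF assms(1,2)])
    show "coset_supp G P F \<subseteq> {h <#\<^bsub>G\<^esub> P}"
    proof
      fix B assume "B \<in> coset_supp G P F"
      then obtain g where "g \<in> carrier G" "F g \<noteq> 0" "B = g <#\<^bsub>G\<^esub> P" by (auto simp: coset_supp_def)
      then show "B \<in> {h <#\<^bsub>G\<^esub> P}" using assms(3,4) by (simp add: l_coset_eq_iff[OF assms(2)])
    qed
  qed (use assms in auto)
  then show ?thesis using right_inv_rep[OF assms(1-3)] by simp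
qed

lemma coset_sum_zero: "(\<And>g. g \<in> carrier G \<Longrightarrow> F g = 0) \<Longrightarrow> coset_sum G P F = 0"
  unfolding coset_sum_def coset_supp_def by (rule sum.neutral) auto

lemma coset_sum_cong:
  assumes "right_inv G P F" "subgroup P G" "\<And>g. g \<in> carrier G \<Longrightarrow> F g = F' g"
  shows "coset_sum G P F = coset_sum G P F'"
proof -
  interpret P: subgroup P G by fact
  have "right_inv G P F'" using assms by (auto simp: right_inv_def)
  moreover have "coset_supp G P F = coset_supp G P F'"
    using assms(3) by (auto simp: coset_supp_def image_iff)
  ultimately show ?thesis using assms unfolding coset_sum_def
    by (intro sum.cong) (auto simp: coset_supp_def right_inv_rep)
qed

text \<open>Left translation by \<open>h\<close> permutes the cosets \<open>g P\<close>, and by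
  invariance the value on a coset does not depend on the representative.\<close>

lemma coset_sum_translate:
  assumes "right_inv G P F" "subgroup P G" "h \<in> carrier G"
  shows "coset_sum G P (\<lambda>g. F (h \<otimes> g)) = coset_sum G P F"
proof -
  interpret P: subgroup P G by fact
  have r: "right_inv G P (\<lambda>g. F (h \<otimes> g))"
    using assms by (auto simp: right_inv_def simp flip: m_assoc)
  have lm: "x <#\<^bsub>G\<^esub> (g <#\<^bsub>G\<^esub> P) = (x \<otimes> g) <#\<^bsub>G\<^esub> P" if "x \<in> carrier G" "g \<in> carrier G" for x g
    using that lcos_m_assoc P.subset by blast
  have bij: "bij_betw (\<lambda>B. h <#\<^bsub>G\<^esub> B) (coset_supp G P (\<lambda>g. F (h \<otimes> g))) (coset_supp G P F)"
  proof (rule bij_betw_byWitness[where f' = "\<lambda>B. inv h <#\<^bsub>G\<^esub> B"])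
    show "(\<lambda>B. inv h <#\<^bsub>G\<^esub> B) ` coset_supp G P F \<subseteq> coset_supp G P (\<lambda>g. F (h \<otimes> g))"
      using assms by (force simp: coset_supp_def lm intro!: imageI)
  qed (use assms in \<open>auto simp: coset_supp_def lm\<close>)
  show ?thesis unfolding coset_sum_def
    by (rule sum.reindex_bij_betw[OF bij, THEN trans[rotated]], rule sum.cong)
       (use assms in \<open>auto simp: coset_supp_def lm right_inv_rep[OF assms(1,2)] right_inv_rep[OF r assms(2)]\<close>)
qed

end

section \<open>Translates of open and compact sets; finiteness of coset spaces\<close>

context locally_profinite_group begin

lemma continuous_left_mult:
  assumes "g \<in> carrier G"
  shows "continuous_map T T (\<lambda>x. g \<otimes> x)"
proof -
  have "continuous_map T (prod_topology T T) (\<lambda>x. (g, x))"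
    using assms by (intro continuous_map_pairedI) (auto simp: topspace)
  from continuous_map_compose[OF this continuous_mult] show ?thesis
    by (simp add: o_def)
qed

lemma continuous_right_mult:
  assumes "g \<in> carrier G"
  shows "continuous_map T T (\<lambda>x. x \<otimes> g)"
proof -
  have "continuous_map T (prod_topology T T) (\<lambda>x. (x, g))"
    using assms by (intro continuous_map_pairedI) (auto simp: topspace)
  from continuous_map_compose[OF this continuous_mult] show ?thesis
    by (simp add: o_def)
qed

lemma openin_subset_carrier: "openin T V \<Longrightarrow> V \<subseteq> carrier G"
  using openin_subset topspace by auto

lemma openin_l_coset:
  assumes "openin T V" "g \<in> carrier G"
  shows "openin T (g <#\<^bsub>G\<^esub> V)"
proof -
  have "openin T {x \<in> topspace T. inv g \<otimes> x \<in> V}"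
    using assms by (intro openin_continuous_map_preimage[OF continuous_left_mult]) auto
  also have "{x \<in> topspace T. inv g \<otimes> x \<in> V} = g <#\<^bsub>G\<^esub> V"
    using assms by (auto simp: mem_l_coset_iff openin_subset_carrier topspace)
  finally show ?thesis .
qed

lemma openin_r_coset:
  assumes "openin T V" "g \<in> carrier G"
  shows "openin T (V #> g)"
proof -
  have "openin T {x \<in> topspace T. x \<otimes> inv g \<in> V}"
    using assms by (intro openin_continuous_map_preimage[OF continuous_right_mult]) auto
  also have "{x \<in> topspace T. x \<otimes> inv g \<in> V} = V #> g"
    using assms by (auto simp: mem_r_coset_iff openin_subset_carrier topspace)
  finally show ?thesis .
qed

lemma compactin_l_coset:
  assumes "compactin T V" "g \<in> carrier G"
  shows "compactin T (g <#\<^bsub>G\<^esub> V)"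
proof -
  have "g <#\<^bsub>G\<^esub> V = (\<lambda>x. g \<otimes> x) ` V" by (auto simp: l_coset_def)
  then show ?thesis using image_compactin[OF assms(1) continuous_left_mult] assms(2) by simp
qed

text \<open>A double coset is the image under multiplication of a product of two compact
  sets.\<close>

lemma compactin_dcoset:
  assumes "compactin T P" "compactin T Q" "g \<in> carrier G"
  shows "compactin T (dcoset G P g Q)"
proof -
  have "dcoset G P g Q = (\<lambda>(x, y). x \<otimes> y) ` ((\<lambda>x. x \<otimes> g) ` P \<times> Q)"
    by (force simp: dcoset_def r_coset_def set_mult_def)
  moreover have "compactin (prod_topology T T) ((\<lambda>x. x \<otimes> g) ` P \<times> Q)"
    using assms image_compactin[OF assms(1) continuous_right_mult[OF assms(3)]]
    by (simp add: compactin_Times)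
  ultimately show ?thesis using image_compactin[OF _ continuous_mult] by metis
qed

text \<open>The cosets of an open subgroup are an open cover by pairwise disjoint sets, so a finite
  subcover of \<open>C\<close> already contains every coset that meets \<open>C\<close>.\<close>

lemma finite_l_cosets:
  assumes "compactin T C" "subgroup V G" "openin T V"
  shows "finite ((\<lambda>g. g <#\<^bsub>G\<^esub> V) ` C)"
proof -
  have sub: "C \<subseteq> carrier G" using assms(1) compactin_subset_topspace topspace by blast
  have "\<exists>\<F>. finite \<F> \<and> \<F> \<subseteq> (\<lambda>g. g <#\<^bsub>G\<^esub> V) ` carrier G \<and> C \<subseteq> \<Union>\<F>"
    using l_coset_self[OF assms(2)] sub
    by (intro assms(1)[unfolded compactin_def, THEN conjunct2, rule_format])
       (auto intro!: openin_l_coset assms)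
  then obtain \<F> where F: "finite \<F>" "\<F> \<subseteq> (\<lambda>g. g <#\<^bsub>G\<^esub> V) ` carrier G" "C \<subseteq> \<Union>\<F>" by blast
  have "(\<lambda>g. g <#\<^bsub>G\<^esub> V) ` C \<subseteq> \<F>"
  proof (rule image_subsetI)
    fix g assume g: "g \<in> C"
    then obtain B where B: "B \<in> \<F>" "g \<in> B" using F(3) by auto
    then obtain h where h: "h \<in> carrier G" "h <#\<^bsub>G\<^esub> V \<in> \<F>" "g \<in> h <#\<^bsub>G\<^esub> V" using F(2) by auto
    then have "g <#\<^bsub>G\<^esub> V = h <#\<^bsub>G\<^esub> V"
      using g sub assms(2) by (auto simp: l_coset_eq_iff mem_l_coset_iff subgroup.subset)
    with h show "g <#\<^bsub>G\<^esub> V \<in> \<F>" by simp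
  qed
  then show ?thesis using F(1) finite_subset by blast
qed

lemma finite_r_cosets:
  assumes "compactin T C" "subgroup V G" "openin T V"
  shows "finite ((\<lambda>g. V #> g) ` C)"
proof -
  have sub: "C \<subseteq> carrier G" using assms(1) compactin_subset_topspace topspace by blast
  have "\<exists>\<F>. finite \<F> \<and> \<F> \<subseteq> (\<lambda>g. V #> g) ` carrier G \<and> C \<subseteq> \<Union>\<F>"
    using rcos_self[OF _ assms(2)] sub
    by (intro assms(1)[unfolded compactin_def, THEN conjunct2, rule_format])
       (auto intro!: openin_r_coset assms)
  then obtain \<F> where F: "finite \<F>" "\<F> \<subseteq> (\<lambda>g. V #> g) ` carrier G" "C \<subseteq> \<Union>\<F>" by blast
  have "(\<lambda>g. V #> g) ` C \<subseteq> \<F>"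
  proof (rule image_subsetI)
    fix g assume g: "g \<in> C"
    then obtain B where B: "B \<in> \<F>" "g \<in> B" using F(3) by auto
    then obtain h where "h \<in> carrier G" "V #> h \<in> \<F>" "g \<in> V #> h" using F(2) by auto
    then show "V #> g \<in> \<F>" using repr_independence[OF _ _ assms(2)] by metis
  qed
  then show ?thesis using F(1) finite_subset by blast
qed

end

section \<open>Volumes of levels and their indices\<close>

locale haar_level = level_collection G T \<Upsilon>
  for G :: "'g monoid" (structure) and T and \<Upsilon> +
  fixes \<mu> :: "'g measure"
  assumes haar: "left_haar_measure G T \<mu>"
    and unimod: "unimodular G T"
begin

lemma level_subgroup: "V \<in> \<Upsilon> \<Longrightarrow> subgroup V G"
  and level_open: "V \<in> \<Upsilon> \<Longrightarrow> openin T V"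
  and level_compact: "V \<in> \<Upsilon> \<Longrightarrow> compactin T V"
  using compact_open by auto

lemma level_subset: "V \<in> \<Upsilon> \<Longrightarrow> V \<subseteq> carrier G"
  using level_subgroup subgroup.subset by blast

lemma open_measurable: "openin T S \<Longrightarrow> S \<in> sets \<mu>"
  using haar by (auto simp: left_haar_measure_def)

lemma level_measurable [simp]: "V \<in> \<Upsilon> \<Longrightarrow> V \<in> sets \<mu>"
  using open_measurable level_open by auto

lemma emeasure_l_coset: "g \<in> carrier G \<Longrightarrow> A \<in> sets \<mu> \<Longrightarrow> emeasure \<mu> (g <#\<^bsub>G\<^esub> A) = emeasure \<mu> A"
  using haar by (auto simp: left_haar_measure_def)

lemma emeasure_r_coset: "g \<in> carrier G \<Longrightarrow> A \<in> sets \<mu> \<Longrightarrow> emeasure \<mu> (A #> g) = emeasure \<mu> A"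
  using haar unimod by (auto simp: unimodular_def)

lemma emeasure_level_finite: "V \<in> \<Upsilon> \<Longrightarrow> emeasure \<mu> V \<noteq> \<infinity>"
  using haar level_compact by (force simp: left_haar_measure_def)

text \<open>A compact set is covered by finitely many translates of \<open>V\<close>. If
  \<open>V\<close> were null, every compact set would be null, and by inner regularity so would the
  whole group, against the nontriviality of the measure.\<close>

lemma emeasure_level_nonzero:
  assumes "V \<in> \<Upsilon>"
  shows "emeasure \<mu> V \<noteq> 0"
proof
  assume V0: "emeasure \<mu> V = 0"
  have "emeasure \<mu> C = 0" if C: "compactin T C" for C
  proof -
    have sub: "C \<subseteq> carrier G" using C compactin_subset_topspace topspace by blast
    let ?F = "(\<lambda>g. g <#\<^bsub>G\<^esub> V) ` C"
    have fin: "finite ?F" using finite_l_cosets[OF C] level_subgroup level_open assms by blast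
    have null: "B \<in> null_sets \<mu>" if "B \<in> ?F" for B
      using that sub assms V0
      by (auto simp: null_sets_def emeasure_l_coset open_measurable openin_l_coset level_open subset_iff)
    have "\<Union>?F \<in> null_sets \<mu>" using fin null by (intro null_sets.finite_Union) auto
    moreover have "C \<subseteq> \<Union>?F"
      using l_coset_self[OF level_subgroup[OF assms]] sub by auto
    ultimately show ?thesis
      by (metis emeasure_mono le_zero_eq null_setsD1 null_setsD2)
  qed
  then have "(SUP C\<in>{C. compactin T C \<and> C \<subseteq> topspace T}. emeasure \<mu> C) \<le> 0"
    by (intro SUP_least) auto
  moreover have "emeasure \<mu> (topspace T) = (SUP C\<in>{C. compactin T C \<and> C \<subseteq> topspace T}. emeasure \<mu> C)"
    using haar unfolding left_haar_measure_def by (meson openin_topspace)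
  ultimately show False using haar by (auto simp: left_haar_measure_def)
qed

lemma measure_level_pos: "V \<in> \<Upsilon> \<Longrightarrow> measure \<mu> V > 0"
  using emeasure_level_nonzero[of V] emeasure_level_finite[of V]
  by (metis emeasure_eq_ennreal_measure ennreal_0 infinity_ennreal_def less_eq_real_def
      measure_nonneg)

lemma measure_disjoint_Union:
  assumes "finite \<F>" "disjoint \<F>" "V \<in> \<Upsilon>"
    "\<And>B. B \<in> \<F> \<Longrightarrow> B \<in> sets \<mu> \<and> emeasure \<mu> B = emeasure \<mu> V"
  shows "measure \<mu> (\<Union>\<F>) = card \<F> * measure \<mu> V"
proof -
  have "measure \<mu> (\<Union>B\<in>\<F>. B) = (\<Sum>B\<in>\<F>. measure \<mu> B)"
    using assms emeasure_level_finite[OF assms(3)]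
    by (intro measure_finite_Union) (auto simp: disjoint_def disjoint_family_on_def)
  also have "\<dots> = (\<Sum>B\<in>\<F>. measure \<mu> V)"
    using assms by (intro sum.cong) (auto simp: measure_def)
  finally show ?thesis by simp
qed

text \<open>A set stable under right multiplication by \<open>V\<close> is a disjoint union of left
  cosets, all of the volume of \<open>V\<close>; counting cosets is therefore the same as
  measuring.\<close>

lemma measure_l_invariant:
  assumes "V \<in> \<Upsilon>" "S \<subseteq> carrier G" "finite ((\<lambda>g. g <#\<^bsub>G\<^esub> V) ` S)"
    "\<And>s v. s \<in> S \<Longrightarrow> v \<in> V \<Longrightarrow> s \<otimes> v \<in> S"
  shows "measure \<mu> S = card ((\<lambda>g. g <#\<^bsub>G\<^esub> V) ` S) * measure \<mu> V"
proof -
  note V = level_subgroup[OF assms(1)] level_subset[OF assms(1)]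
  have "S = \<Union>((\<lambda>g. g <#\<^bsub>G\<^esub> V) ` S)"
  proof (intro equalityI subsetI)
    fix x assume "x \<in> S"
    then show "x \<in> \<Union>((\<lambda>g. g <#\<^bsub>G\<^esub> V) ` S)" using assms(2) l_coset_self[OF V(1)] by blast
  qed (use assms(4) in \<open>auto simp: l_coset_def\<close>)
  moreover have "disjoint ((\<lambda>g. g <#\<^bsub>G\<^esub> V) ` S)"
    unfolding disjoint_def
  proof (intro ballI impI equals0I)
    fix A B x assume AB: "A \<in> (\<lambda>g. g <#\<^bsub>G\<^esub> V) ` S" "B \<in> (\<lambda>g. g <#\<^bsub>G\<^esub> V) ` S" "A \<noteq> B"
      and x: "x \<in> A \<inter> B"
    obtain g h where gh: "g \<in> carrier G" "h \<in> carrier G" "A = g <#\<^bsub>G\<^esub> V" "B = h <#\<^bsub>G\<^esub> V"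
      using AB assms(2) by blast
    then have "x \<in> carrier G" "x <#\<^bsub>G\<^esub> V = A" "x <#\<^bsub>G\<^esub> V = B"
      using x V by (auto simp: l_coset_eq_iff mem_l_coset_iff)
    with AB show False by simp
  qed
  moreover have "B \<in> sets \<mu> \<and> emeasure \<mu> B = emeasure \<mu> V" if "B \<in> (\<lambda>g. g <#\<^bsub>G\<^esub> V) ` S" for B
    using that assms by (auto simp: emeasure_l_coset open_measurable openin_l_coset level_open subset_iff)
  ultimately show ?thesis
    using measure_disjoint_Union[OF assms(3) _ assms(1)] by presburger
qed

text \<open>The mirror image of the previous count; right cosets have the volume of \<open>V\<close>
  because the group is unimodular.\<close>

lemma measure_r_invariant:
  assumes "V \<in> \<Upsilon>" "S \<subseteq> carrier G" "finite ((\<lambda>g. V #> g) ` S)"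
    "\<And>s v. s \<in> S \<Longrightarrow> v \<in> V \<Longrightarrow> v \<otimes> s \<in> S"
  shows "measure \<mu> S = card ((\<lambda>g. V #> g) ` S) * measure \<mu> V"
proof -
  note V = level_subgroup[OF assms(1)] level_subset[OF assms(1)]
  have "S = \<Union>((\<lambda>g. V #> g) ` S)"
  proof (intro equalityI subsetI)
    fix x assume "x \<in> S"
    then show "x \<in> \<Union>((\<lambda>g. V #> g) ` S)" using assms(2) rcos_self[OF _ V(1)] by blast
  qed (use assms(4) in \<open>auto simp: r_coset_def\<close>)
  moreover have "disjoint ((\<lambda>g. V #> g) ` S)"
    unfolding disjoint_def
  proof (intro ballI impI equals0I)
    fix A B x assume AB: "A \<in> (\<lambda>g. V #> g) ` S" "B \<in> (\<lambda>g. V #> g) ` S" "A \<noteq> B"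
      and x: "x \<in> A \<inter> B"
    obtain g h where gh: "g \<in> carrier G" "h \<in> carrier G" "A = V #> g" "B = V #> h"
      using AB assms(2) by blast
    then have "A = V #> x" "B = V #> x" using x repr_independence[OF _ _ V(1)] by auto
    with AB show False by simp
  qed
  moreover have "B \<in> sets \<mu> \<and> emeasure \<mu> B = emeasure \<mu> V" if "B \<in> (\<lambda>g. V #> g) ` S" for B
    using that assms by (auto simp: emeasure_r_coset open_measurable openin_r_coset level_open subset_iff)
  ultimately show ?thesis
    using measure_disjoint_Union[OF assms(3) _ assms(1)] by presburger
qed

lemma measure_subgroup:
  assumes "V \<in> \<Upsilon>" "P \<in> \<Upsilon>" "V \<subseteq> P"
  shows "measure \<mu> P = card (rcosets\<^bsub>G\<lparr>carrier := P\<rparr>\<^esub> V) * measure \<mu> V"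
proof -
  have "rcosets\<^bsub>G\<lparr>carrier := P\<rparr>\<^esub> V = (\<lambda>g. V #> g) ` P"
    by (auto simp: RCOSETS_def r_coset_def)
  moreover have "measure \<mu> P = card ((\<lambda>g. V #> g) ` P) * measure \<mu> V"
    using assms subgroup.m_closed[OF level_subgroup[OF assms(2)]]
    by (intro measure_r_invariant finite_r_cosets level_compact level_subgroup level_open level_subset) auto
  ultimately show ?thesis by simp
qed

text \<open>Both volumes are positive integral multiples of the volume of
  \<open>U \<inter> V\<close>, so their ratio is rational and the description in
  \<open>haar_index\<close> denotes it.\<close>

lemma real_haar_index:
  assumes "U \<in> \<Upsilon>" "V \<in> \<Upsilon>"
  shows "real_of_rat (haar_index \<mu> U V) = measure \<mu> U / measure \<mu> V"
proof -
  let ?n = "\<lambda>P. card (rcosets\<^bsub>G\<lparr>carrier := P\<rparr>\<^esub> (U \<inter> V))"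
  have W: "U \<inter> V \<in> \<Upsilon>" using T3 assms by auto
  have "measure \<mu> U = ?n U * measure \<mu> (U \<inter> V)" "measure \<mu> V = ?n V * measure \<mu> (U \<inter> V)"
    using measure_subgroup[OF W] assms by auto
  then have r: "real_of_rat (of_nat (?n U) / of_nat (?n V)) = measure \<mu> U / measure \<mu> V" (is "real_of_rat ?r = _")
    using measure_level_pos[OF W] by (simp add: of_rat_divide)
  then have "haar_index \<mu> U V = ?r"
    unfolding haar_index_def by (intro the_equality) (metis of_rat_eq_iff)+
  with r show ?thesis by simp
qed

lemma haar_index_nonzero: "U \<in> \<Upsilon> \<Longrightarrow> V \<in> \<Upsilon> \<Longrightarrow> haar_index \<mu> U V \<noteq> 0"
  using measure_level_pos[of U] measure_level_pos[of V] real_haar_index[of U V] by auto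

lemma haar_index_mult:
  assumes "U \<in> \<Upsilon>" "V \<in> \<Upsilon>" "P \<in> \<Upsilon>"
  shows "haar_index \<mu> U V * haar_index \<mu> V P = haar_index \<mu> U P"
proof -
  have "real_of_rat (haar_index \<mu> U V * haar_index \<mu> V P) = real_of_rat (haar_index \<mu> U P)"
    using assms measure_level_pos[of V] by (simp add: of_rat_mult real_haar_index)
  then show ?thesis by (simp only: of_rat_eq_iff)
qed

text \<open>Ties the ratio of volumes to the degree that occurs in the cohomological
  relation.\<close>

lemma haar_index_subset:
  assumes "V \<in> \<Upsilon>" "P \<in> \<Upsilon>" "V \<subseteq> P"
  shows "haar_index \<mu> P V = of_nat (card (rcosets\<^bsub>G\<lparr>carrier := P\<rparr>\<^esub> V))"
proof -
  have "real_of_rat (haar_index \<mu> P V) = real_of_rat (of_nat (card (rcosets\<^bsub>G\<lparr>carrier := P\<rparr>\<^esub> V)))"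
    using assms measure_level_pos[of V] by (simp add: real_haar_index measure_subgroup[OF assms])
  then show ?thesis by (simp only: of_rat_eq_iff)
qed

text \<open>A conjugate is a left and a right translate at once, so this also rests on
  unimodularity.\<close>

lemma measure_conj:
  assumes "V \<in> \<Upsilon>" "g \<in> carrier G"
  shows "measure \<mu> (conj_by G g V) = measure \<mu> V"
  using assms openin_l_coset[OF level_open]
  by (simp add: conj_by_def measure_def emeasure_r_coset emeasure_l_coset open_measurable)

lemma haar_index_conj:
  assumes "U \<in> \<Upsilon>" "V \<in> \<Upsilon>" "g \<in> carrier G"
  shows "haar_index \<mu> U (conj_by G g V) = haar_index \<mu> U V"
    and "haar_index \<mu> (conj_by G g U) V = haar_index \<mu> U V"
  using assms by (simp_all add: haar_index_def measure_conj)

end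

lemma (in plain_group) inv_image_l_coset:
  assumes "subgroup P G" "g \<in> carrier G"
  shows "m_inv G ` (g <#\<^bsub>G\<^esub> P) = P #> inv g"
proof -
  interpret P: subgroup P G by fact
  show ?thesis
  proof (intro equalityI subsetI)
    fix x assume "x \<in> P #> inv g"
    then obtain p where p: "p \<in> P" "x = p \<otimes> inv g" by (auto simp: r_coset_def)
    then have "x = inv (g \<otimes> inv p)" using assms by (simp add: inv_mult_group)
    moreover have "g \<otimes> inv p \<in> g <#\<^bsub>G\<^esub> P" using p by (auto simp: l_coset_def)
    ultimately show "x \<in> m_inv G ` (g <#\<^bsub>G\<^esub> P)" by blast
  qed (use assms in \<open>auto simp: l_coset_def r_coset_def inv_mult_group\<close>)
qed

context haar_level begin

text \<open>Sorting the cosets by the value of \<open>F\<close> leaves a sum that depends on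
  \<open>P\<close> only through the number of cosets in each level set. These numbers are what can
  be compared between two subgroups.\<close>

lemma coset_sum_level_sets:
  fixes s :: "'f::field_char_0 \<Rightarrow> 'w::ab_group_add \<Rightarrow> 'w"
  assumes "vector_space s" "right_inv G P F" "subgroup P G" "finite (coset_supp G P F)"
  shows "coset_sum G P F =
    (\<Sum>v\<in>F ` carrier G - {0}. s (of_nat (card ((\<lambda>g. g <#\<^bsub>G\<^esub> P) ` {g \<in> carrier G. F g = v}))) v)"
proof -
  interpret vector_space s by fact
  let ?rep = "\<lambda>B. SOME g. g \<in> B"
  note rep = right_inv_rep[OF assms(2,3)]
  have im: "(\<lambda>B. F (?rep B)) ` coset_supp G P F = F ` carrier G - {0}"
    by (auto simp: coset_supp_def rep image_iff intro!: bexI)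
  have "coset_sum G P F =
      (\<Sum>v\<in>F ` carrier G - {0}. \<Sum>B\<in>{B \<in> coset_supp G P F. F (?rep B) = v}. F (?rep B))"
    unfolding coset_sum_def using sum.image_gen[OF assms(4), of "\<lambda>B. F (?rep B)" "\<lambda>B. F (?rep B)"]
    by (simp add: im)
  also have "\<dots> = (\<Sum>v\<in>F ` carrier G - {0}. s (of_nat (card ((\<lambda>g. g <#\<^bsub>G\<^esub> P) ` {g \<in> carrier G. F g = v}))) v)"
  proof (rule sum.cong[OF refl])
    fix v assume v: "v \<in> F ` carrier G - {0}"
    have eq: "{B \<in> coset_supp G P F. F (?rep B) = v} = (\<lambda>g. g <#\<^bsub>G\<^esub> P) ` {g \<in> carrier G. F g = v}"
      using v by (auto simp: coset_supp_def rep)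
    have c: "s (of_nat (card A)) v = (\<Sum>a\<in>A. v)" for A :: "'g set set"
      using scale_sum_left[of "\<lambda>_. 1" A v] by simp
    show "(\<Sum>B\<in>{B \<in> coset_supp G P F. F (?rep B) = v}. F (?rep B))
        = s (of_nat (card ((\<lambda>g. g <#\<^bsub>G\<^esub> P) ` {g \<in> carrier G. F g = v}))) v"
      unfolding c eq[symmetric] by (rule sum.cong) auto
  qed
  finally show ?thesis .
qed

text \<open>Both sides integrate \<open>F\<close> over \<open>G\<close>; the level sets of \<open>F\<close> are unions of
  right cosets of \<open>P\<close> as well as of left cosets of \<open>U\<close>.\<close>

lemma coset_sum_inverse:
  fixes s :: "'f::field_char_0 \<Rightarrow> 'w::ab_group_add \<Rightarrow> 'w"
  assumes "vector_space s" "U \<in> \<Upsilon>" "P \<in> \<Upsilon>"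
    and U: "right_inv G U F" "finite (coset_supp G U F)"
    and P: "right_inv G P (\<lambda>g. F (inv g))" "finite (coset_supp G P (\<lambda>g. F (inv g)))"
  shows "s (of_rat (haar_index \<mu> U P)) (coset_sum G U F) = coset_sum G P (\<lambda>g. F (inv g))"
proof -
  interpret vector_space s by fact
  note subg = level_subgroup[OF assms(2)] level_subgroup[OF assms(3)]
  define S where "S v = {g \<in> carrier G. F g = v}" for v
  define S' where "S' v = {g \<in> carrier G. F (inv g) = v}" for v
  have im: "(\<lambda>g. F (inv g)) ` carrier G = F ` carrier G"
  proof (intro equalityI image_subsetI)
    fix g assume "g \<in> carrier G"
    then show "F g \<in> (\<lambda>g. F (inv g)) ` carrier G" by (intro image_eqI[of _ _ "inv g"]) auto
  qed auto
  \<comment> \<open>The volume of one level set is counted twice, by cosets \<open>g U\<close> and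
    by cosets \<open>P g\<close>; inversion matches the latter with the cosets \<open>g P\<close> of
    \<open>S' v\<close>. The value 0 is excluded because its level set need not consist of finitely
    many cosets.\<close>
  have count: "of_rat (haar_index \<mu> U P) * of_nat (card ((\<lambda>g. g <#\<^bsub>G\<^esub> U) ` S v))
      = (of_nat (card ((\<lambda>g. g <#\<^bsub>G\<^esub> P) ` S' v)) :: 'f)" if v: "v \<noteq> 0" for v
  proof -
    have "bij_betw (image (m_inv G)) ((\<lambda>g. g <#\<^bsub>G\<^esub> P) ` S' v) ((\<lambda>g. P #> g) ` S v)"
    proof (rule bij_betw_imageI)
      show "inj_on (image (m_inv G)) ((\<lambda>g. g <#\<^bsub>G\<^esub> P) ` S' v)"
      proof (rule inj_on_image)
        have "\<Union> ((\<lambda>g. g <#\<^bsub>G\<^esub> P) ` S' v) \<subseteq> carrier G"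
          using level_subset[OF assms(3)] by (auto simp: S'_def mem_l_coset_iff)
        then show "inj_on (m_inv G) (\<Union> ((\<lambda>g. g <#\<^bsub>G\<^esub> P) ` S' v))" using inj_on_subset[OF inv_inj] by blast
      qed
      have "m_inv G ` S' v = S v"
      proof (intro equalityI subsetI)
        fix g assume "g \<in> S v"
        then show "g \<in> m_inv G ` S' v" by (intro image_eqI[of _ _ "inv g"]) (auto simp: S_def S'_def)
      qed (auto simp: S_def S'_def)
      moreover have "image (m_inv G) ` (\<lambda>g. g <#\<^bsub>G\<^esub> P) ` S' v = (\<lambda>g. P #> g) ` m_inv G ` S' v"
        unfolding image_image using inv_image_l_coset[OF subg(2)] by (intro image_cong) (auto simp: S'_def)
      ultimately show "image (m_inv G) ` (\<lambda>g. g <#\<^bsub>G\<^esub> P) ` S' v = (\<lambda>g. P #> g) ` S v" by simp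
    qed
    note bij = this
    have "(\<lambda>g. g <#\<^bsub>G\<^esub> U) ` S v \<subseteq> coset_supp G U F" using v by (auto simp: coset_supp_def S_def)
    then have 1: "measure \<mu> (S v) = card ((\<lambda>g. g <#\<^bsub>G\<^esub> U) ` S v) * measure \<mu> U"
      using U level_subset[OF assms(2)]
      by (intro measure_l_invariant[OF assms(2)]) (auto intro: finite_subset simp: S_def right_inv_def)
    have "(\<lambda>g. g <#\<^bsub>G\<^esub> P) ` S' v \<subseteq> coset_supp G P (\<lambda>g. F (inv g))" using v by (auto simp: coset_supp_def S'_def)
    then have "finite ((\<lambda>g. P #> g) ` S v)"
      using P(2) bij_betw_finite[OF bij] finite_subset by blast
    \<comment> \<open>Right \<open>P\<close>-invariance of the inverted function is left
      \<open>P\<close>-invariance of \<open>F\<close>.\<close>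
    moreover have "p \<otimes> g \<in> S v" if "g \<in> S v" "p \<in> P" for g p
    proof -
      have gp: "g \<in> carrier G" "p \<in> carrier G" using that level_subset[OF assms(3)] by (auto simp: S_def)
      have "F (inv (inv g \<otimes> inv p)) = F (inv (inv g))"
        using P(1) that subgroup.m_inv_closed[OF subg(2)] gp unfolding right_inv_def by blast
      then show ?thesis using gp that by (simp add: S_def inv_mult_group)
    qed
    ultimately have 2: "measure \<mu> (S v) = card ((\<lambda>g. P #> g) ` S v) * measure \<mu> P"
      by (intro measure_r_invariant[OF assms(3)]) (auto simp: S_def)
    have "real_of_rat (haar_index \<mu> U P * of_nat (card ((\<lambda>g. g <#\<^bsub>G\<^esub> U) ` S v)))
        = real_of_rat (of_nat (card ((\<lambda>g. g <#\<^bsub>G\<^esub> P) ` S' v)))"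
      using 1 2 bij_betw_same_card[OF bij] measure_level_pos[OF assms(3)] assms
      by (simp add: of_rat_mult real_haar_index field_simps)
    then have "haar_index \<mu> U P * of_nat (card ((\<lambda>g. g <#\<^bsub>G\<^esub> U) ` S v)) = of_nat (card ((\<lambda>g. g <#\<^bsub>G\<^esub> P) ` S' v))"
      by (simp only: of_rat_eq_iff)
    then show ?thesis by (metis of_rat_mult of_rat_of_nat_eq)
  qed
  show ?thesis
    unfolding coset_sum_level_sets[OF assms(1) U(1) subg(1) U(2)]
      coset_sum_level_sets[OF assms(1) P(1) subg(2) P(2)] im scale_sum_right
    by (rule sum.cong) (auto simp flip: S_def S'_def simp: count)
qed

end

section \<open>Spaces given by generators and relations\<close>

text \<open>With \<open>F = jmap W\<close> this is \<open>free_eval\<close>. Leaving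
  \<open>F\<close> free makes it the common shape of every map out of the completion that is
  prescribed on generators.\<close>

definition gen_eval ::
    "('f \<Rightarrow> 'w \<Rightarrow> 'w) \<Rightarrow> ('a \<Rightarrow> 'b \<Rightarrow> 'w) \<Rightarrow> ('a \<times> 'b \<Rightarrow>\<^sub>0 'f::field) \<Rightarrow> 'w::ab_group_add" where
  "gen_eval s F a = (\<Sum>(V, x)\<in>Poly_Mapping.keys a. s (Poly_Mapping.lookup a (V, x)) (F V x))"

context vector_space begin

lemma gen_eval_superset:
  assumes "finite A" "Poly_Mapping.keys a \<subseteq> A"
  shows "gen_eval scale F a = (\<Sum>(V, x)\<in>A. Poly_Mapping.lookup a (V, x) *s F V x)"
  unfolding gen_eval_def using assms
  by (intro sum.mono_neutral_left) (auto simp: in_keys_iff)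

lemma gen_eval_zero [simp]: "gen_eval scale F 0 = 0"
  by (simp add: gen_eval_def)

lemma gen_eval_single [simp]: "gen_eval scale F (Poly_Mapping.single (V, x) c) = c *s F V x"
  by (simp add: gen_eval_superset[of "{(V, x)}"])

lemma gen_eval_add: "gen_eval scale F (a + b) = gen_eval scale F a + gen_eval scale F b"
proof -
  let ?A = "Poly_Mapping.keys a \<union> Poly_Mapping.keys b"
  have "Poly_Mapping.keys (a + b) \<subseteq> ?A" by (rule keys_add)
  then show ?thesis
    by (simp add: gen_eval_superset[of ?A] split_beta lookup_add scale_left_distrib sum.distrib)
qed

lemma gen_eval_uminus: "gen_eval scale F (- a) = - gen_eval scale F a"
  using gen_eval_add[of F a "- a"] by (simp add: minus_unique)

lemma gen_eval_diff: "gen_eval scale F (a - b) = gen_eval scale F a - gen_eval scale F b"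
  using gen_eval_add[of F a "- b"] by (simp add: gen_eval_uminus)

end

lemma lookup_free_scale: "Poly_Mapping.lookup (free_scale c a) k = c * Poly_Mapping.lookup a k"
  by (simp add: free_scale_def Poly_Mapping.map.rep_eq when_def)

lemma keys_free_scale: "Poly_Mapping.keys (free_scale c a) \<subseteq> Poly_Mapping.keys a"
  by (auto simp: in_keys_iff lookup_free_scale)

lemma vector_space_free_scale: "vector_space free_scale"
  by standard (auto intro!: poly_mapping_eqI simp: lookup_free_scale lookup_add algebra_simps)

lemma (in vector_space) gen_eval_scale: "gen_eval scale F (free_scale c a) = c *s gen_eval scale F a"
  by (simp add: gen_eval_superset[of "Poly_Mapping.keys a"] keys_free_scale split_beta
      lookup_free_scale scale_sum_right)

section \<open>Linearity and the basic morphisms of RIC functors\<close>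

context ric_functor begin

lemma
  assumes "K \<in> \<Upsilon>"
  shows val_zero [simp]: "0 \<in> val M K"
    and val_add: "x \<in> val M K \<Longrightarrow> y \<in> val M K \<Longrightarrow> x + y \<in> val M K"
    and val_smul: "x \<in> val M K \<Longrightarrow> smul M a x \<in> val M K"
  using submodule[OF assms] ambient_module by (simp_all add: module.subspace_def)

lemma val_sum: "K \<in> \<Upsilon> \<Longrightarrow> (\<And>i. i \<in> A \<Longrightarrow> f i \<in> val M K) \<Longrightarrow> sum f A \<in> val M K"
  by (induction A rule: infinite_finite_induct) (auto simp: val_add)

lemma
  assumes "L \<in> \<Upsilon>" "K \<in> \<Upsilon>" "is_mor G L K g"
  shows pull_in: "x \<in> val M K \<Longrightarrow> pull M L K g x \<in> val M L"
    and pull_add: "x \<in> val M K \<Longrightarrow> y \<in> val M K \<Longrightarrow> pull M L K g (x + y) = pull M L K g x + pull M L K g y"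
    and pull_smul: "x \<in> val M K \<Longrightarrow> pull M L K g (smul M a x) = smul M a (pull M L K g x)"
    and push_in: "x \<in> val M L \<Longrightarrow> push M L K g x \<in> val M K"
    and push_add: "x \<in> val M L \<Longrightarrow> y \<in> val M L \<Longrightarrow> push M L K g (x + y) = push M L K g x + push M L K g y"
    and push_smul: "x \<in> val M L \<Longrightarrow> push M L K g (smul M a x) = smul M a (push M L K g x)"
  using pull_linear[OF assms] push_linear[OF assms] by (auto simp: linear_between_def)

lemma level_subset_carrier: "K \<in> \<Upsilon> \<Longrightarrow> K \<subseteq> carrier G"
  using compact_open subgroup.subset by blast

lemma is_mor_one: "L \<in> \<Upsilon> \<Longrightarrow> L \<subseteq> K \<Longrightarrow> is_mor G L K \<one>"
  using level_subset_carrier[of L] by (auto simp: is_mor_iff subset_iff)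

lemma is_mor_conj: "K \<in> \<Upsilon> \<Longrightarrow> g \<in> carrier G \<Longrightarrow> is_mor G (conj_by G g K) K g"
  using level_subset_carrier[of K] by (simp add: is_mor_iff conj_by_subset_carrier mem_conj_by_iff)

lemma is_mor_self: "K \<in> \<Upsilon> \<Longrightarrow> g \<in> K \<Longrightarrow> is_mor G K K g"
  using is_mor_conj[of K g] conj_by_self[of K g] compact_open[of K] level_subset_carrier[of K] by auto

end

text \<open>The relations of the limit turned into conditions on a family of maps: the hypothesis of
  the universal property of the limit.\<close>

definition compatible ::
    "'g monoid \<Rightarrow> 'g set set \<Rightarrow> ('g, 'o, 'm::ab_group_add) ric \<Rightarrow> ('o \<Rightarrow> 'f::field) \<Rightarrow>
     ('f \<Rightarrow> 'w \<Rightarrow> 'w) \<Rightarrow> ('g set \<Rightarrow> 'm \<Rightarrow> 'w::ab_group_add) \<Rightarrow> bool" where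
  "compatible G \<Upsilon> M \<phi> s F \<longleftrightarrow>
     (\<forall>V\<in>\<Upsilon>. \<forall>x\<in>val M V. \<forall>y\<in>val M V. F V (x + y) = F V x + F V y) \<and>
     (\<forall>V\<in>\<Upsilon>. \<forall>x\<in>val M V. \<forall>a. F V (smul M a x) = s (\<phi> a) (F V x)) \<and>
     (\<forall>V\<in>\<Upsilon>. \<forall>V'\<in>\<Upsilon>. \<forall>x\<in>val M V. V' \<subseteq> V \<longrightarrow> F V' (pull M V' V \<one>\<^bsub>G\<^esub> x) = F V x)"

text \<open>The elements on which the evaluation vanishes form a subspace, and compatibility places
  every relation in it.\<close>

lemma gen_eval_relations:
  fixes s :: "'f::field \<Rightarrow> 'w::ab_group_add \<Rightarrow> 'w" and M :: "('g, 'o, 'm::ab_group_add) ric"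
  assumes "vector_space s" "compatible G \<Upsilon> M \<phi> s F"
    "a \<in> module.span free_scale (tensor_relations \<phi> \<Upsilon> M \<union> limit_relations G \<Upsilon> M)"
  shows "gen_eval s F a = 0"
proof -
  interpret vector_space s by fact
  interpret fr: vector_space "free_scale :: 'f \<Rightarrow> ('g set \<times> 'm \<Rightarrow>\<^sub>0 'f) \<Rightarrow> _" by (rule vector_space_free_scale)
  have "fr.subspace {a. gen_eval s F a = 0}"
    by (rule fr.subspaceI) (auto simp: gen_eval_add gen_eval_scale)
  moreover have "tensor_relations \<phi> \<Upsilon> M \<union> limit_relations G \<Upsilon> M \<subseteq> {a. gen_eval s F a = 0}"
    using assms(2)
    by (auto simp: tensor_relations_def limit_relations_def compatible_def gen_eval_diff)
  ultimately show ?thesis using assms(3) fr.span_minimal by blast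
qed

section \<open>The completion\<close>

locale completion = comack_functor H T \<Upsilon> M + haar_level H T \<Upsilon> \<mu>
  for H :: "'h monoid" (structure) and T \<Upsilon> \<mu>
    and M :: "('h, 'o::{idom,ring_char_0}, 'm::ab_group_add) ric" +
  fixes \<phi> :: "'o \<Rightarrow> 'f::field_char_0"
    and W :: "('h, 'm, 'f, 'w::ab_group_add) realisation"
  assumes phi_inj: "inj \<phi>" and phi_one: "\<phi> 1 = 1"
    and phi_add: "\<phi> (a + b) = \<phi> a + \<phi> b" and phi_mult: "\<phi> (a * b) = \<phi> a * \<phi> b"
    and completion: "is_completion H \<Upsilon> M \<phi> W"
begin

abbreviation vsc (infixr \<open>\<odot>\<close> 75) where "vsc \<equiv> vscale W"
abbreviation j where "j \<equiv> jmap W"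
abbreviation lim where "lim \<equiv> limit_space \<Upsilon> M W"
abbreviation act where "act \<equiv> limit_act H \<Upsilon> M W"
abbreviation index :: "'h set \<Rightarrow> 'h set \<Rightarrow> 'f" where "index U V \<equiv> of_rat (haar_index \<mu> U V)"

sublocale W: vector_space vsc
  using completion by (simp add: is_completion_def)

lemma phi_zero [simp]: "\<phi> 0 = 0"
  using phi_add[of 0 0] by simp

lemma phi_eq_zero_iff [simp]: "\<phi> a = 0 \<longleftrightarrow> a = 0"
  using inj_eq[OF phi_inj, of a 0] by simp

lemma phi_of_nat [simp]: "\<phi> (of_nat n) = of_nat n"
  by (induction n) (auto simp: phi_one phi_add)

abbreviation presented where
  "presented a \<equiv> Poly_Mapping.keys a \<subseteq> Sigma \<Upsilon> (val M)"

lemma free_eval_eq: "free_eval W a = gen_eval vsc j a"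
  by (simp add: free_eval_def gen_eval_def)

lemma presented_add: "presented a \<Longrightarrow> presented b \<Longrightarrow> presented (a + b)"
  using keys_add[of a b] by blast

lemma presented_diff: "presented a \<Longrightarrow> presented b \<Longrightarrow> presented (a - b)"
  using keys_diff[of a b] by blast

lemma presented_scale: "presented a \<Longrightarrow> presented (free_scale c a)"
  using keys_free_scale[of c a] by blast

lemma presented_single: "V \<in> \<Upsilon> \<Longrightarrow> x \<in> val M V \<Longrightarrow> presented (Poly_Mapping.single (V, x) c)"
  by auto

lemma eval_relation:
  assumes "a \<in> tensor_relations \<phi> \<Upsilon> M \<union> limit_relations H \<Upsilon> M" "presented a"
  shows "gen_eval vsc j a = 0"
proof -
  interpret fr: vector_space "free_scale :: 'f \<Rightarrow> ('h set \<times> 'm \<Rightarrow>\<^sub>0 'f) \<Rightarrow> _" by (rule vector_space_free_scale)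
  show ?thesis using completion assms fr.span_base[OF assms(1)]
    by (simp add: is_completion_def free_eval_eq)
qed

lemma compatible_j: "compatible H \<Upsilon> M \<phi> vsc j"
  unfolding compatible_def
proof (intro conjI ballI allI impI)
  fix V x y assume V: "V \<in> \<Upsilon>" "x \<in> val M V" "y \<in> val M V"
  have "gen_eval vsc j (Poly_Mapping.single (V, x + y) 1 - Poly_Mapping.single (V, x) 1
      - Poly_Mapping.single (V, y) 1) = 0"
    by (rule eval_relation, use V in \<open>unfold tensor_relations_def, blast\<close>, intro presented_diff presented_single)
       (use V in \<open>auto simp: val_add\<close>)
  then have "j V (x + y) - j V x - j V y = 0" by (simp add: W.gen_eval_diff)
  then show "j V (x + y) = j V x + j V y" by (simp add: algebra_simps)
next
  fix V x a assume V: "V \<in> \<Upsilon>" "x \<in> val M V"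
  have "gen_eval vsc j (Poly_Mapping.single (V, smul M a x) 1 - Poly_Mapping.single (V, x) (\<phi> a)) = 0"
    by (rule eval_relation, use V in \<open>unfold tensor_relations_def, blast\<close>, intro presented_diff presented_single)
       (use V in \<open>auto simp: val_smul\<close>)
  then show "j V (smul M a x) = \<phi> a \<odot> j V x" by (simp add: W.gen_eval_diff)
next
  fix V V' x assume V: "V \<in> \<Upsilon>" "V' \<in> \<Upsilon>" "x \<in> val M V" "V' \<subseteq> V"
  have "gen_eval vsc j (Poly_Mapping.single (V', pull M V' V \<one> x) 1 - Poly_Mapping.single (V, x) 1) = 0"
    by (rule eval_relation, use V in \<open>unfold limit_relations_def, blast\<close>, intro presented_diff presented_single)
       (use V in \<open>auto intro: pull_in is_mor_one\<close>)
  then show "j V' (pull M V' V \<one> x) = j V x" by (simp add: W.gen_eval_diff)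
qed

lemma j_add: "V \<in> \<Upsilon> \<Longrightarrow> x \<in> val M V \<Longrightarrow> y \<in> val M V \<Longrightarrow> j V (x + y) = j V x + j V y"
  and j_smul: "V \<in> \<Upsilon> \<Longrightarrow> x \<in> val M V \<Longrightarrow> j V (smul M a x) = \<phi> a \<odot> j V x"
  and j_pull: "V \<in> \<Upsilon> \<Longrightarrow> V' \<in> \<Upsilon> \<Longrightarrow> x \<in> val M V \<Longrightarrow> V' \<subseteq> V \<Longrightarrow> j V' (pull M V' V \<one> x) = j V x"
  using compatible_j by (auto simp: compatible_def)

lemma j_zero: "V \<in> \<Upsilon> \<Longrightarrow> j V 0 = 0"
  using j_add[of V 0 0] by simp

lemma j_sum: "V \<in> \<Upsilon> \<Longrightarrow> (\<And>i. i \<in> A \<Longrightarrow> f i \<in> val M V) \<Longrightarrow> j V (sum f A) = (\<Sum>i\<in>A. j V (f i))"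
  by (induction A rule: infinite_finite_induct) (auto simp: j_zero j_add val_sum)

lemma limI: "presented a \<Longrightarrow> gen_eval vsc j a \<in> lim"
  by (auto simp: limit_space_def free_eval_eq)

lemma limE:
  assumes "w \<in> lim"
  obtains a where "presented a" "w = gen_eval vsc j a"
  using assms by (auto simp: limit_space_def free_eval_eq)

lemma lim_subspace: "W.subspace lim"
proof (rule W.subspaceI)
  show "0 \<in> lim" using limI[of 0] by simp
next
  fix v w assume "v \<in> lim" "w \<in> lim"
  then show "v + w \<in> lim" by (metis limE limI presented_add W.gen_eval_add)
next
  fix c w assume "w \<in> lim"
  then show "c \<odot> w \<in> lim" by (metis limE limI presented_scale W.gen_eval_scale)
qed

lemmas lim_zero [simp] = W.subspace_0[OF lim_subspace]
  and lim_add = W.subspace_add[OF lim_subspace]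
  and lim_scale = W.subspace_scale[OF lim_subspace]

lemma lim_j: "V \<in> \<Upsilon> \<Longrightarrow> x \<in> val M V \<Longrightarrow> j V x \<in> lim"
  using limI[of "Poly_Mapping.single (V, x) 1"] by simp

text \<open>Reduces an additive statement to multiples of generators, by induction on the terms of a
  presentation. Membership of the partial sums in \<open>lim\<close> is carried along because the
  case \<open>add\<close> supplies it as a hypothesis.\<close>

lemma lim_induct [consumes 1, case_names zero add j]:
  assumes "w \<in> lim" "P 0"
    and add: "\<And>v w. v \<in> lim \<Longrightarrow> w \<in> lim \<Longrightarrow> P v \<Longrightarrow> P w \<Longrightarrow> P (v + w)"
    and gen: "\<And>c V x. V \<in> \<Upsilon> \<Longrightarrow> x \<in> val M V \<Longrightarrow> P (c \<odot> j V x)"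
  shows "P w"
proof -
  obtain a where a: "presented a" "w = gen_eval vsc j a" using limE assms(1) by blast
  have "(\<Sum>k\<in>A. Poly_Mapping.lookup a k \<odot> j (fst k) (snd k)) \<in> lim \<and>
      P (\<Sum>k\<in>A. Poly_Mapping.lookup a k \<odot> j (fst k) (snd k))"
    if "finite A" "A \<subseteq> Sigma \<Upsilon> (val M)" for A
    using that
  proof (induction A rule: finite_induct)
    case (insert k A)
    then have "fst k \<in> \<Upsilon>" "snd k \<in> val M (fst k)" by auto
    then show ?case using insert by (auto intro!: lim_add add gen lim_scale lim_j)
  qed (simp add: assms)
  from this[of "Poly_Mapping.keys a"] a show ?thesis
    by (simp add: gen_eval_def split_beta)
qed

text \<open>The map out of the completion induced by \<open>F\<close>. It chooses a presentation in
  the same way as \<open>limit_act\<close>, so that the action is literally an instance.\<close>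

definition lift :: "('h set \<Rightarrow> 'm \<Rightarrow> 'w) \<Rightarrow> 'w \<Rightarrow> 'w" where
  "lift F w = gen_eval vsc F (SOME a. presented a \<and> free_eval W a = w)"

text \<open>Two presentations of one vector differ by an element of the kernel of the evaluation. By
  exactness this kernel is spanned by the relations, which a compatible family kills.\<close>

lemma lift_eval:
  assumes "compatible H \<Upsilon> M \<phi> vsc F" "presented a"
  shows "lift F (gen_eval vsc j a) = gen_eval vsc F a"
proof -
  define b where "b = (SOME b. presented b \<and> free_eval W b = gen_eval vsc j a)"
  have b: "presented b" "free_eval W b = gen_eval vsc j a"
    using someI[of "\<lambda>b. presented b \<and> free_eval W b = gen_eval vsc j a" a] assms(2)
    by (auto simp: b_def free_eval_eq)
  then have "free_eval W (b - a) = 0" by (simp add: free_eval_eq W.gen_eval_diff)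
  then have "b - a \<in> module.span free_scale (tensor_relations \<phi> \<Upsilon> M \<union> limit_relations H \<Upsilon> M)"
    using completion presented_diff[OF b(1) assms(2)] by (simp add: is_completion_def)
  from gen_eval_relations[OF W.vector_space_axioms assms(1) this]
  show ?thesis by (simp add: lift_def b_def[symmetric] W.gen_eval_diff)
qed

context
  fixes F assumes F: "compatible H \<Upsilon> M \<phi> vsc F"
begin

lemma lift_add: "v \<in> lim \<Longrightarrow> w \<in> lim \<Longrightarrow> lift F (v + w) = lift F v + lift F w"
  by (elim limE) (simp add: lift_eval[OF F] presented_add flip: W.gen_eval_add)

lemma lift_scale: "w \<in> lim \<Longrightarrow> lift F (c \<odot> w) = c \<odot> lift F w"
  by (elim limE) (simp add: lift_eval[OF F] presented_scale flip: W.gen_eval_scale)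

lemma lift_j: "V \<in> \<Upsilon> \<Longrightarrow> x \<in> val M V \<Longrightarrow> lift F (j V x) = F V x"
  using lift_eval[OF F, of "Poly_Mapping.single (V, x) 1"] by simp

end

section \<open>The action on the completion\<close>

lemma act_eq_lift: "act h = lift (\<lambda>V x. j (conj_by H h V) (pull M (conj_by H h V) V h x))"
  by (rule ext) (simp add: limit_act_def lift_def gen_eval_def Let_def)

text \<open>Both sides are the pullback along \<open>h\<close>, factored once as
  \<open>h \<otimes> \<one>\<close> and once as \<open>\<one> \<otimes> h\<close>.\<close>

lemma conj_mono_pull:
  assumes "V \<in> \<Upsilon>" "V' \<in> \<Upsilon>" "V' \<subseteq> V" "x \<in> val M V" "h \<in> carrier H"
  shows "pull M (conj_by H h V') V' h (pull M V' V \<one> x)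
    = pull M (conj_by H h V') (conj_by H h V) \<one> (pull M (conj_by H h V) V h x)"
proof -
  note T = T1[OF _ assms(5)]
  have "pull M (conj_by H h V') V' h (pull M V' V \<one> x) = pull M (conj_by H h V') V (h \<otimes> \<one>) x"
    using assms T by (intro pull_comp[symmetric]) (auto intro: is_mor_conj is_mor_one)
  also have "\<dots> = pull M (conj_by H h V') V (\<one> \<otimes> h) x" using assms by simp
  also have "\<dots> = pull M (conj_by H h V') (conj_by H h V) \<one> (pull M (conj_by H h V) V h x)"
    using assms T by (intro pull_comp is_mor_conj is_mor_one conj_by_mono)
  finally show ?thesis .
qed

lemma compatible_act:
  assumes "h \<in> carrier H"
  shows "compatible H \<Upsilon> M \<phi> vsc (\<lambda>V x. j (conj_by H h V) (pull M (conj_by H h V) V h x))"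
  unfolding compatible_def using assms T1 is_mor_conj conj_by_mono
  by (auto simp: pull_add pull_smul pull_in j_add j_smul conj_mono_pull j_pull)

lemma
  assumes "h \<in> carrier H"
  shows act_add: "v \<in> lim \<Longrightarrow> w \<in> lim \<Longrightarrow> act h (v + w) = act h v + act h w"
    and act_scale: "w \<in> lim \<Longrightarrow> act h (c \<odot> w) = c \<odot> act h w"
    and act_j: "V \<in> \<Upsilon> \<Longrightarrow> x \<in> val M V \<Longrightarrow>
      act h (j V x) = j (conj_by H h V) (pull M (conj_by H h V) V h x)"
  unfolding act_eq_lift using compatible_act[OF assms]
  by (simp_all add: lift_add lift_scale lift_j)

lemma act_zero: "h \<in> carrier H \<Longrightarrow> act h 0 = 0"
  using act_add[of h 0 0] by simp

lemma act_lim: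
  assumes "h \<in> carrier H" "w \<in> lim"
  shows "act h w \<in> lim"
  using assms(2,1) T1 is_mor_conj
  by (induction rule: lim_induct)
     (auto simp: act_zero act_add act_scale act_j lim_j intro!: lim_add lim_scale lim_j pull_in)

lemma act_mult:
  assumes "g \<in> carrier H" "h \<in> carrier H" "w \<in> lim"
  shows "act (g \<otimes> h) w = act g (act h w)"
  using assms(3)
proof (induction rule: lim_induct)
  case (j c V x)
  note T = T1[OF j(1) assms(2)]
  have "pull M (conj_by H (g \<otimes> h) V) V (g \<otimes> h) x
      = pull M (conj_by H g (conj_by H h V)) (conj_by H h V) g (pull M (conj_by H h V) V h x)"
    using j assms T T1[OF T assms(1)] level_subset_carrier
    by (simp add: conj_by_mult pull_comp is_mor_conj)
  then show ?case using j assms T level_subset_carrier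
    by (simp add: act_scale act_j lim_j act_lim pull_in is_mor_conj conj_by_mult)
qed (use assms in \<open>simp_all add: act_zero act_add act_lim\<close>)

text \<open>The axiom on inner elements speaks of pushforwards; since \<open>h\<close> normalises
  \<open>V\<close>, pulling back along \<open>h\<close> is pushing forward along its
  inverse.\<close>

lemma pull_level_element:
  assumes "V \<in> \<Upsilon>" "h \<in> V" "x \<in> val M V"
  shows "pull M V V h x = x"
proof -
  have V: "subgroup V H" "h \<in> carrier H" using assms level_subset level_subgroup by auto
  have "pull M V V h x = push M V V (inv h) x"
    using assms V conj_by_self[OF V(1), of "inv h"] subgroup.m_inv_closed[OF V(1)]
    by (intro pull_eq_push) auto
  then show ?thesis using push_inner assms subgroup.m_inv_closed[OF V(1)] by simp
qed

lemma act_fixed: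
  assumes "V \<in> \<Upsilon>" "h \<in> V" "x \<in> val M V"
  shows "act h (j V x) = j V x"
  using assms level_subset level_subgroup conj_by_self[of V h] pull_level_element
  by (subst act_j) auto

lemma act_one: "w \<in> lim \<Longrightarrow> act \<one> w = w"
  by (induction rule: lim_induct)
     (auto simp: act_zero act_add act_scale lim_j intro!: arg_cong2[of _ _ _ _ vsc] act_fixed
       subgroup.one_closed level_subgroup)

lemma act_inv_cancel:
  assumes "h \<in> carrier H" "w \<in> lim"
  shows "act (inv h) (act h w) = w" "act h (act (inv h) w) = w"
  using assms by (simp_all flip: act_mult add: act_one)

subsection \<open>Averaging over a level\<close>

text \<open>The projection onto the \<open>P\<close>-invariants is defined by means of the cohomological
  relation alone; only the comparison with a sum over cosets requires the Mackey formula.\<close>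

definition average :: "'h set \<Rightarrow> 'w \<Rightarrow> 'w" where
  "average P = lift (\<lambda>V x. index (V \<inter> P) P \<odot>
      j P (push M (V \<inter> P) P \<one> (pull M (V \<inter> P) V \<one> x)))"

lemma index_mult: "U \<in> \<Upsilon> \<Longrightarrow> V \<in> \<Upsilon> \<Longrightarrow> P \<in> \<Upsilon> \<Longrightarrow> index U V * index V P = index U P"
  by (simp flip: of_rat_mult add: haar_index_mult)

lemma index_nonzero: "U \<in> \<Upsilon> \<Longrightarrow> V \<in> \<Upsilon> \<Longrightarrow> index U V \<noteq> 0"
  by (simp add: haar_index_nonzero)

text \<open>Replacing \<open>V\<close> by a smaller \<open>V'\<close> multiplies the trace by
  \<open>[V \<inter> P : V' \<inter> P]\<close>, by the cohomological relation. The normalising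
  index changes by the inverse factor.\<close>

lemma compatible_average:
  assumes P: "P \<in> \<Upsilon>"
  shows "compatible H \<Upsilon> M \<phi> vsc (\<lambda>V x. index (V \<inter> P) P \<odot>
      j P (push M (V \<inter> P) P \<one> (pull M (V \<inter> P) V \<one> x)))"
  unfolding compatible_def
proof (intro conjI ballI allI impI)
  fix V V' x assume V: "V \<in> \<Upsilon>" "V' \<in> \<Upsilon>" "x \<in> val M V" "V' \<subseteq> V"
  define A A' where "A = V \<inter> P" and "A' = V' \<inter> P"
  have A: "A \<in> \<Upsilon>" "A' \<in> \<Upsilon>" "A' \<subseteq> A" "A \<subseteq> V" "A \<subseteq> P" "A' \<subseteq> V'"
    using V P T3 by (auto simp: A_def A'_def)
  then have mor: "is_mor H A V \<one>" "is_mor H A P \<one>" "is_mor H A' A \<one>" "is_mor H A' V' \<one>" "is_mor H V' V \<one>"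
    using V by (auto intro!: is_mor_one)
  define n where "n = card (rcosets\<^bsub>H\<lparr>carrier := A\<rparr>\<^esub> A')"
  have z: "pull M A V \<one> x \<in> val M A" using A V mor by (simp add: pull_in)
  have "pull M A' V' \<one> (pull M V' V \<one> x) = pull M A' A \<one> (pull M A V \<one> x)"
    using A V mor by (simp flip: pull_comp)
  then have "push M A' P \<one> (pull M A' V' \<one> (pull M V' V \<one> x))
      = push M A P \<one> (push M A' A \<one> (pull M A' A \<one> (pull M A V \<one> x)))"
    using push_comp[OF A(2,1) P mor(3,2), of "pull M A' A \<one> (pull M A V \<one> x)"] z A mor
    by (simp add: pull_in)
  also have "\<dots> = smul M (of_nat n) (push M A P \<one> (pull M A V \<one> x))"
    using A z mor P by (simp add: cohomological n_def push_smul)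
  finally have "index A' P \<odot> j P (push M A' P \<one> (pull M A' V' \<one> (pull M V' V \<one> x)))
      = (index A' P * of_nat n) \<odot> j P (push M A P \<one> (pull M A V \<one> x))"
    using z A mor P by (simp add: j_smul push_in)
  moreover have "index A A' = of_nat n" using A by (simp add: haar_index_subset n_def)
  then have "index A' P * of_nat n = index A P" using index_mult[of A A' P] A P by (simp add: mult.commute)
  ultimately show "index (V' \<inter> P) P \<odot> j P (push M (V' \<inter> P) P \<one> (pull M (V' \<inter> P) V' \<one> (pull M V' V \<one> x)))
      = index (V \<inter> P) P \<odot> j P (push M (V \<inter> P) P \<one> (pull M (V \<inter> P) V \<one> x))"
    by (simp add: A_def A'_def)
next
  fix V x y assume V: "V \<in> \<Upsilon>" "x \<in> val M V" "y \<in> val M V"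
  then have "V \<inter> P \<in> \<Upsilon>" "is_mor H (V \<inter> P) V \<one>" "is_mor H (V \<inter> P) P \<one>"
    using P T3 by (auto intro!: is_mor_one)
  then show "index (V \<inter> P) P \<odot> j P (push M (V \<inter> P) P \<one> (pull M (V \<inter> P) V \<one> (x + y))) =
      index (V \<inter> P) P \<odot> j P (push M (V \<inter> P) P \<one> (pull M (V \<inter> P) V \<one> x)) +
      index (V \<inter> P) P \<odot> j P (push M (V \<inter> P) P \<one> (pull M (V \<inter> P) V \<one> y))"
    using V P by (simp add: pull_add push_add pull_in push_in j_add W.scale_right_distrib)
next
  fix V x a assume V: "V \<in> \<Upsilon>" "x \<in> val M V"
  then have "V \<inter> P \<in> \<Upsilon>" "is_mor H (V \<inter> P) V \<one>" "is_mor H (V \<inter> P) P \<one>"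
    using P T3 by (auto intro!: is_mor_one)
  then show "index (V \<inter> P) P \<odot> j P (push M (V \<inter> P) P \<one> (pull M (V \<inter> P) V \<one> (smul M a x))) =
      \<phi> a \<odot> index (V \<inter> P) P \<odot> j P (push M (V \<inter> P) P \<one> (pull M (V \<inter> P) V \<one> x))"
    using V P by (simp add: pull_smul push_smul pull_in push_in j_smul mult.commute)
qed

context
  fixes P assumes P: "P \<in> \<Upsilon>"
begin

lemma average_add: "v \<in> lim \<Longrightarrow> w \<in> lim \<Longrightarrow> average P (v + w) = average P v + average P w"
  and average_scale: "w \<in> lim \<Longrightarrow> average P (c \<odot> w) = c \<odot> average P w"
  and average_j': "V \<in> \<Upsilon> \<Longrightarrow> x \<in> val M V \<Longrightarrow> average P (j V x) =
    index (V \<inter> P) P \<odot> j P (push M (V \<inter> P) P \<one> (pull M (V \<inter> P) V \<one> x))"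
  unfolding average_def using compatible_average[OF P]
  by (simp_all add: lift_add lift_scale lift_j)

lemma average_zero: "average P 0 = 0"
  using average_add[of 0 0] by simp

lemma average_j:
  assumes "V \<in> \<Upsilon>" "x \<in> val M V" "V \<subseteq> P"
  shows "average P (j V x) = index V P \<odot> j P (push M V P \<one> x)"
  using assms by (simp add: average_j' pull_id Int_absorb2)

text \<open>As \<open>h\<close> lies in \<open>P\<close>, conjugation by \<open>h\<close> carries
  \<open>V \<inter> P\<close> to \<open>h V h\<^sup>-\<^sup>1 \<inter> P\<close>. The pullback along
  \<open>h\<close> becomes a pushforward along its inverse, which can be moved past the trace and is
  then inner at level \<open>P\<close>, hence trivial.\<close>

lemma average_act:
  assumes "h \<in> P" "w \<in> lim"
  shows "average P (act h w) = average P w"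
  using assms(2)
proof (induction rule: lim_induct)
  case (j c V x)
  have sub: "subgroup P H" using level_subgroup P by blast
  have h: "h \<in> carrier H" "inv h \<in> P" "inv h \<in> carrier H"
    using assms(1) P level_subset subgroup.m_inv_closed[OF sub] by auto
  define A where "A = V \<inter> P"
  define z where "z = pull M A V \<one> x"
  have A: "A \<in> \<Upsilon>" "A \<subseteq> V" "A \<subseteq> P" using T3 P j by (auto simp: A_def)
  have cA: "conj_by H h V \<inter> P = conj_by H h A"
  proof -
    have "conj_by H h P = P" using conj_by_self[OF sub assms(1)] .
    then show ?thesis using h level_subset j(1) P
      by (auto simp: A_def mem_conj_by_iff set_eq_iff le_infI1)
  qed
  have U: "conj_by H h V \<in> \<Upsilon>" "conj_by H h A \<in> \<Upsilon>" using T1 j A h by auto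
  have z: "z \<in> val M A" using A j by (simp add: z_def pull_in is_mor_one)
  have mor: "is_mor H A P \<one>" "is_mor H P P (inv h)" "is_mor H (conj_by H h A) P \<one>"
    "is_mor H A (conj_by H h A) (inv h)"
    using is_mor_one[OF A(1,3)] is_mor_self[OF P h(2)] is_mor_one[OF U(2)] cA is_mor_conj[OF U(2) h(3)]
      conj_by_inv_cancel(1)[OF h(1) level_subset[OF A(1)]] by auto
  have "pull M (conj_by H h A) (conj_by H h V) \<one> (pull M (conj_by H h V) V h x)
      = pull M (conj_by H h A) A h z"
    using A j h by (simp add: conj_mono_pull z_def)
  also have "\<dots> = push M A (conj_by H h A) (inv h) z"
    using A U h z level_subset by (intro pull_eq_push) (auto simp: conj_by_inv_cancel)
  finally have "push M (conj_by H h A) P \<one> (pull M (conj_by H h A) (conj_by H h V) \<one> (pull M (conj_by H h V) V h x))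
      = push M A P (inv h \<otimes> \<one>) z"
    using push_comp[OF A(1) U(2) P mor(4,3) z] by simp
  also have "\<dots> = push M A P (\<one> \<otimes> inv h) z" using h by simp
  also have "\<dots> = push M P P (inv h) (push M A P \<one> z)"
    using A P mor z by (intro push_comp)
  also have "\<dots> = push M A P \<one> z" using h P push_inner push_in A mor z by simp
  finally have "average P (act h (j V x)) = index (conj_by H h A) P \<odot> j P (push M A P \<one> z)"
    using j h P U by (simp add: act_j average_j' pull_in is_mor_conj cA)
  also have "\<dots> = average P (j V x)"
    using j A P h by (simp add: average_j' haar_index_conj A_def z_def)
  finally show ?case using j h by (simp add: act_scale average_scale lim_j act_lim)
qed (use assms level_subset P in \<open>auto simp: act_zero average_zero act_add average_add act_lim subset_iff\<close>)

end

text \<open>A vector involves finitely many generators, which can all be restricted to one level.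
  Every smaller level serves as well, which leaves room to pick one that is normal in a given
  subgroup.\<close>

lemma lim_small:
  assumes "w \<in> lim"
  shows "\<exists>V0\<in>\<Upsilon>. \<forall>V\<in>\<Upsilon>. V \<subseteq> V0 \<longrightarrow> w \<in> W.span (j V ` val M V)"
  using assms
proof (induction rule: lim_induct)
  case zero
  then show ?case using nonempty W.span_zero by blast
next
  case (add v w)
  then obtain V0 V1 where "V0 \<in> \<Upsilon>" "\<And>V. V \<in> \<Upsilon> \<Longrightarrow> V \<subseteq> V0 \<Longrightarrow> v \<in> W.span (j V ` val M V)"
     "V1 \<in> \<Upsilon>" "\<And>V. V \<in> \<Upsilon> \<Longrightarrow> V \<subseteq> V1 \<Longrightarrow> w \<in> W.span (j V ` val M V)" by blast
  then show ?case using T3 by (intro bexI[of _ "V0 \<inter> V1"]) (auto intro: W.span_add)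
next
  case (j c V x)
  show ?case
  proof (intro bexI[OF _ j(1)] ballI impI W.span_scale)
    fix V' assume V': "V' \<in> \<Upsilon>" "V' \<subseteq> V"
    then have "j V x = j V' (pull M V' V \<one> x)" using j by (simp add: j_pull)
    moreover have "pull M V' V \<one> x \<in> val M V'" using j V' by (intro pull_in is_mor_one)
    ultimately show "j V x \<in> W.span (j V' ` val M V')" by (auto intro: W.span_base)
  qed
qed

text \<open>Choose \<open>V\<close> normal in \<open>P\<close> and so small that \<open>w\<close>
  comes from level \<open>V\<close>. The Mackey formula for restricting a trace from
  \<open>V\<close> to \<open>P\<close> back to \<open>V\<close> then has one term for each coset in
  \<open>P/V\<close>, and that term is the action of a representative. The set \<open>R\<close>
  depends on \<open>w\<close> through \<open>V\<close>.\<close>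

lemma average_eq_sum:
  assumes P: "P \<in> \<Upsilon>" and w: "w \<in> lim"
  obtains R where "finite R" "R \<subseteq> P" "R \<noteq> {}" "average P w = (1 / of_nat (card R)) \<odot> (\<Sum>\<gamma>\<in>R. act \<gamma> w)"
proof -
  obtain V0 where V0: "V0 \<in> \<Upsilon>" "\<And>V. V \<in> \<Upsilon> \<Longrightarrow> V \<subseteq> V0 \<Longrightarrow> w \<in> W.span (j V ` val M V)"
    using lim_small[OF w] by blast
  obtain V where V: "V \<in> \<Upsilon>" "V \<lhd> H\<lparr>carrier := P\<rparr>" "V \<subseteq> V0" using T2[OF P V0(1)] by blast
  have sub: "subgroup P H" "subgroup V H" "P \<subseteq> carrier H" using level_subgroup level_subset P V by auto
  have VP: "V \<subseteq> P" using V(2) normal_imp_subgroup subgroup.subset by fastforce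
  have P_closed: "\<gamma> \<in> P \<Longrightarrow> v \<in> V \<Longrightarrow> \<gamma> \<otimes> v \<in> P" for \<gamma> v
    using VP subgroup.m_closed[OF sub(1)] by auto
  define rep where "rep \<gamma> = (SOME x. x \<in> \<gamma> <#\<^bsub>H\<^esub> V)" for \<gamma>
  have rep: "rep \<gamma> \<in> \<gamma> <#\<^bsub>H\<^esub> V" "rep \<gamma> \<in> P" if "\<gamma> \<in> P" for \<gamma>
  proof -
    have "\<gamma> \<in> carrier H" using that sub(3) by blast
    then obtain v where "v \<in> V" "rep \<gamma> = \<gamma> \<otimes> v"
      unfolding rep_def by (rule l_coset_rep[OF sub(2)])
    then show "rep \<gamma> \<in> \<gamma> <#\<^bsub>H\<^esub> V" "rep \<gamma> \<in> P" using that P_closed by (auto simp: l_coset_def)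
  qed
  define R where "R = rep ` P"
  have fin: "finite ((\<lambda>g. g <#\<^bsub>H\<^esub> V) ` P)"
    using finite_l_cosets[OF level_compact[OF P] sub(2) level_open[OF V(1)]] .
  have rep_eq: "rep \<gamma> = rep \<delta>" if "\<gamma> <#\<^bsub>H\<^esub> V = \<delta> <#\<^bsub>H\<^esub> V" for \<gamma> \<delta> using that by (simp add: rep_def)
  have coset_eq: "\<gamma> <#\<^bsub>H\<^esub> V = \<delta> <#\<^bsub>H\<^esub> V" if "\<delta> \<in> \<gamma> <#\<^bsub>H\<^esub> V" "\<gamma> \<in> P" "\<delta> \<in> P" for \<gamma> \<delta>
  proof -
    have c: "\<gamma> \<in> carrier H" "\<delta> \<in> carrier H" using that sub(3) by auto
    then have "inv \<gamma> \<otimes> \<delta> \<in> V"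
      using that(1) mem_l_coset_iff[OF c(1) level_subset[OF V(1)]] by simp
    then show ?thesis using l_coset_eq_iff[OF sub(2) c(2,1)] by simp
  qed
  have bij: "bij_betw (\<lambda>g. g <#\<^bsub>H\<^esub> V) R ((\<lambda>g. g <#\<^bsub>H\<^esub> V) ` P)"
  proof (rule bij_betwI')
    fix x y assume "x \<in> R" "y \<in> R"
    then show "(x <#\<^bsub>H\<^esub> V = y <#\<^bsub>H\<^esub> V) = (x = y)"
      using rep coset_eq rep_eq unfolding R_def by (metis (no_types, lifting) image_iff)
  next
    fix B assume "B \<in> (\<lambda>g. g <#\<^bsub>H\<^esub> V) ` P"
    then show "\<exists>x\<in>R. B = x <#\<^bsub>H\<^esub> V" using rep coset_eq unfolding R_def by blast
  qed (use rep in \<open>auto simp: R_def\<close>)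
  have R: "finite R" "R \<subseteq> P" "R \<noteq> {}"
    using bij_betw_finite[OF bij] fin rep subgroup.one_closed[OF sub(1)] by (auto simp: R_def)
  have "measure \<mu> P = card R * measure \<mu> V"
    using measure_l_invariant[OF V(1) sub(3) fin P_closed] bij_betw_same_card[OF bij] by simp
  then have "real_of_rat (haar_index \<mu> V P) = real_of_rat (1 / of_nat (card R))"
    using measure_level_pos[OF V(1)] P V by (simp add: real_haar_index of_rat_divide)
  then have "haar_index \<mu> V P = 1 / of_nat (card R)" by (simp only: of_rat_eq_iff)
  then have idx: "index V P = 1 / of_nat (card R)" by (simp add: of_rat_divide)
  \<comment> \<open>By normality the double cosets in the Mackey formula are the left cosets already
    represented by \<open>R\<close>.\<close>
  have dcoset: "dcoset H V \<gamma> V = \<gamma> <#\<^bsub>H\<^esub> V" if "\<gamma> \<in> P" for \<gamma>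
  proof -
    interpret N: normal V "H\<lparr>carrier := P\<rparr>" by (rule V(2))
    have "V #> \<gamma> = \<gamma> <#\<^bsub>H\<^esub> V" using N.coset_eq that by (simp add: r_coset_def l_coset_def)
    moreover have "(\<gamma> <#\<^bsub>H\<^esub> V) <#>\<^bsub>H\<^esub> V = \<gamma> <#\<^bsub>H\<^esub> V"
    proof (intro equalityI subsetI)
      fix x assume "x \<in> (\<gamma> <#\<^bsub>H\<^esub> V) <#>\<^bsub>H\<^esub> V"
      then obtain v v' where v: "v \<in> V" "v' \<in> V" "x = \<gamma> \<otimes> v \<otimes> v'" by (auto simp: l_coset_def set_mult_def)
      moreover have "\<gamma> \<in> carrier H" "v \<in> carrier H" "v' \<in> carrier H"
        using that v sub(3) level_subset[OF V(1)] by auto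
      ultimately have "x = \<gamma> \<otimes> (v \<otimes> v')" by (simp add: m_assoc)
      then show "x \<in> \<gamma> <#\<^bsub>H\<^esub> V" using subgroup.m_closed[OF sub(2) v(1,2)] by (auto simp: l_coset_def)
    next
      fix x assume x: "x \<in> \<gamma> <#\<^bsub>H\<^esub> V"
      then have "x \<otimes> \<one> = x" using that sub(3) level_subset[OF V(1)] by (auto simp: l_coset_def subset_iff)
      then show "x \<in> (\<gamma> <#\<^bsub>H\<^esub> V) <#>\<^bsub>H\<^esub> V"
        using x subgroup.one_closed[OF sub(2)] unfolding set_mult_def by blast
    qed
    ultimately show ?thesis by (simp add: dcoset_def)
  qed
  have reps: "dcoset_reps H V P V R"
    unfolding dcoset_reps_def
  proof (rule conjI[OF R(2)], intro ballI ex1I)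
    fix \<gamma> assume \<gamma>: "\<gamma> \<in> P"
    then show "rep \<gamma> \<in> R \<and> rep \<gamma> \<in> dcoset H V \<gamma> V" using rep by (auto simp: R_def dcoset)
    fix r assume "r \<in> R \<and> r \<in> dcoset H V \<gamma> V"
    then show "r = rep \<gamma>"
      using \<gamma> rep coset_eq rep_eq unfolding R_def dcoset[OF \<gamma>] by (metis (no_types, lifting) image_iff)
  qed
  have gen: "average P (j V x) = (1 / of_nat (card R)) \<odot> (\<Sum>\<gamma>\<in>R. act \<gamma> (j V x))" if x: "x \<in> val M V" for x
  proof -
    \<comment> \<open>Normality again: each intersection in the Mackey formula is \<open>V\<close>
      itself, so the pushforwards in it are identities.\<close>
    have conj: "conj_by H \<gamma> V = V" if "\<gamma> \<in> R" for \<gamma> using conj_by_normal[OF sub(1) V(2)] R that by blast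
    have carr: "\<gamma> \<in> carrier H" if "\<gamma> \<in> R" for \<gamma> using R that sub by blast
    have mor: "is_mor H V V \<gamma>" if "\<gamma> \<in> R" for \<gamma> using is_mor_conj[OF V(1) carr[OF that]] conj[OF that] by simp
    have pP: "push M V P \<one> x \<in> val M P" using x V P VP by (intro push_in is_mor_one)
    have "pull M V P \<one> (push M V P \<one> x)
        = (\<Sum>\<gamma>\<in>R. push M (V \<inter> conj_by H \<gamma> V) V \<one> (pull M (V \<inter> conj_by H \<gamma> V) V \<gamma> x))"
      using V VP P x reps by (intro mackey)
    also have "\<dots> = (\<Sum>\<gamma>\<in>R. pull M V V \<gamma> x)"
      using V x mor by (intro sum.cong) (auto simp: conj push_id pull_in)
    finally have "j P (push M V P \<one> x) = (\<Sum>\<gamma>\<in>R. j V (pull M V V \<gamma> x))"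
      using j_pull[OF P V(1) pP VP] V(1) x mor by (simp add: j_sum pull_in)
    also have "\<dots> = (\<Sum>\<gamma>\<in>R. act \<gamma> (j V x))"
      using V x conj carr by (intro sum.cong) (auto simp: act_j)
    finally show ?thesis using P V x VP by (simp add: average_j idx)
  qed
  \<comment> \<open>Both sides of the claim are linear in \<open>w\<close>, so the generators of
    level \<open>V\<close> suffice.\<close>
  have "W.span (j V ` val M V) \<subseteq>
      {w \<in> lim. average P w = (1 / of_nat (card R)) \<odot> (\<Sum>\<gamma>\<in>R. act \<gamma> w)}"
  proof (rule W.span_minimal)
    have carr: "\<gamma> \<in> carrier H" if "\<gamma> \<in> R" for \<gamma> using R that sub by blast
    show "W.subspace {w \<in> lim. average P w = (1 / of_nat (card R)) \<odot> (\<Sum>\<gamma>\<in>R. act \<gamma> w)}"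
      by (rule W.subspaceI)
         (auto simp: P average_zero act_zero carr lim_add average_add act_add sum.distrib lim_scale
           average_scale act_scale W.scale_right_distrib W.scale_sum_right mult.commute)
  qed (use V gen in \<open>auto simp: lim_j\<close>)
  then show thesis using that[OF R] V0(2)[OF V(1,3)] by blast
qed

lemma average_invariant:
  assumes "P \<in> \<Upsilon>" "w \<in> lim" "\<And>h. h \<in> P \<Longrightarrow> act h w = w"
  shows "average P w = w"
proof -
  obtain R where R: "finite R" "R \<subseteq> P" "R \<noteq> {}"
      "average P w = (1 / of_nat (card R)) \<odot> (\<Sum>\<gamma>\<in>R. act \<gamma> w)"
    using average_eq_sum[OF assms(1,2)] by blast
  have "(\<Sum>\<gamma>\<in>R. act \<gamma> w) = (\<Sum>\<gamma>\<in>R. 1 \<odot> w)" using R assms by (intro sum.cong) auto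
  also have "\<dots> = of_nat (card R) \<odot> w" using W.scale_sum_left[of "\<lambda>_. 1" R w] by simp
  finally show ?thesis using R by simp
qed

end

subsection \<open>Torsion-free functors embed into the completion\<close>

text \<open>A submodule \<open>B\<close> that is maximal among those meeting \<open>O x\<close> trivially makes
  \<open>A/B\<close> torsion-free of rank one, so that \<open>x \<mapsto> 1\<close> extends uniquely from it.\<close>

lemma exists_semilinear_functional:
  fixes s :: "'o::idom \<Rightarrow> 'm::ab_group_add \<Rightarrow> 'm" and \<phi> :: "'o \<Rightarrow> 'f::field"
  assumes "Modules.module s" and A: "module.subspace s A" and x: "x \<in> A"
    and tf: "\<And>a. s a x = 0 \<Longrightarrow> a = 0"
    and phi: "inj \<phi>" "\<And>a b. \<phi> (a + b) = \<phi> a + \<phi> b" "\<And>a b. \<phi> (a * b) = \<phi> a * \<phi> b"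
  obtains f where "\<And>y z. y \<in> A \<Longrightarrow> z \<in> A \<Longrightarrow> f (y + z) = f y + f z"
    "\<And>a y. y \<in> A \<Longrightarrow> f (s a y) = \<phi> a * f y" "f x = (1::'f)"
proof -
  interpret module s by fact
  have phi0: "\<phi> 0 = 0" using phi(2)[of 0 0] by (metis add_0 add_cancel_right_right)
  have phi_eq0: "\<phi> a = 0 \<longleftrightarrow> a = 0" for a using inj_eq[OF phi(1), of a 0] phi0 by simp
  have phi1: "\<phi> 1 = 1" using phi(3)[of 1 1] phi_eq0[of 1] by simp
  define \<B> where "\<B> = {B. subspace B \<and> B \<subseteq> A \<and> (\<forall>a. s a x \<in> B \<longrightarrow> a = 0)}"
  have "\<exists>B\<in>\<B>. \<forall>C\<in>\<B>. B \<subseteq> C \<longrightarrow> C = B"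
  proof (rule subset_Zorn_nonempty)
    have "{0} \<in> \<B>" using tf A subspace_0[OF A] by (auto simp: \<B>_def subspace_def)
    then show "\<B> \<noteq> {}" by blast
    fix \<C> assume \<C>: "\<C> \<noteq> {}" "subset.chain \<B> \<C>"
    have mem: "subspace B" "B \<subseteq> A" "s a x \<in> B \<Longrightarrow> a = 0" if "B \<in> \<C>" for B a
      using \<C>(2) that by (auto simp: subset_chain_def \<B>_def)
    have "subspace (\<Union>\<C>)"
    proof (rule subspaceI)
      obtain B where "B \<in> \<C>" using \<C>(1) by blast
      then show "0 \<in> \<Union>\<C>" using mem(1) subspace_0 by blast
    next
      fix y z assume "y \<in> \<Union>\<C>" "z \<in> \<Union>\<C>"
      then obtain B C where BC: "B \<in> \<C>" "C \<in> \<C>" "y \<in> B" "z \<in> C" by blast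
      then have "B \<subseteq> C \<or> C \<subseteq> B" using \<C>(2) by (auto simp: subset_chain_def)
      then obtain D where "D \<in> \<C>" "y \<in> D" "z \<in> D" using BC by blast
      then show "y + z \<in> \<Union>\<C>" using mem(1) subspace_add by blast
    next
      fix c y assume "y \<in> \<Union>\<C>"
      then obtain B where "B \<in> \<C>" "y \<in> B" by blast
      then show "s c y \<in> \<Union>\<C>" using mem(1) subspace_scale by blast
    qed
    moreover have "\<Union>\<C> \<subseteq> A" using mem(2) by blast
    moreover have "a = 0" if "s a x \<in> \<Union>\<C>" for a using that mem(3) by blast
    ultimately show "\<Union>\<C> \<in> \<B>" by (simp add: \<B>_def)
  qed
  then obtain B where "B \<in> \<B>" and max: "\<And>C. C \<in> \<B> \<Longrightarrow> B \<subseteq> C \<Longrightarrow> C = B" by blast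
  then have B: "subspace B" "B \<subseteq> A" "\<And>a. s a x \<in> B \<Longrightarrow> a = 0" by (auto simp: \<B>_def)
  \<comment> \<open>If \<open>z\<close> is not in \<open>B\<close>, maximality forces
    \<open>B + O z\<close> to contain a nonzero multiple \<open>a x\<close>. In the resulting
    \<open>a x = y + b z\<close> the coefficient \<open>b\<close> cannot vanish, since
    \<open>B\<close> contains no nonzero multiple of \<open>x\<close>.\<close>
  have frac: "\<exists>a b. b \<noteq> 0 \<and> s b z - s a x \<in> B" if z: "z \<in> A" for z
  proof (cases "z \<in> B")
    case True
    then show ?thesis by (intro exI[of _ 0] exI[of _ 1]) simp
  next
    case False
    define C where "C = {y + s b z | y b. y \<in> B}"
    have "subspace C"
    proof (rule subspaceI)
      show "0 \<in> C" using subspace_0[OF B(1)] by (force simp: C_def intro: exI[of _ 0])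
    next
      fix u v assume "u \<in> C" "v \<in> C"
      then obtain y b y' b' where "u = y + s b z" "v = y' + s b' z" "y \<in> B" "y' \<in> B"
        by (auto simp: C_def)
      then have "u + v = (y + y') + s (b + b') z" "y + y' \<in> B"
        using subspace_add[OF B(1)] by (auto simp: algebra_simps)
      then show "u + v \<in> C" unfolding C_def by blast
    next
      fix c u assume "u \<in> C"
      then obtain y b where "u = y + s b z" "y \<in> B" by (auto simp: C_def)
      then have "s c u = s c y + s (c * b) z" "s c y \<in> B"
        using subspace_scale[OF B(1)] by (auto simp: algebra_simps)
      then show "s c u \<in> C" unfolding C_def by blast
    qed
    moreover have "C \<subseteq> A"
      using B(2) z A by (auto simp: C_def intro!: subspace_add subspace_scale)
    moreover have "B \<subseteq> C"
    proof
      fix y assume "y \<in> B"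
      then have "y + s 0 z \<in> C" unfolding C_def by blast
      then show "y \<in> C" by simp
    qed
    moreover have "z \<in> C"
    proof -
      have "0 + s 1 z \<in> C" unfolding C_def using subspace_0[OF B(1)] by blast
      then show ?thesis by simp
    qed
    ultimately have "C \<notin> \<B>" using max False by blast
    then obtain a where a: "s a x \<in> C" "a \<noteq> 0" using \<open>subspace C\<close> \<open>C \<subseteq> A\<close> by (auto simp: \<B>_def)
    then obtain y b where yb: "s a x = y + s b z" "y \<in> B" by (auto simp: C_def)
    have "b \<noteq> 0" using a yb B(3)[of a] by auto
    moreover have "s b z - s a x = s (- 1) y" using yb by simp
    ultimately show ?thesis using subspace_scale[OF B(1) yb(2)] by metis
  qed
  define rel where "rel z a b \<longleftrightarrow> b \<noteq> 0 \<and> s b z - s a x \<in> B" for z a b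
  \<comment> \<open>Modulo \<open>B\<close> the element \<open>z\<close> is the fraction
    \<open>a / b\<close> of \<open>x\<close>, and this fraction, read in the field, is its
    value.\<close>
  define f where "f z = (SOME q. \<exists>a b. rel z a b \<and> q = \<phi> a / \<phi> b)" for z
  have f_eq: "f z = \<phi> a / \<phi> b" if "rel z a b" for z a b
    unfolding f_def
  proof (rule some_equality)
    fix q assume "\<exists>a b. rel z a b \<and> q = \<phi> a / \<phi> b"
    then obtain a' b' where ab: "rel z a' b'" "q = \<phi> a' / \<phi> b'" by blast
    \<comment> \<open>Cross multiplication eliminates \<open>z\<close> from the two relations and
      leaves a multiple of \<open>x\<close> in \<open>B\<close>, whose coefficient must be
      zero.\<close>
    have "s b' (s b z - s a x) - s b (s b' z - s a' x) \<in> B"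
      by (rule subspace_diff[OF B(1)]; rule subspace_scale[OF B(1)])
         (use that ab in \<open>auto simp: rel_def\<close>)
    also have "s b' (s b z - s a x) - s b (s b' z - s a' x) = s (b * a' - b' * a) x"
      by (simp add: algebra_simps)
    finally have "b * a' = b' * a" using B(3) by force
    then have "\<phi> b * \<phi> a' = \<phi> b' * \<phi> a" by (metis phi(3))
    then show "q = \<phi> a / \<phi> b" using ab that by (simp add: rel_def phi_eq0 frac_eq_eq mult.commute)
  qed (use that in blast)
  show thesis
  proof
    fix y z assume "y \<in> A" "z \<in> A"
    then obtain a b c d where ab: "rel y a b" and cd: "rel z c d" using frac unfolding rel_def by metis
    have "s d (s b y - s a x) + s b (s d z - s c x) \<in> B"
      by (rule subspace_add[OF B(1)]; rule subspace_scale[OF B(1)])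
         (use ab cd in \<open>auto simp: rel_def\<close>)
    also have "s d (s b y - s a x) + s b (s d z - s c x) = s (b * d) (y + z) - s (d * a + b * c) x"
      by (simp add: algebra_simps)
    finally have "rel (y + z) (d * a + b * c) (b * d)" using ab cd by (simp add: rel_def)
    moreover have "\<phi> b \<noteq> 0" "\<phi> d \<noteq> 0" using ab cd by (simp_all add: rel_def phi_eq0)
    ultimately show "f (y + z) = f y + f z"
      unfolding f_eq[OF ab] f_eq[OF cd] by (simp add: f_eq phi field_simps)
  next
    fix c y assume "y \<in> A"
    then obtain a b where ab: "rel y a b" using frac unfolding rel_def by metis
    have "s c (s b y - s a x) \<in> B" using subspace_scale[OF B(1)] ab by (simp add: rel_def)
    also have "s c (s b y - s a x) = s b (s c y) - s (c * a) x" by (simp add: algebra_simps)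
    finally have "rel (s c y) (c * a) b" using ab by (simp add: rel_def)
    from f_eq[OF this] show "f (s c y) = \<phi> c * f y" using f_eq[OF ab] by (simp add: phi)
  next
    have "rel x 1 1" using subspace_0[OF B(1)] by (simp add: rel_def)
    from f_eq[OF this] show "f x = 1" by (simp add: phi1)
  qed
qed

text \<open>If \<open>j V x\<close> vanishes, the generator \<open>(V, x)\<close> is a combination
  of finitely many relations. All of them are killed by a semilinear functional on one sufficiently
  small level, evaluated after restriction to it; but a functional that takes the value 1 on the
  restriction of \<open>x\<close> does not kill the generator.\<close>

lemma (in completion) j_inject:
  assumes tf: "torsion_free \<Upsilon> M" and V: "V \<in> \<Upsilon>" "x \<in> val M V" and j0: "j V x = 0"
  shows "x = 0"
proof (rule ccontr)
  assume "x \<noteq> 0"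
  interpret fr: vector_space "free_scale :: 'f \<Rightarrow> ('h set \<times> 'm \<Rightarrow>\<^sub>0 'f) \<Rightarrow> _" by (rule vector_space_free_scale)
  define functional where "functional V f \<longleftrightarrow>
      (\<forall>y\<in>val M V. \<forall>z\<in>val M V. f (y + z) = f y + f z) \<and> (\<forall>a. \<forall>y\<in>val M V. f (smul M a y) = \<phi> a * f y)"
    for V and f :: "'m \<Rightarrow> 'f"
  define ev where "ev V f = gen_eval (*) (\<lambda>V' y. f (pull M V V' \<one> y))" for V and f :: "'m \<Rightarrow> 'f"
  \<comment> \<open>A functional lives on a single level and can only test generators of larger
    levels. Hence an element is required to vanish under all functionals on all sufficiently small
    levels; with the bound depending on the element, this condition is linear.\<close>
  define N where "N = {a. \<exists>V0\<in>\<Upsilon>. \<forall>V\<in>\<Upsilon>. V \<subseteq> V0 \<longrightarrow> (\<forall>f. functional V f \<longrightarrow> ev V f a = 0)}"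
  have "fr.subspace N"
  proof (rule fr.subspaceI)
    show "0 \<in> N" using V(1) by (auto simp: N_def ev_def)
  next
    fix a b assume "a \<in> N" "b \<in> N"
    then obtain V0 V1 where V01: "V0 \<in> \<Upsilon>" "V1 \<in> \<Upsilon>"
      and V0: "\<forall>V\<in>\<Upsilon>. V \<subseteq> V0 \<longrightarrow> (\<forall>f. functional V f \<longrightarrow> ev V f a = 0)"
      and V1: "\<forall>V\<in>\<Upsilon>. V \<subseteq> V1 \<longrightarrow> (\<forall>f. functional V f \<longrightarrow> ev V f b = 0)"
      unfolding N_def by auto
    have "ev V f (a + b) = 0" if "V \<in> \<Upsilon>" "V \<subseteq> V0 \<inter> V1" "functional V f" for V f
      using that V0 V1 by (simp add: ev_def vector_space_over_itself.gen_eval_add)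
    then show "a + b \<in> N"
      unfolding N_def by (intro CollectI bexI[OF _ T3[OF V01(1,2)]] ballI allI impI)
  next
    fix c a assume "a \<in> N"
    then show "free_scale c a \<in> N" by (auto simp: N_def ev_def vector_space_over_itself.gen_eval_scale)
  qed
  moreover have "tensor_relations \<phi> \<Upsilon> M \<union> limit_relations H \<Upsilon> M \<subseteq> N"
  proof
    fix a assume "a \<in> tensor_relations \<phi> \<Upsilon> M \<union> limit_relations H \<Upsilon> M"
    then consider
      (add) V' y z where "V' \<in> \<Upsilon>" "y \<in> val M V'" "z \<in> val M V'"
        "a = Poly_Mapping.single (V', y + z) 1 - Poly_Mapping.single (V', y) 1 - Poly_Mapping.single (V', z) 1"
    | (scale) V' c y where "V' \<in> \<Upsilon>" "y \<in> val M V'"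
        "a = Poly_Mapping.single (V', smul M c y) 1 - Poly_Mapping.single (V', y) (\<phi> c)"
    | (pull) V' V'' y where "V' \<in> \<Upsilon>" "V'' \<in> \<Upsilon>" "V'' \<subseteq> V'" "y \<in> val M V'"
        "a = Poly_Mapping.single (V'', pull M V'' V' \<one> y) 1 - Poly_Mapping.single (V', y) 1"
      unfolding tensor_relations_def limit_relations_def by blast
    then show "a \<in> N"
    proof cases
      case add
      have "ev V f a = 0" if "V \<in> \<Upsilon>" "V \<subseteq> V'" "functional V f" for V f
        using add that is_mor_one[of V V'] pull_in[of V V' \<one>]
        by (simp add: ev_def vector_space_over_itself.gen_eval_diff pull_add functional_def)
      then show ?thesis unfolding N_def by (intro CollectI bexI[OF _ add(1)] ballI allI impI)
    next
      case scale
      have "ev V f a = 0" if "V \<in> \<Upsilon>" "V \<subseteq> V'" "functional V f" for V f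
        using scale that is_mor_one[of V V'] pull_in[of V V' \<one>]
        by (simp add: ev_def vector_space_over_itself.gen_eval_diff pull_smul functional_def)
      then show ?thesis unfolding N_def by (intro CollectI bexI[OF _ scale(1)] ballI allI impI)
    next
      case pull
      have "ev V f a = 0" if "V \<in> \<Upsilon>" "V \<subseteq> V''" "functional V f" for V f
      proof -
        have "pull M V V'' \<one> (pull M V'' V' \<one> y) = pull M V V' \<one> y"
          using pull_comp[OF that(1) pull(2,1) is_mor_one is_mor_one pull(4)] that pull by simp
        then show ?thesis using pull by (simp add: ev_def vector_space_over_itself.gen_eval_diff)
      qed
      then show ?thesis unfolding N_def by (intro CollectI bexI[OF _ pull(2)] ballI allI impI)
    qed
  qed
  moreover have "Poly_Mapping.single (V, x) 1 \<in> fr.span (tensor_relations \<phi> \<Upsilon> M \<union> limit_relations H \<Upsilon> M)"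
  proof -
    have "gen_eval vsc j (Poly_Mapping.single (V, x) 1) = 0" using j0 by simp
    then show ?thesis using completion presented_single[OF V, of 1]
      unfolding is_completion_def free_eval_eq by blast
  qed
  ultimately have "Poly_Mapping.single (V, x) 1 \<in> N" using fr.span_minimal by blast
  then obtain V0 where V0: "V0 \<in> \<Upsilon>"
      "\<forall>V'\<in>\<Upsilon>. V' \<subseteq> V0 \<longrightarrow> (\<forall>f. functional V' f \<longrightarrow> ev V' f (Poly_Mapping.single (V, x) 1) = 0)"
    unfolding N_def by auto
  define V1 where "V1 = V0 \<inter> V"
  have V1: "V1 \<in> \<Upsilon>" "V1 \<subseteq> V0" "V1 \<subseteq> V" using T3 V0 V by (auto simp: V1_def)
  define z where "z = pull M V1 V \<one> x"
  have z: "z \<in> val M V1" using V V1 by (simp add: z_def pull_in is_mor_one)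
  \<comment> \<open>Pushing the restriction back up multiplies \<open>x\<close> by the positive
    integer \<open>[V : V1]\<close>, which a torsion-free module does not allow to be zero unless
    \<open>x\<close> is.\<close>
  have "z \<noteq> 0"
  proof
    assume "z = 0"
    have "push M V1 V \<one> (0 + 0) = push M V1 V \<one> 0 + push M V1 V \<one> 0"
      using V V1 by (intro push_add is_mor_one) auto
    then have "smul M (of_nat (card (rcosets\<^bsub>H\<lparr>carrier := V\<rparr>\<^esub> V1))) x = 0"
      using cohomological[OF V1(1) V(1) V1(3) V(2)] \<open>z = 0\<close> by (simp add: z_def)
    then have "card (rcosets\<^bsub>H\<lparr>carrier := V\<rparr>\<^esub> V1) = 0"
      using tf V \<open>x \<noteq> 0\<close> unfolding torsion_free_def by (metis of_nat_eq_0_iff)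
    then show False
      using haar_index_subset[OF V1(1) V(1) V1(3)] haar_index_nonzero[OF V(1) V1(1)] by simp
  qed
  then have "smul M a z = 0 \<Longrightarrow> a = 0" for a using tf V1(1) z unfolding torsion_free_def by blast
  from exists_semilinear_functional[OF ambient_module submodule[OF V1(1)] z this phi_inj phi_add phi_mult]
  obtain f where f: "functional V1 f" "f z = 1" unfolding functional_def by metis
  then have "ev V1 f (Poly_Mapping.single (V, x) 1) = 0" using V0(2) V1 by blast
  with f show False by (simp add: ev_def z_def)
qed

section \<open>Coinvariants\<close>

text \<open>The function \<open>w \<otimes> ch(g K)\<close>.\<close>

definition delta :: "'g monoid \<Rightarrow> 'g set \<Rightarrow> 'w::zero \<Rightarrow> 'g \<Rightarrow> 'g \<Rightarrow> 'w" where
  "delta G K w g = (\<lambda>g'. if g' \<in> g <#\<^bsub>G\<^esub> K then w else 0)"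

lemma sum_fun_apply: "sum f A x = (\<Sum>a\<in>A. f a x)"
  by (induction A rule: infinite_finite_induct) auto

lemma sum_list_fun_apply: "(\<Sum>a\<leftarrow>as. f a) x = (\<Sum>a\<leftarrow>as. f a x)"
  by (induction as) auto

locale zeta_setup = completion H TH \<Upsilon>H \<mu> MH \<phi> W + G: level_collection G TG \<Upsilon>G
  for H :: "'h monoid" (structure) and TH \<Upsilon>H \<mu>
    and MH :: "('h, 'o::{idom,ring_char_0}, 'm::ab_group_add) ric"
    and \<phi> :: "'o \<Rightarrow> 'f::field_char_0"
    and W :: "('h, 'm, 'f, 'w::ab_group_add) realisation"
    and G :: "'g monoid" and TG \<Upsilon>G +
  fixes \<iota> :: "'h \<Rightarrow> 'g" and K :: "'g set"
  assumes hom: "\<iota> \<in> hom H G"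
    and trace_level: "K' \<in> \<Upsilon>G \<Longrightarrow> trace_on H \<iota> K' \<in> \<Upsilon>H"
    and K: "K \<in> \<Upsilon>G"
begin

abbreviation gmult (infixl \<open>\<cdot>\<close> 70) where "gmult \<equiv> mult G"

lemma iota_group_hom: "group_hom H G \<iota>"
  using hom by (simp add: group_hom_def group_hom_axioms_def is_group G.is_group)

lemma iota_closed [simp]: "h \<in> carrier H \<Longrightarrow> \<iota> h \<in> carrier G"
  using group_hom.hom_closed[OF iota_group_hom] .

lemma iota_mult: "g \<in> carrier H \<Longrightarrow> h \<in> carrier H \<Longrightarrow> \<iota> (g \<otimes> h) = \<iota> g \<cdot> \<iota> h"
  using group_hom.hom_mult[OF iota_group_hom] .

lemma iota_one [simp]: "\<iota> \<one> = \<one>\<^bsub>G\<^esub>"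
  using group_hom.hom_one[OF iota_group_hom] .

lemma iota_inv: "h \<in> carrier H \<Longrightarrow> \<iota> (inv h) = inv\<^bsub>G\<^esub> (\<iota> h)"
  using group_hom.hom_inv[OF iota_group_hom] .

lemma K_subgroup: "subgroup K G" and K_open: "openin TG K" and K_compact: "compactin TG K"
  and K_subset: "K \<subseteq> carrier G"
  using G.compact_open[OF K] subgroup.subset by auto

lemma K_mem_carrier [simp]: "k \<in> K \<Longrightarrow> k \<in> carrier G"
  using K_subset by auto

lemmas K_mult = subgroup.m_closed[OF K_subgroup] and K_inv = subgroup.m_inv_closed[OF K_subgroup]
  and K_one [simp] = subgroup.one_closed[OF K_subgroup]

lemmas mem_gK = G.mem_l_coset_iff[OF _ K_subset]
lemmas gK_eq_iff = G.l_coset_eq_iff[OF K_subgroup]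

abbreviation orbit :: "'g \<Rightarrow> 'g set" where "orbit g \<equiv> dcoset G (\<iota> ` carrier H) g K"
abbreviation stab :: "'g \<Rightarrow> 'h set" where "stab g \<equiv> trace_on H \<iota> (conj_by G g K)"
abbreviation cfun :: "('g \<Rightarrow> 'w) set" where "cfun \<equiv> cc_functions G TG K lim"
abbreviation kernel :: "('g \<Rightarrow> 'w) set" where "kernel \<equiv> coinvariant_kernel H G \<iota> vsc act cfun"
abbreviation fscale :: "'f \<Rightarrow> ('g \<Rightarrow> 'w) \<Rightarrow> 'g \<Rightarrow> 'w" where "fscale \<equiv> \<lambda>c \<xi> g. vsc c (\<xi> g)"

sublocale fn: vector_space fscale
  by standard (auto simp: fun_eq_iff algebra_simps W.scale_right_distrib W.scale_left_distrib)

lemma stab_level: "g \<in> carrier G \<Longrightarrow> stab g \<in> \<Upsilon>H"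
  using trace_level G.T1 K by blast

lemma mem_stab_iff:
  "g \<in> carrier G \<Longrightarrow> h \<in> stab g \<longleftrightarrow> h \<in> carrier H \<and> inv\<^bsub>G\<^esub> g \<cdot> \<iota> h \<cdot> g \<in> K"
  by (auto simp: trace_on_def G.mem_conj_by_iff K_subset)

lemmas stab_subgroup = level_subgroup[OF stab_level]

lemma stab_carrier: "g \<in> carrier G \<Longrightarrow> h \<in> stab g \<Longrightarrow> h \<in> carrier H"
  by (simp add: trace_on_def)

text \<open>Sending \<open>h\<close> to \<open>h g K\<close> identifies the cosets of the stabiliser
  with the cosets of \<open>K\<close> in the double coset of \<open>g\<close>.\<close>

lemma stab_coset:
  assumes "g \<in> carrier G" "h \<in> carrier H" "h' \<in> carrier H"
  shows "inv h \<otimes> h' \<in> stab g \<longleftrightarrow> (\<iota> h \<cdot> g) <#\<^bsub>G\<^esub> K = (\<iota> h' \<cdot> g) <#\<^bsub>G\<^esub> K"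
proof -
  have "inv h \<otimes> h' \<in> stab g \<longleftrightarrow> (\<iota> h' \<cdot> g) <#\<^bsub>G\<^esub> K = (\<iota> h \<cdot> g) <#\<^bsub>G\<^esub> K"
    using assms by (simp add: mem_stab_iff gK_eq_iff iota_mult iota_inv G.inv_mult_group G.m_assoc)
  then show ?thesis by auto
qed

text \<open>Replaces topology by finiteness. As \<open>K\<close> is open, a compact set meets
  finitely many of its cosets; as \<open>K\<close> is compact, a finite union of cosets is compact,
  and closed because the group is Hausdorff.\<close>

lemma cfun_iff:
  "\<xi> \<in> cfun \<longleftrightarrow> (\<forall>g\<in>carrier G. \<xi> g \<in> lim) \<and> (\<forall>g. g \<notin> carrier G \<longrightarrow> \<xi> g = 0) \<and>
     right_inv G K \<xi> \<and> finite (coset_supp G K \<xi>)"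
proof (intro iffI)
  assume \<xi>: "\<xi> \<in> cfun"
  let ?S = "{g. \<xi> g \<noteq> 0}"
  have "?S \<subseteq> TG closure_of ?S"
    using \<xi> by (intro closure_of_subset) (auto simp: cc_functions_def G.topspace)
  moreover have "finite ((\<lambda>g. g <#\<^bsub>G\<^esub> K) ` (TG closure_of ?S))"
    using \<xi> by (intro G.finite_l_cosets K_subgroup K_open) (simp add: cc_functions_def)
  ultimately have "finite (coset_supp G K \<xi>)"
    by (rule_tac finite_subset) (auto simp: coset_supp_def)
  then show "(\<forall>g\<in>carrier G. \<xi> g \<in> lim) \<and> (\<forall>g. g \<notin> carrier G \<longrightarrow> \<xi> g = 0) \<and>
     right_inv G K \<xi> \<and> finite (coset_supp G K \<xi>)"
    using \<xi> by (auto simp: cc_functions_def right_inv_def)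
next
  assume \<xi>: "(\<forall>g\<in>carrier G. \<xi> g \<in> lim) \<and> (\<forall>g. g \<notin> carrier G \<longrightarrow> \<xi> g = 0) \<and>
     right_inv G K \<xi> \<and> finite (coset_supp G K \<xi>)"
  let ?S = "{g. \<xi> g \<noteq> 0}"
  have "?S = \<Union>(coset_supp G K \<xi>)"
  proof (intro equalityI subsetI)
    fix g assume "g \<in> ?S"
    moreover then have "g \<in> carrier G" using \<xi> by auto
    ultimately show "g \<in> \<Union>(coset_supp G K \<xi>)"
      using G.l_coset_self[OF K_subgroup] by (auto simp: coset_supp_def)
  next
    fix g assume "g \<in> \<Union>(coset_supp G K \<xi>)"
    then obtain g' k where "g' \<in> carrier G" "\<xi> g' \<noteq> 0" "k \<in> K" "g = g' \<cdot> k"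
      by (auto simp: coset_supp_def l_coset_def)
    then show "g \<in> ?S" using \<xi> by (auto simp: right_inv_def)
  qed
  moreover have "compactin TG (\<Union>(coset_supp G K \<xi>))"
    using \<xi> by (intro compactin_Union) (auto simp: coset_supp_def intro!: G.compactin_l_coset K_compact)
  ultimately have S: "compactin TG ?S" by simp
  then have "TG closure_of ?S = ?S"
    using compactin_imp_closedin[OF G.hausdorff] closure_of_closedin by blast
  then show "\<xi> \<in> cfun" using S \<xi> by (auto simp: cc_functions_def right_inv_def)
qed

lemma cfun_subspace: "fn.subspace cfun"
proof (rule fn.subspaceI)
  show "0 \<in> cfun" by (simp add: cfun_iff right_inv_def coset_supp_def)
next
  fix \<xi> \<eta> assume "\<xi> \<in> cfun" "\<eta> \<in> cfun"
  moreover have "finite (coset_supp G K (\<xi> + \<eta>))"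
    if "finite (coset_supp G K \<xi>)" "finite (coset_supp G K \<eta>)"
    using that G.coset_supp_add[of K \<xi> \<eta>] finite_subset by (auto simp: plus_fun_def)
  ultimately show "\<xi> + \<eta> \<in> cfun" by (auto simp: cfun_iff right_inv_def intro!: lim_add)
next
  fix c \<xi> assume "\<xi> \<in> cfun"
  moreover have "coset_supp G K (fscale c \<xi>) \<subseteq> coset_supp G K \<xi>"
    by (intro G.coset_supp_mono) auto
  ultimately show "fscale c \<xi> \<in> cfun"
    by (auto simp: cfun_iff right_inv_def intro: lim_scale finite_subset)
qed

lemma delta_cfun:
  assumes "w \<in> lim" "g \<in> carrier G"
  shows "delta G K w g \<in> cfun"
proof -
  have "coset_supp G K (delta G K w g) \<subseteq> {g <#\<^bsub>G\<^esub> K}"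
  proof
    fix B assume "B \<in> coset_supp G K (delta G K w g)"
    then obtain g' where "g' \<in> carrier G" "B = g' <#\<^bsub>G\<^esub> K" "g' \<in> g <#\<^bsub>G\<^esub> K"
      by (auto simp: coset_supp_def delta_def split: if_splits)
    then show "B \<in> {g <#\<^bsub>G\<^esub> K}" using assms by (auto simp: gK_eq_iff mem_gK)
  qed
  moreover have "inv\<^bsub>G\<^esub> g \<cdot> (g' \<cdot> k) \<in> K \<longleftrightarrow> inv\<^bsub>G\<^esub> g \<cdot> g' \<in> K"
    if "g' \<in> carrier G" "k \<in> K" for g' k
  proof
    assume "inv\<^bsub>G\<^esub> g \<cdot> (g' \<cdot> k) \<in> K"
    from K_mult[OF this K_inv[OF that(2)]] show "inv\<^bsub>G\<^esub> g \<cdot> g' \<in> K"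
      using that assms by (simp add: G.m_assoc)
  next
    assume "inv\<^bsub>G\<^esub> g \<cdot> g' \<in> K"
    from K_mult[OF this that(2)] show "inv\<^bsub>G\<^esub> g \<cdot> (g' \<cdot> k) \<in> K"
      using that assms by (simp add: G.m_assoc)
  qed
  ultimately show ?thesis using assms
    by (auto simp: cfun_iff right_inv_def delta_def mem_gK intro: finite_subset)
qed

lemma cfun_decomposition:
  assumes "\<xi> \<in> cfun"
  shows "\<xi> = (\<Sum>B\<in>coset_supp G K \<xi>. delta G K (\<xi> (SOME g. g \<in> B)) (SOME g. g \<in> B))"
proof
  fix g
  note \<xi> = assms[unfolded cfun_iff]
  have rep: "\<xi> (SOME x. x \<in> g <#\<^bsub>G\<^esub> K) = \<xi> g" if "g \<in> carrier G" for g
    using \<xi> G.right_inv_rep[OF _ K_subgroup that] by blast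
  have coset: "(SOME x. x \<in> g <#\<^bsub>G\<^esub> K) <#\<^bsub>G\<^esub> K = g <#\<^bsub>G\<^esub> K" if g: "g \<in> carrier G" for g
  proof -
    obtain k where "k \<in> K" "(SOME x. x \<in> g <#\<^bsub>G\<^esub> K) = g \<cdot> k"
      using G.l_coset_rep[OF K_subgroup g] by blast
    then show ?thesis using g by (simp add: gK_eq_iff G.m_assoc)
  qed
  let ?c = "\<lambda>B. delta G K (\<xi> (SOME g. g \<in> B)) (SOME g. g \<in> B) g"
  have val: "?c B = (if g \<in> B then \<xi> g else 0)" if B: "B \<in> coset_supp G K \<xi>" for B
  proof -
    obtain g' where g': "g' \<in> carrier G" "B = g' <#\<^bsub>G\<^esub> K" using B by (auto simp: coset_supp_def)
    have "\<xi> g' = \<xi> g" if "g \<in> g' <#\<^bsub>G\<^esub> K"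
      using that \<xi> g' by (auto simp: l_coset_def right_inv_def)
    then show ?thesis using g' by (simp add: delta_def coset rep)
  qed
  have "(\<Sum>B\<in>coset_supp G K \<xi>. ?c B) = (\<Sum>B\<in>coset_supp G K \<xi>. if g \<in> B then \<xi> g else 0)"
    using val by (rule sum.cong[OF refl])
  also have "\<dots> = \<xi> g"
  proof (cases "g \<in> carrier G \<and> \<xi> g \<noteq> 0")
    case True
    have "B = g <#\<^bsub>G\<^esub> K" if "B \<in> coset_supp G K \<xi>" "g \<in> B" for B
      using that True by (auto simp: coset_supp_def gK_eq_iff mem_gK) (metis gK_eq_iff)+
    moreover have "g \<in> g <#\<^bsub>G\<^esub> K" "g <#\<^bsub>G\<^esub> K \<in> coset_supp G K \<xi>"
      using True G.l_coset_self[OF K_subgroup] by (auto simp: coset_supp_def)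
    ultimately have "g \<in> B \<longleftrightarrow> g <#\<^bsub>G\<^esub> K = B" if "B \<in> coset_supp G K \<xi>" for B
      using that by blast
    then have "(\<Sum>B\<in>coset_supp G K \<xi>. if g \<in> B then \<xi> g else 0)
        = (\<Sum>B\<in>coset_supp G K \<xi>. if g <#\<^bsub>G\<^esub> K = B then \<xi> g else 0)"
      by (intro sum.cong refl if_cong)
    then show ?thesis using \<open>g <#\<^bsub>G\<^esub> K \<in> _\<close> \<xi> by simp
  next
    case False
    then have "\<xi> g = 0" using \<xi> by auto
    then have "(\<Sum>B\<in>coset_supp G K \<xi>. if g \<in> B then \<xi> g else 0) = (\<Sum>B\<in>coset_supp G K \<xi>. 0)"
      by (intro sum.cong refl) (simp only: if_cancel)
    then show ?thesis using \<open>\<xi> g = 0\<close> by simp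
  qed
  finally show "\<xi> g = (\<Sum>B\<in>coset_supp G K \<xi>. delta G K (\<xi> (SOME g. g \<in> B)) (SOME g. g \<in> B)) g"
    by (simp add: sum_fun_apply)
qed

subsection \<open>Coordinates of the coinvariants\<close>

text \<open>The coinvariants decompose over \<open>H\G/K\<close>; by Shapiro's lemma the summand of
  \<open>g\<close> is the space of \<open>stab g\<close>-coinvariants of the completion, which averaging identifies with
  the invariants.\<close>

definition coord_fun :: "'g \<Rightarrow> ('g \<Rightarrow> 'w) \<Rightarrow> 'h \<Rightarrow> 'w" where
  "coord_fun g \<xi> h = average (stab g) (act (inv h) (\<xi> (\<iota> h \<cdot> g)))"

definition coord :: "'g \<Rightarrow> ('g \<Rightarrow> 'w) \<Rightarrow> 'w" where
  "coord g \<xi> = coset_sum H (stab g) (coord_fun g \<xi>)"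

lemma cfun_lim: "\<xi> \<in> cfun \<Longrightarrow> g \<in> carrier G \<Longrightarrow> \<xi> g \<in> lim"
  by (simp add: cfun_iff)

text \<open>Replacing \<open>h\<close> by \<open>h \<otimes> \<gamma>\<close> does not change the
  value of \<xi>, by right \<open>K\<close>-invariance, but inserts the action of the inverse of
  \<gamma>. The average absorbs it, and this makes the coordinate a sum over cosets.\<close>

lemma coord_fun_right_inv:
  assumes "\<xi> \<in> cfun" "g \<in> carrier G"
  shows "right_inv H (stab g) (coord_fun g \<xi>)"
  unfolding right_inv_def
proof (intro ballI)
  fix h \<gamma> assume h: "h \<in> carrier H" and \<gamma>: "\<gamma> \<in> stab g"
  then have c: "\<gamma> \<in> carrier H" using stab_carrier assms by blast
  define k where "k = inv\<^bsub>G\<^esub> g \<cdot> \<iota> \<gamma> \<cdot> g"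
  have k: "k \<in> K" using \<gamma> assms by (simp add: mem_stab_iff k_def)
  have "\<iota> (h \<otimes> \<gamma>) \<cdot> g = (\<iota> h \<cdot> g) \<cdot> k"
    using h c assms by (simp add: k_def iota_mult G.m_assoc)
  then have \<xi>: "\<xi> (\<iota> (h \<otimes> \<gamma>) \<cdot> g) = \<xi> (\<iota> h \<cdot> g)"
    using assms h k by (simp add: cfun_iff right_inv_def)
  have "act (inv (h \<otimes> \<gamma>)) (\<xi> (\<iota> h \<cdot> g)) = act (inv \<gamma>) (act (inv h) (\<xi> (\<iota> h \<cdot> g)))"
    using h c assms by (simp add: inv_mult_group act_mult cfun_lim)
  moreover have "inv \<gamma> \<in> stab g" using \<gamma> subgroup.m_inv_closed[OF stab_subgroup] assms by blast
  ultimately show "coord_fun g \<xi> (h \<otimes> \<gamma>) = coord_fun g \<xi> h"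
    using h assms by (simp add: coord_fun_def \<xi> average_act[OF stab_level] act_lim cfun_lim)
qed

text \<open>A coset of the stabiliser is recovered from the coset of \<open>K\<close> to which it
  sends \<open>g\<close>, and only finitely many of the latter meet the support of \<xi>.\<close>

lemma finite_coset_supp_stab:
  assumes g: "g \<in> carrier G" and fin: "finite (coset_supp G K \<xi>)"
    and F: "\<And>h. h \<in> carrier H \<Longrightarrow> F h \<noteq> 0 \<Longrightarrow> \<xi> (\<iota> h \<cdot> g) \<noteq> 0"
  shows "finite (coset_supp H (stab g) F)"
proof -
  define C where "C B = {h \<in> carrier H. (\<iota> h \<cdot> g) <#\<^bsub>G\<^esub> K = B}" for B
  have "h <#\<^bsub>H\<^esub> stab g = C ((\<iota> h \<cdot> g) <#\<^bsub>G\<^esub> K)" if "h \<in> carrier H" for h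
    using that g by (auto simp: C_def mem_l_coset_iff level_subset stab_level stab_coset)
  then have "coset_supp H (stab g) F \<subseteq> C ` coset_supp G K \<xi>"
    using F g by (fastforce simp: coset_supp_def)
  then show ?thesis using fin finite_surj by blast
qed

lemma coord_fun_finite:
  assumes "\<xi> \<in> cfun" "g \<in> carrier G"
  shows "finite (coset_supp H (stab g) (coord_fun g \<xi>))"
proof (rule finite_coset_supp_stab[OF assms(2)])
  show "finite (coset_supp G K \<xi>)" using assms by (simp add: cfun_iff)
qed (use assms stab_level average_zero act_zero in \<open>auto simp: coord_fun_def\<close>)

lemma coord_add:
  assumes "\<xi> \<in> cfun" "\<eta> \<in> cfun" "g \<in> carrier G"
  shows "coord g (\<xi> + \<eta>) = coord g \<xi> + coord g \<eta>"
proof -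
  have "\<xi> + \<eta> \<in> cfun" using assms fn.subspace_add[OF cfun_subspace] by blast
  then have "coord g (\<xi> + \<eta>) = coset_sum H (stab g) (\<lambda>h. coord_fun g \<xi> h + coord_fun g \<eta> h)"
    unfolding coord_def using assms
    by (intro coset_sum_cong coord_fun_right_inv stab_subgroup)
       (auto simp: coord_fun_def act_add cfun_lim average_add[OF stab_level] act_lim)
  then show ?thesis using assms
    by (simp add: coord_def coset_sum_add coord_fun_right_inv coord_fun_finite stab_subgroup)
qed

lemma coord_scale:
  assumes "\<xi> \<in> cfun" "g \<in> carrier G"
  shows "coord g (fscale c \<xi>) = c \<odot> coord g \<xi>"
proof -
  have "fscale c \<xi> \<in> cfun" using assms fn.subspace_scale[OF cfun_subspace] by blast
  then have "coord g (fscale c \<xi>) = coset_sum H (stab g) (\<lambda>h. c \<odot> coord_fun g \<xi> h)"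
    unfolding coord_def using assms
    by (intro coset_sum_cong coord_fun_right_inv stab_subgroup)
       (auto simp: coord_fun_def act_scale cfun_lim average_scale[OF stab_level] act_lim)
  then show ?thesis
    using coset_sum_additive(1)[OF coord_fun_right_inv stab_subgroup coord_fun_finite,
        OF assms assms(2) assms, of UNIV "vsc c"]
    by (simp add: coord_def W.scale_right_distrib)
qed

lemma coord_zero: "g \<in> carrier G \<Longrightarrow> coord g 0 = 0"
  using coord_add[of 0 0 g] fn.subspace_0[OF cfun_subspace] by simp

lemma coord_diff:
  assumes "\<xi> \<in> cfun" "\<eta> \<in> cfun" "g \<in> carrier G"
  shows "coord g (\<xi> - \<eta>) = coord g \<xi> - coord g \<eta>"
  using coord_add[of "\<xi> - \<eta>" \<eta> g] assms fn.subspace_diff[OF cfun_subspace] by (simp add: eq_diff_eq)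

lemma coord_sum:
  assumes "g \<in> carrier G" "\<And>i. i \<in> A \<Longrightarrow> f i \<in> cfun"
  shows "coord g (sum f A) = (\<Sum>i\<in>A. coord g (f i))"
  using assms(2)
  by (induction A rule: infinite_finite_induct)
     (auto simp: coord_zero coord_add assms(1) fn.subspace_sum[OF cfun_subspace])

lemma translate_cfun:
  assumes "\<xi> \<in> cfun" "h \<in> carrier H"
  shows "translate G \<iota> act h \<xi> \<in> cfun"
proof -
  let ?t = "translate G \<iota> act h \<xi>"
  have "coset_supp G K ?t \<subseteq> (\<lambda>B. \<iota> h <#\<^bsub>G\<^esub> B) ` coset_supp G K \<xi>"
  proof
    fix B assume "B \<in> coset_supp G K ?t"
    then obtain g where g: "g \<in> carrier G" "?t g \<noteq> 0" "B = g <#\<^bsub>G\<^esub> K" by (auto simp: coset_supp_def)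
    then have "\<xi> (inv\<^bsub>G\<^esub> (\<iota> h) \<cdot> g) \<noteq> 0" using assms act_zero by (auto simp: translate_def)
    moreover have "B = \<iota> h <#\<^bsub>G\<^esub> ((inv\<^bsub>G\<^esub> (\<iota> h) \<cdot> g) <#\<^bsub>G\<^esub> K)"
      using g assms K_subset by (subst G.lcos_m_assoc) auto
    ultimately show "B \<in> (\<lambda>B. \<iota> h <#\<^bsub>G\<^esub> B) ` coset_supp G K \<xi>"
      using g assms by (auto simp: coset_supp_def)
  qed
  moreover have "\<xi> (inv\<^bsub>G\<^esub> (\<iota> h) \<cdot> (g \<cdot> k)) = \<xi> (inv\<^bsub>G\<^esub> (\<iota> h) \<cdot> g)"
    if "g \<in> carrier G" "k \<in> K" for g k
    using assms that by (simp add: cfun_iff right_inv_def flip: G.m_assoc)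
  ultimately show ?thesis using assms
    by (auto simp: cfun_iff right_inv_def translate_def intro!: act_lim intro: finite_subset)
qed

text \<open>Translating \<xi> reparametrises the sum by left multiplication with the inverse of
  \<open>h\<close>; the action on the value cancels against the change in
  \<open>inv x\<close>.\<close>

lemma coord_translate:
  assumes "\<xi> \<in> cfun" "h \<in> carrier H" "g \<in> carrier G"
  shows "coord g (translate G \<iota> act h \<xi>) = coord g \<xi>"
proof -
  have "coord g (translate G \<iota> act h \<xi>) = coset_sum H (stab g) (\<lambda>x. coord_fun g \<xi> (inv h \<otimes> x))"
    unfolding coord_def
  proof (intro coset_sum_cong coord_fun_right_inv stab_subgroup translate_cfun assms)
    fix x assume x: "x \<in> carrier H"
    have "inv\<^bsub>G\<^esub> (\<iota> h) \<cdot> (\<iota> x \<cdot> g) = \<iota> (inv h \<otimes> x) \<cdot> g"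
      using x assms by (simp add: iota_mult iota_inv G.m_assoc)
    moreover have "act (inv (inv h \<otimes> x)) w = act (inv x) (act h w)" if "w \<in> lim" for w
      using x assms that by (simp add: inv_mult_group act_mult)
    ultimately show "coord_fun g (translate G \<iota> act h \<xi>) x = coord_fun g \<xi> (inv h \<otimes> x)"
      using x assms by (simp add: coord_fun_def translate_def cfun_lim)
  qed
  then show ?thesis
    using coset_sum_translate[OF coord_fun_right_inv stab_subgroup] assms by (simp add: coord_def)
qed

lemma coord_kernel:
  assumes "\<xi> \<in> kernel" "g \<in> carrier G"
  shows "coord g \<xi> = 0"
proof -
  have "kernel \<subseteq> {\<xi> \<in> cfun. coord g \<xi> = 0}"
    unfolding coinvariant_kernel_def
  proof (rule fn.span_minimal)
    show "fn.subspace {\<xi> \<in> cfun. coord g \<xi> = 0}"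
      using assms(2) fn.subspace_0[OF cfun_subspace] fn.subspace_add[OF cfun_subspace]
        fn.subspace_scale[OF cfun_subspace]
      by (intro fn.subspaceI) (auto simp: coord_zero coord_add coord_scale)
  qed (use assms(2) in \<open>auto simp: coord_diff coord_translate translate_cfun
      intro!: fn.subspace_diff[OF cfun_subspace]\<close>)
  then show ?thesis using assms(1) by blast
qed

lemma mem_dcoset_iota:
  assumes "g \<in> carrier G"
  shows "x \<in> orbit g \<longleftrightarrow> (\<exists>h\<in>carrier H. \<exists>k\<in>K. x = \<iota> h \<cdot> g \<cdot> k)"
  using assms K_subset by (subst G.mem_dcoset_iff) auto

text \<open>The function is supported on one coset of \<open>K\<close>, so by
  \<open>stab_coset\<close> one coset of the stabiliser contributes.\<close>

lemma coord_delta: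
  assumes "w \<in> lim" "g \<in> carrier G" "h \<in> carrier H" "k \<in> K"
  shows "coord g (delta G K w (\<iota> h \<cdot> g \<cdot> k)) = average (stab g) (act (inv h) w)"
proof -
  let ?d = "delta G K w (\<iota> h \<cdot> g \<cdot> k)"
  have "(\<iota> h \<cdot> g) <#\<^bsub>G\<^esub> K = (\<iota> h \<cdot> g \<cdot> k) <#\<^bsub>G\<^esub> K"
    using assms by (simp add: gK_eq_iff G.inv_mult_group G.m_assoc K_inv)
  then have d: "?d g' = (if g' \<in> (\<iota> h \<cdot> g) <#\<^bsub>G\<^esub> K then w else 0)" for g'
    by (simp add: delta_def)
  have "coord g ?d = coord_fun g ?d h"
    unfolding coord_def
  proof (intro coset_sum_single coord_fun_right_inv stab_subgroup delta_cfun)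
    fix x assume x: "x \<in> carrier H" "coord_fun g ?d x \<noteq> 0"
    then have "?d (\<iota> x \<cdot> g) \<noteq> 0"
      using assms act_zero average_zero stab_level by (auto simp: coord_fun_def)
    then have "(\<iota> x \<cdot> g) <#\<^bsub>G\<^esub> K = (\<iota> h \<cdot> g) <#\<^bsub>G\<^esub> K"
      using x assms by (simp add: d mem_gK gK_eq_iff split: if_splits)
    then show "inv h \<otimes> x \<in> stab g" using x assms by (simp add: stab_coset)
  qed (use assms in auto)
  also have "?d (\<iota> h \<cdot> g) = w" using assms by (simp add: d G.l_coset_self[OF K_subgroup])
  then have "coord_fun g ?d h = average (stab g) (act (inv h) w)" by (simp add: coord_fun_def)
  finally show ?thesis .
qed

lemma coord_delta_other:
  assumes "g \<in> carrier G" "g' \<in> carrier G" "g' \<notin> orbit g"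
  shows "coord g (delta G K w g') = 0"
  unfolding coord_def
proof (rule coset_sum_zero)
  fix h assume h: "h \<in> carrier H"
  have "\<iota> h \<cdot> g \<notin> g' <#\<^bsub>G\<^esub> K"
  proof
    assume "\<iota> h \<cdot> g \<in> g' <#\<^bsub>G\<^esub> K"
    then have "inv\<^bsub>G\<^esub> (inv\<^bsub>G\<^esub> g' \<cdot> (\<iota> h \<cdot> g)) \<in> K" using h assms K_inv by (simp add: mem_gK)
    moreover have "g' = \<iota> h \<cdot> g \<cdot> inv\<^bsub>G\<^esub> (inv\<^bsub>G\<^esub> g' \<cdot> (\<iota> h \<cdot> g))"
      using h assms by (simp add: G.inv_mult_group G.m_assoc)
    ultimately show False using assms(1,3) h by (auto simp: mem_dcoset_iota)
  qed
  then show "coord_fun g (delta G K w g') h = 0"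
    using h assms by (simp add: coord_fun_def delta_def act_zero average_zero stab_level)
qed

lemma kernel_diffI: "h \<in> carrier H \<Longrightarrow> \<xi> \<in> cfun \<Longrightarrow> translate G \<iota> act h \<xi> - \<xi> \<in> kernel"
  unfolding coinvariant_kernel_def by (intro fn.span_base) blast

lemma kernel_subspace: "fn.subspace kernel"
  unfolding coinvariant_kernel_def by (rule fn.subspace_span)

lemma translate_delta:
  assumes "h \<in> carrier H" "g \<in> carrier G"
  shows "translate G \<iota> act h (delta G K w g) = delta G K (act h w) (\<iota> h \<cdot> g)"
proof
  fix x
  have "inv\<^bsub>G\<^esub> (\<iota> h \<cdot> g) \<cdot> x = inv\<^bsub>G\<^esub> g \<cdot> (inv\<^bsub>G\<^esub> (\<iota> h) \<cdot> x)" if "x \<in> carrier G"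
    using that assms by (simp add: G.inv_mult_group G.m_assoc)
  then show "translate G \<iota> act h (delta G K w g) x = delta G K (act h w) (\<iota> h \<cdot> g) x"
    using assms by (auto simp: translate_def delta_def mem_gK act_zero)
qed

lemma delta_add: "delta G K (v + w :: 'w) g = delta G K v g + delta G K w g"
  by (auto simp: delta_def fun_eq_iff)

lemma delta_zero: "delta G K 0 g = 0"
  by (auto simp: delta_def fun_eq_iff)

text \<open>Translation by the inverse of \<open>h\<close> moves the function to the base point
  \<open>g\<close>. There the stabiliser fixes the coset \<open>g K\<close> and acts on the value
  only, so each conjugate value may replace the original one, and with division by
  \<open>card R\<close> so may their mean.\<close>

lemma kernel_delta:
  assumes "w \<in> lim" "g \<in> carrier G" "h \<in> carrier H" "k \<in> K"
  shows "delta G K w (\<iota> h \<cdot> g \<cdot> k) - delta G K (average (stab g) (act (inv h) w)) g \<in> kernel"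
proof -
  define v where "v = act (inv h) w"
  have v: "v \<in> lim" using assms by (simp add: v_def act_lim)
  have "(\<iota> h \<cdot> g) <#\<^bsub>G\<^esub> K = (\<iota> h \<cdot> g \<cdot> k) <#\<^bsub>G\<^esub> K"
    using assms by (simp add: gK_eq_iff G.inv_mult_group G.m_assoc K_inv)
  then have "delta G K w (\<iota> h \<cdot> g \<cdot> k) = translate G \<iota> act h (delta G K v g)"
    using assms by (simp add: translate_delta v_def act_inv_cancel) (simp add: delta_def)
  then have 1: "delta G K w (\<iota> h \<cdot> g \<cdot> k) - delta G K v g \<in> kernel"
    using assms v by (simp add: kernel_diffI delta_cfun)
  obtain R where R: "finite R" "R \<subseteq> stab g" "R \<noteq> {}"
      "average (stab g) v = (1 / of_nat (card R)) \<odot> (\<Sum>\<gamma>\<in>R. act \<gamma> v)"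
    using average_eq_sum[OF stab_level v] assms by blast
  have "delta G K (act \<gamma> v) g - delta G K v g \<in> kernel" if "\<gamma> \<in> R" for \<gamma>
  proof -
    have \<gamma>: "\<gamma> \<in> carrier H" "inv \<gamma> \<in> stab g" "\<gamma> \<in> stab g"
      using that R assms stab_carrier subgroup.m_inv_closed[OF stab_subgroup] by blast+
    then have "(\<iota> \<gamma> \<cdot> g) <#\<^bsub>G\<^esub> K = g <#\<^bsub>G\<^esub> K"
      using assms stab_coset[of g \<gamma> \<one>] by simp
    then have "translate G \<iota> act \<gamma> (delta G K v g) = delta G K (act \<gamma> v) g"
      using assms \<gamma> by (simp add: translate_delta) (simp add: delta_def)
    then show ?thesis using kernel_diffI[OF \<gamma>(1) delta_cfun[OF v assms(2)]] by simp
  qed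
  then have "fscale (1 / of_nat (card R)) (\<Sum>\<gamma>\<in>R. delta G K (act \<gamma> v) g - delta G K v g) \<in> kernel"
    using kernel_subspace by (intro fn.subspace_scale fn.subspace_sum)
  also have "fscale (1 / of_nat (card R)) (\<Sum>\<gamma>\<in>R. delta G K (act \<gamma> v) g - delta G K v g)
      = delta G K (average (stab g) v) g - delta G K v g"
  proof -
    have "(\<Sum>\<gamma>\<in>R. v) = of_nat (card R) \<odot> v" using W.scale_sum_left[of "\<lambda>_. 1" R v] by simp
    then have "(1 / of_nat (card R)) \<odot> (\<Sum>\<gamma>\<in>R. v) = v" using R by simp
    then show ?thesis unfolding R(4)
      by (auto simp: delta_def sum_fun_apply fun_eq_iff sum_subtractf W.scale_right_diff_distrib)
  qed
  finally have "delta G K w (\<iota> h \<cdot> g \<cdot> k) - delta G K v g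
      - (delta G K (average (stab g) v) g - delta G K v g) \<in> kernel"
    by (rule fn.subspace_diff[OF kernel_subspace 1])
  then show ?thesis by (simp add: v_def)
qed

text \<open>The converse of \<open>coord_kernel\<close> for functions supported on finitely many
  double cosets: modulo the kernel, such a function is the sum of its coordinates placed at the base
  points.\<close>

lemma mem_kernel_if_coords_zero:
  assumes \<xi>: "\<xi> \<in> cfun" and "finite A"
    and A: "\<And>\<alpha>. \<alpha> \<in> A \<Longrightarrow> r \<alpha> \<in> carrier G \<and> \<alpha> = orbit (r \<alpha>)"
    and disj: "\<And>\<alpha> \<beta>. \<alpha> \<in> A \<Longrightarrow> \<beta> \<in> A \<Longrightarrow> \<alpha> \<noteq> \<beta> \<Longrightarrow> \<alpha> \<inter> \<beta> = {}"
    and supp: "\<And>g. g \<in> carrier G \<Longrightarrow> \<xi> g \<noteq> 0 \<Longrightarrow> g \<in> \<Union>A"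
    and zero: "\<And>\<alpha>. \<alpha> \<in> A \<Longrightarrow> coord (r \<alpha>) \<xi> = 0"
  shows "\<xi> \<in> kernel"
proof -
  \<comment> \<open>The normal form of a class, with one value at each base point.\<close>
  define D where "D \<eta> = (\<Sum>\<alpha>\<in>A. delta G K (coord (r \<alpha>) \<eta>) (r \<alpha>))" for \<eta>
  have single: "delta G K w g - D (delta G K w g) \<in> kernel" if w: "w \<in> lim" and g: "g \<in> \<Union>A" for w g
  proof -
    obtain \<alpha> where \<alpha>: "\<alpha> \<in> A" "g \<in> \<alpha>" using g by blast
    then obtain h k where hk: "h \<in> carrier H" "k \<in> K" "g = \<iota> h \<cdot> r \<alpha> \<cdot> k"
      using A[OF \<alpha>(1)] mem_dcoset_iota by blast
    have gc: "g \<in> carrier G" using hk A[OF \<alpha>(1)] by simp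
    have "coord (r \<beta>) (delta G K w g) = 0" if "\<beta> \<in> A" "\<beta> \<noteq> \<alpha>" for \<beta>
    proof -
      have "g \<notin> \<beta>" using disj[OF \<alpha>(1) that(1)] that(2) \<alpha>(2) by blast
      then show ?thesis using A[OF that(1)] gc coord_delta_other by metis
    qed
    then have "D (delta G K w g) = (\<Sum>\<beta>\<in>A. if \<beta> = \<alpha> then delta G K (coord (r \<alpha>) (delta G K w g)) (r \<alpha>) else 0)"
      unfolding D_def by (intro sum.cong) (auto simp: delta_zero)
    also have "\<dots> = delta G K (average (stab (r \<alpha>)) (act (inv h) w)) (r \<alpha>)"
      using \<alpha>(1) \<open>finite A\<close> w hk A[OF \<alpha>(1)] by (simp add: coord_delta)
    finally show ?thesis using kernel_delta[OF w _ hk(1,2)] A[OF \<alpha>(1)] hk(3) by simp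
  qed
  have add: "D (\<eta> + \<eta>') = D \<eta> + D \<eta>'" if "\<eta> \<in> cfun" "\<eta>' \<in> cfun" for \<eta> \<eta>'
    using that A by (simp add: D_def coord_add delta_add sum.distrib)
  have "D 0 = 0" using A by (simp add: D_def coord_zero delta_zero)
  let ?f = "\<lambda>B. delta G K (\<xi> (SOME g. g \<in> B)) (SOME g. g \<in> B)"
  have rep: "(SOME g. g \<in> B) \<in> carrier G \<and> \<xi> (SOME g. g \<in> B) \<noteq> 0" if "B \<in> coset_supp G K \<xi>" for B
  proof -
    obtain g where g: "g \<in> carrier G" "\<xi> g \<noteq> 0" "B = g <#\<^bsub>G\<^esub> K" using \<open>B \<in> _\<close> by (auto simp: coset_supp_def)
    obtain k where "k \<in> K" "(SOME x. x \<in> B) = g \<cdot> k"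
      using G.l_coset_rep[OF K_subgroup g(1)] g(3) by blast
    then show ?thesis using g \<xi> by (simp add: cfun_iff right_inv_def)
  qed
  \<comment> \<open>Membership in \<open>cfun\<close> is part of the induction because
    \<open>D\<close> is known to be additive only there.\<close>
  have "sum ?f S \<in> cfun \<and> sum ?f S - D (sum ?f S) \<in> kernel" if "finite S" "S \<subseteq> coset_supp G K \<xi>" for S
    using that
  proof (induction S rule: finite_induct)
    case empty
    show ?case using fn.subspace_0[OF cfun_subspace] fn.subspace_0[OF kernel_subspace]
      by (simp only: sum.empty \<open>D 0 = 0\<close> diff_zero simp_thms)
  next
    case (insert B S)
    then have B: "(SOME g. g \<in> B) \<in> carrier G" "\<xi> (SOME g. g \<in> B) \<noteq> 0" using rep by auto
    then have f: "?f B \<in> cfun" using \<xi> by (simp add: delta_cfun cfun_lim)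
    have "?f B - D (?f B) \<in> kernel" using B supp cfun_lim[OF \<xi>] by (intro single) auto
    moreover have S: "sum ?f S \<in> cfun" "sum ?f S - D (sum ?f S) \<in> kernel"
      using insert.IH insert.prems by blast+
    ultimately have "(?f B - D (?f B)) + (sum ?f S - D (sum ?f S)) \<in> kernel"
      using fn.subspace_add[OF kernel_subspace] by blast
    moreover have "(?f B - D (?f B)) + (sum ?f S - D (sum ?f S)) = (?f B + sum ?f S) - D (?f B + sum ?f S)"
      unfolding add[OF f S(1)] by (rule add_diff_add[symmetric])
    ultimately show ?case
      unfolding sum.insert[OF insert.hyps] using fn.subspace_add[OF cfun_subspace f S(1)] by metis
  qed
  from this[of "coset_supp G K \<xi>"] have "\<xi> - D \<xi> \<in> kernel"
    using \<xi> cfun_decomposition[OF \<xi>] by (simp add: cfun_iff)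
  moreover have "D \<xi> = 0" using zero by (simp add: D_def delta_zero)
  ultimately show ?thesis by simp
qed

end

section \<open>Twisted restrictions and presentations\<close>

context plain_group begin

lemma r_coset_eq_iff:
  assumes "subgroup P G" "g \<in> carrier G" "h \<in> carrier G"
  shows "P #> g = P #> h \<longleftrightarrow> g \<otimes> inv h \<in> P"
proof -
  have "g \<in> P #> h \<longleftrightarrow> g \<otimes> inv h \<in> P"
    using assms by (simp add: mem_r_coset_iff subgroup.subset)
  then show ?thesis
    using assms rcos_self[of g P] repr_independence[of g P h] by metis
qed

lemma dcoset_self:
  assumes "subgroup P G" "subgroup Q G" "g \<in> carrier G"
  shows "g \<in> dcoset G P g Q"
proof -
  have "g = \<one> \<otimes> g \<otimes> \<one>" using assms by simp
  then show ?thesis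
    using assms subgroup.one_closed unfolding mem_dcoset_iff[OF assms(3) subgroup.subset[OF assms(1)] subgroup.subset[OF assms(2)]]
    by metis
qed

lemma dcoset_subset_carrier:
  assumes "subgroup P G" "subgroup Q G" "g \<in> carrier G"
  shows "dcoset G P g Q \<subseteq> carrier G"
  using assms by (auto simp: mem_dcoset_iff subgroup.subset subgroup.mem_carrier)

lemma dcoset_mult_mem:
  assumes "subgroup P G" "subgroup Q G" "g \<in> carrier G" "x \<in> dcoset G P g Q" "p \<in> P" "q \<in> Q"
  shows "p \<otimes> x \<otimes> q \<in> dcoset G P g Q"
proof -
  note sub = subgroup.subset[OF assms(1)] subgroup.subset[OF assms(2)]
  obtain p' q' where x: "p' \<in> P" "q' \<in> Q" "x = p' \<otimes> g \<otimes> q'"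
    using assms(4) mem_dcoset_iff[OF assms(3) sub] by blast
  have "p \<in> carrier G" "q \<in> carrier G" "p' \<in> carrier G" "q' \<in> carrier G" using assms x sub by auto
  then have "p \<otimes> x \<otimes> q = (p \<otimes> p') \<otimes> g \<otimes> (q' \<otimes> q)" using x assms(3) by (simp add: m_assoc)
  then show ?thesis
    using subgroup.m_closed[OF assms(1) assms(5) x(1)] subgroup.m_closed[OF assms(2) x(2) assms(6)]
    unfolding mem_dcoset_iff[OF assms(3) sub] by blast
qed

lemma dcoset_eq:
  assumes "subgroup P G" "subgroup Q G" "g \<in> carrier G" "x \<in> dcoset G P g Q"
  shows "dcoset G P x Q = dcoset G P g Q"
proof -
  have x: "x \<in> carrier G" using assms dcoset_subset_carrier by blast
  note sub = subgroup.subset[OF assms(1)] subgroup.subset[OF assms(2)]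
  obtain p q where pq: "p \<in> P" "q \<in> Q" "x = p \<otimes> g \<otimes> q"
    using assms(4) mem_dcoset_iff[OF assms(3) sub] by blast
  have c: "p \<in> carrier G" "q \<in> carrier G" using pq sub by auto
  have "g = inv p \<otimes> x \<otimes> inv q" using pq c assms(3) by (simp add: m_assoc)
  moreover have "inv p \<otimes> x \<otimes> inv q \<in> dcoset G P x Q"
    using pq assms x by (intro dcoset_mult_mem dcoset_self subgroup.m_inv_closed)
  ultimately have g: "g \<in> dcoset G P x Q" by simp
  have *: "dcoset G P a Q \<subseteq> dcoset G P b Q" if "b \<in> carrier G" "a \<in> dcoset G P b Q" for a b
  proof
    have a: "a \<in> carrier G" using dcoset_subset_carrier[OF assms(1,2) that(1)] that(2) by blast
    fix y assume "y \<in> dcoset G P a Q"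
    then obtain p q where "p \<in> P" "q \<in> Q" "y = p \<otimes> a \<otimes> q" using mem_dcoset_iff[OF a sub] by blast
    then show "y \<in> dcoset G P b Q" using dcoset_mult_mem[OF assms(1,2) that] by simp
  qed
  show ?thesis using *[OF assms(3,4)] *[OF x g] by blast
qed

end

text \<open>The coefficient is constant on double cosets and each double coset is a disjoint union
  of left cosets, so the nested sum collapses to one sum over \<open>H/U\<close>, to which the coset
  calculus applies.\<close>

lemma (in completion) dcoset_act_eq_coset_sum:
  assumes P: "P \<in> \<Upsilon>" and U: "U \<in> \<Upsilon>"
    and f: "\<And>p h u. p \<in> P \<Longrightarrow> h \<in> carrier H \<Longrightarrow> u \<in> U \<Longrightarrow> f (p \<otimes> h \<otimes> u) = f h"
    and fin: "finite (coset_supp H U f)"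
    and w: "w \<in> lim" "\<And>u. u \<in> U \<Longrightarrow> act u w = w"
  shows "right_inv H U (\<lambda>\<beta>. \<phi> (f \<beta>) \<odot> act \<beta> w)"
    and "dcoset_act H vsc act \<phi> P U f w = coset_sum H U (\<lambda>\<beta>. \<phi> (f \<beta>) \<odot> act \<beta> w)"
proof -
  note sub = level_subgroup[OF P] level_subgroup[OF U]
  have c: "p \<in> P \<Longrightarrow> p \<in> carrier H" "u \<in> U \<Longrightarrow> u \<in> carrier H" for p u
    using level_subset P U by auto
  have fU: "f (h \<otimes> u) = f h" if "h \<in> carrier H" "u \<in> U" for h u
    using f[OF subgroup.one_closed[OF sub(1)] that] that c by simp
  show inv: "right_inv H U (\<lambda>\<beta>. \<phi> (f \<beta>) \<odot> act \<beta> w)"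
    using c w by (auto simp: right_inv_def fU act_mult)
  define \<D> where "\<D> = {dcoset H P h U | h. h \<in> carrier H \<and> f h \<noteq> 0}"
  define C where "C D = {\<beta> <#\<^bsub>H\<^esub> U | \<beta>. \<beta> \<in> D}" for D
  define rep where "rep B = (SOME \<beta>. \<beta> \<in> B)" for B :: "'h set"
  have D: "\<beta> \<in> carrier H" "f \<beta> \<noteq> 0" "f \<beta> = f (rep D)" "dcoset H P \<beta> U = D"
    if DD: "D \<in> \<D>" "\<beta> \<in> D" for D \<beta>
  proof -
    obtain h where h: "h \<in> carrier H" "f h \<noteq> 0" "D = dcoset H P h U" using DD(1) by (auto simp: \<D>_def)
    have fD: "f \<beta> = f h" if "\<beta> \<in> D" for \<beta>
      using that h(1,3) f mem_dcoset_iff[OF h(1) level_subset[OF P] level_subset[OF U]] by auto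
    have "rep D \<in> D" unfolding rep_def using that(2) by (rule someI)
    with fD that h(2) show "f \<beta> \<noteq> 0" "f \<beta> = f (rep D)" by auto
    show "\<beta> \<in> carrier H" using that h dcoset_subset_carrier[OF sub] by blast
    show "dcoset H P \<beta> U = D" using dcoset_eq[OF sub h(1)] that h by blast
  qed
  have repB: "rep (\<beta> <#\<^bsub>H\<^esub> U) \<in> D" if DD: "D \<in> \<D>" "\<beta> \<in> D" for D \<beta>
  proof -
    obtain u where u: "u \<in> U" "rep (\<beta> <#\<^bsub>H\<^esub> U) = \<beta> \<otimes> u"
      using l_coset_rep[OF sub(2) D(1)[OF DD]] unfolding rep_def by blast
    have "\<one> \<otimes> \<beta> \<otimes> u \<in> dcoset H P \<beta> U"
      using u D(1)[OF DD] by (intro dcoset_mult_mem sub dcoset_self subgroup.one_closed)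
    then show ?thesis using u D[OF DD] by simp
  qed
  have CD: "C D \<subseteq> coset_supp H U f" if "D \<in> \<D>" for D
    using D[OF that] by (auto simp: C_def coset_supp_def)
  have UN: "(\<Union>D\<in>\<D>. C D) = coset_supp H U f"
  proof (intro equalityI subsetI)
    fix B assume "B \<in> coset_supp H U f"
    then obtain h where h: "h \<in> carrier H" "f h \<noteq> 0" "B = h <#\<^bsub>H\<^esub> U" by (auto simp: coset_supp_def)
    then have "dcoset H P h U \<in> \<D>" "B \<in> C (dcoset H P h U)"
      using dcoset_self[OF sub h(1)] by (auto simp: \<D>_def C_def)
    then show "B \<in> (\<Union>D\<in>\<D>. C D)" by blast
  qed (use CD in blast)
  have "\<D> \<subseteq> (\<lambda>B. dcoset H P (rep B) U) ` coset_supp H U f"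
  proof
    fix E assume E: "E \<in> \<D>"
    then obtain h where h: "h \<in> carrier H" "f h \<noteq> 0" "E = dcoset H P h U" by (auto simp: \<D>_def)
    then have "h \<in> E" using dcoset_self[OF sub] by simp
    then have "E = dcoset H P (rep (h <#\<^bsub>H\<^esub> U)) U" using D(4)[OF E repB[OF E]] by simp
    then show "E \<in> (\<lambda>B. dcoset H P (rep B) U) ` coset_supp H U f"
      using h by (auto simp: coset_supp_def)
  qed
  then have fin\<D>: "finite \<D>" using fin finite_surj by blast
  have disj: "C D \<inter> C E = {}" if DE: "D \<in> \<D>" "E \<in> \<D>" "D \<noteq> E" for D E
  proof (rule equals0I)
    fix B assume "B \<in> C D \<inter> C E"
    then obtain \<beta> \<gamma> where B: "B = \<beta> <#\<^bsub>H\<^esub> U" "\<beta> \<in> D" "B = \<gamma> <#\<^bsub>H\<^esub> U" "\<gamma> \<in> E"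
      unfolding C_def by blast
    have "rep B \<in> D" "rep B \<in> E"
      using repB[OF DE(1) B(2)] repB[OF DE(2) B(4)] unfolding B(1)[symmetric] B(3)[symmetric] by auto
    then show False using D(4) DE by metis
  qed
  let ?F = "\<lambda>B. \<phi> (f (rep B)) \<odot> act (rep B) w"
  have "dcoset_act H vsc act \<phi> P U f w = (\<Sum>D\<in>\<D>. \<phi> (f (rep D)) \<odot> (\<Sum>B\<in>C D. act (rep B) w))"
    by (simp add: dcoset_act_def \<D>_def C_def rep_def)
  also have "\<dots> = (\<Sum>D\<in>\<D>. \<Sum>B\<in>C D. ?F B)"
    unfolding W.scale_sum_right
  proof (intro sum.cong refl)
    fix D' B assume D': "D' \<in> \<D>" "B \<in> C D'"
    then obtain \<beta> where "\<beta> \<in> D'" "B = \<beta> <#\<^bsub>H\<^esub> U" by (auto simp: C_def)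
    then show "\<phi> (f (rep D')) \<odot> act (rep B) w = ?F B" using D(3)[OF D'(1) repB[OF D'(1)]] by simp
  qed
  also have "\<dots> = (\<Sum>B\<in>coset_supp H U f. ?F B)"
    unfolding UN[symmetric]
    by (rule sum.UNION_disjoint[symmetric])
       (use fin\<D> disj finite_subset[OF CD fin] in auto)
  also have "\<dots> = coset_sum H U (\<lambda>\<beta>. \<phi> (f \<beta>) \<odot> act \<beta> w)"
    unfolding rep_def
    by (rule coset_sum_superset[OF inv sub(2) fin coset_supp_mono coset_supp_subset, symmetric]) auto
  finally show "dcoset_act H vsc act \<phi> P U f w = coset_sum H U (\<lambda>\<beta>. \<phi> (f \<beta>) \<odot> act \<beta> w)" .
qed

lemma additive_sum_list:
  fixes f :: "'a::ab_group_add \<Rightarrow> 'b::ab_group_add"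
  assumes "0 \<in> A" "\<And>x y. x \<in> A \<Longrightarrow> y \<in> A \<Longrightarrow> x + y \<in> A"
    "\<And>x y. x \<in> A \<Longrightarrow> y \<in> A \<Longrightarrow> f (x + y) = f x + f y"
    "\<And>b. b \<in> set bs \<Longrightarrow> t b \<in> A"
  shows "(\<Sum>b\<leftarrow>bs. t b) \<in> A" "f (\<Sum>b\<leftarrow>bs. t b) = (\<Sum>b\<leftarrow>bs. f (t b))"
proof -
  have "f 0 = 0" using assms(3)[OF assms(1,1)] by simp
  then have "(\<Sum>b\<leftarrow>bs. t b) \<in> A \<and> f (\<Sum>b\<leftarrow>bs. t b) = (\<Sum>b\<leftarrow>bs. f (t b))"
    using assms(4) by (induction bs) (auto simp: assms(1-3))
  then show "(\<Sum>b\<leftarrow>bs. t b) \<in> A" "f (\<Sum>b\<leftarrow>bs. t b) = (\<Sum>b\<leftarrow>bs. f (t b))" by auto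
qed

lemma sum_list_group:
  fixes f :: "'a \<Rightarrow> 'b::ab_group_add"
  assumes "finite \<Delta>" "d ` set bs \<subseteq> \<Delta>"
  shows "(\<Sum>b\<leftarrow>bs. f b) = (\<Sum>\<delta>\<in>\<Delta>. \<Sum>b\<leftarrow>filter (\<lambda>b. d b = \<delta>) bs. f b)"
  using assms(2)
proof (induction bs)
  case (Cons b bs)
  have "(\<Sum>\<delta>\<in>\<Delta>. \<Sum>b\<leftarrow>filter (\<lambda>b. d b = \<delta>) (b # bs). f b)
      = (\<Sum>\<delta>\<in>\<Delta>. (if d b = \<delta> then f b else 0) + (\<Sum>b\<leftarrow>filter (\<lambda>b. d b = \<delta>) bs. f b))"
    by (intro sum.cong) auto
  then show ?case using Cons assms(1) by (simp add: sum.distrib)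
qed simp

section \<open>The coordinate of the Hecke translate\<close>

locale hecke_setup = zeta_setup H TH \<Upsilon>H \<mu> MH \<phi> W G TG \<Upsilon>G \<iota> K
  for H :: "'h monoid" (structure) and TH \<Upsilon>H \<mu>
    and MH :: "('h, 'o::{idom,ring_char_0}, 'm::ab_group_add) ric"
    and \<phi> :: "'o \<Rightarrow> 'f::field_char_0"
    and W :: "('h, 'm, 'f, 'w::ab_group_add) realisation"
    and G :: "'g monoid" and TG \<Upsilon>G and \<iota> :: "'h \<Rightarrow> 'g" and K +
  fixes \<hh> :: "'g \<Rightarrow> 'o" and x :: 'm and L :: "'g set"
  assumes hecke: "is_hecke_function G K \<hh>"
    and x: "x \<in> val MH (trace_on H \<iota> K)"
    and L: "L \<in> \<Upsilon>G" and L_normal: "L \<lhd> G\<lparr>carrier := K\<rparr>"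
begin

abbreviation U where "U \<equiv> trace_on H \<iota> K"

lemma U_level: "U \<in> \<Upsilon>H" using trace_level K by blast

lemma mem_U_iff: "h \<in> U \<longleftrightarrow> h \<in> carrier H \<and> \<iota> h \<in> K"
  by (simp add: trace_on_def)

text \<open>Each double coset is compact, hence meets finitely many left and finitely many right
  cosets of \<open>K\<close>. The right ones matter because the transpose evaluates at
  inverses.\<close>

lemma hecke_outside: "g \<notin> carrier G \<Longrightarrow> \<hh> g = 0"
  and hecke_biinvariant:
    "k \<in> K \<Longrightarrow> g \<in> carrier G \<Longrightarrow> k' \<in> K \<Longrightarrow> \<hh> (k \<cdot> g \<cdot> k') = \<hh> g"
  and hecke_finite_left: "finite (coset_supp G K \<hh>)"
  and hecke_finite_right: "finite ((\<lambda>g. K #>\<^bsub>G\<^esub> g) ` {g \<in> carrier G. \<hh> g \<noteq> 0})"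
proof -
  obtain S c where S: "finite S" "S \<subseteq> {dcoset G K g K | g. g \<in> carrier G}"
    and h: "\<hh> = (\<lambda>g. \<Sum>D\<in>S. c D * of_bool (g \<in> D))"
    using hecke by (auto simp: is_hecke_function_def)
  have sub: "D \<subseteq> carrier G" if "D \<in> S" for D
    using that S(2) G.dcoset_subset_carrier[OF K_subgroup K_subgroup] by blast
  then show "\<hh> g = 0" if "g \<notin> carrier G"
    using that unfolding h by (intro sum.neutral) auto
  have supp: "g \<in> \<Union>S" if "\<hh> g \<noteq> 0" for g
  proof (rule ccontr)
    assume "g \<notin> \<Union>S"
    then have "\<hh> g = 0" unfolding h by (intro sum.neutral) auto
    with that show False by simp
  qed
  have comp: "compactin TG D" if "D \<in> S" for D
    using that S(2) G.compactin_dcoset[OF K_compact K_compact] by blast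
  have "finite (\<Union>D\<in>S. (\<lambda>g. g <#\<^bsub>G\<^esub> K) ` D)"
    using S(1) G.finite_l_cosets[OF comp K_subgroup K_open] by blast
  then show "finite (coset_supp G K \<hh>)"
    by (rule finite_subset[rotated]) (use supp in \<open>auto simp: coset_supp_def\<close>)
  have "finite (\<Union>D\<in>S. (\<lambda>g. K #>\<^bsub>G\<^esub> g) ` D)"
    using S(1) G.finite_r_cosets[OF comp K_subgroup K_open] by blast
  then show "finite ((\<lambda>g. K #>\<^bsub>G\<^esub> g) ` {g \<in> carrier G. \<hh> g \<noteq> 0})"
    by (rule finite_subset[rotated]) (use supp in auto)
  show "\<hh> (k \<cdot> g \<cdot> k') = \<hh> g" if k: "k \<in> K" "g \<in> carrier G" "k' \<in> K" for k g k'
  proof -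
    have "k \<cdot> g \<cdot> k' \<in> D \<longleftrightarrow> g \<in> D" if "D \<in> S" for D
    proof -
      obtain a where a: "a \<in> carrier G" "D = dcoset G K a K" using \<open>D \<in> S\<close> S(2) by blast
      have "inv\<^bsub>G\<^esub> k \<cdot> (k \<cdot> g \<cdot> k') \<cdot> inv\<^bsub>G\<^esub> k' = g" using k by (simp add: G.m_assoc)
      then show ?thesis
        using G.dcoset_mult_mem[OF K_subgroup K_subgroup a(1)] k K_inv unfolding a(2) by metis
    qed
    then show ?thesis unfolding h by (intro sum.cong) auto
  qed
qed

abbreviation source :: "'g \<Rightarrow> 'w" where "source \<equiv> \<lambda>g. \<phi> (\<hh> g) \<odot> j U x"

lemma source_cfun: "source \<in> cfun"
proof -
  have "\<hh> (g \<cdot> k) = \<hh> g" if "g \<in> carrier G" "k \<in> K" for g k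
    using hecke_biinvariant[of "\<one>\<^bsub>G\<^esub>" g k] that by simp
  moreover have "finite (coset_supp G K source)"
    by (rule finite_subset[OF G.coset_supp_mono hecke_finite_left]) auto
  ultimately show ?thesis using U_level x
    by (auto simp: cfun_iff right_inv_def hecke_outside intro!: lim_scale lim_j)
qed

definition twisted :: "'g \<Rightarrow> 'w" where
  "twisted g = dcoset_act H vsc act \<phi> (stab g) U
     (transpose_fun H (twisted_restriction H G \<iota> \<hh> g)) (j U x)"

lemma twisted_zero:
  assumes "\<And>h. h \<in> carrier H \<Longrightarrow> \<hh> (\<iota> h \<cdot> g) = 0"
  shows "twisted g = 0"
proof -
  have "{dcoset H (stab g) h U | h. h \<in> carrier H \<and> transpose_fun H (twisted_restriction H G \<iota> \<hh> g) h \<noteq> 0} = {}"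
    using assms by (auto simp: transpose_fun_def twisted_restriction_def)
  then show ?thesis by (simp only: twisted_def dcoset_act_def sum.empty)
qed

text \<open>The coordinate sums averages of \<open>\<hh>(h g) h\<^sup>-\<^sup>1 w\<close> over
  \<open>H/H_g\<close>, the twisted restriction sums
  \<open>\<hh>(\<beta>\<^sup>-\<^sup>1 g) \<beta> w\<close> over \<open>H/U\<close>. The
  substitution of \<open>h\<^sup>-\<^sup>1\<close> for \<open>\<beta>\<close> exchanges them at the
  cost of the factor \<open>[U : H_g]\<close>.\<close>

lemma coord_source:
  assumes g: "g \<in> carrier G"
  shows "coord g source = index U (stab g) \<odot> twisted g"
proof -
  define f where "f = transpose_fun H (twisted_restriction H G \<iota> \<hh> g)"
  define w where "w = j U x"
  note P = stab_level[OF g]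
  have f: "f \<beta> = \<hh> (inv\<^bsub>G\<^esub> (\<iota> \<beta>) \<cdot> g)" if "\<beta> \<in> carrier H" for \<beta>
    using that by (simp add: f_def transpose_fun_def twisted_restriction_def iota_inv)
  have w: "w \<in> lim" "act u w = w" if "u \<in> U" for u
    using that U_level x by (auto simp: w_def lim_j act_fixed)
  have w_lim: "w \<in> lim" using U_level x by (simp add: w_def lim_j)
  have f_inv: "f (\<gamma> \<otimes> \<beta> \<otimes> u) = f \<beta>" if \<gamma>: "\<gamma> \<in> stab g" "\<beta> \<in> carrier H" "u \<in> U" for \<gamma> \<beta> u
  proof -
    have c: "\<gamma> \<in> carrier H" "u \<in> carrier H" "\<iota> u \<in> K" using \<gamma> stab_carrier[OF g] by (auto simp: mem_U_iff)
    define k where "k = inv\<^bsub>G\<^esub> g \<cdot> \<iota> \<gamma> \<cdot> g"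
    have k: "k \<in> K" using \<gamma> g by (simp add: k_def mem_stab_iff)
    have "inv\<^bsub>G\<^esub> (\<iota> (\<gamma> \<otimes> \<beta> \<otimes> u)) \<cdot> g
        = inv\<^bsub>G\<^esub> (\<iota> u) \<cdot> (inv\<^bsub>G\<^esub> (\<iota> \<beta>) \<cdot> g) \<cdot> inv\<^bsub>G\<^esub> k"
      using g c \<gamma>(2) by (simp add: k_def iota_mult G.inv_mult_group G.m_assoc)
    then show ?thesis using hecke_biinvariant[OF K_inv[OF c(3)] _ K_inv[OF k]] g c \<gamma>(2) by (simp add: f)
  qed
  have f_fin: "finite (coset_supp H U f)"
  proof -
    \<comment> \<open>The coset of \<beta> in \<open>H/U\<close> is determined by the right coset of
      \<open>K\<close> through \<open>\<beta>\<^sup>-\<^sup>1 g\<close>, and \<hh> meets finitely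
      many of those.\<close>
    define C where "C R = {\<beta> \<in> carrier H. K #>\<^bsub>G\<^esub> (inv\<^bsub>G\<^esub> (\<iota> \<beta>) \<cdot> g) = R}" for R
    have "\<beta> <#\<^bsub>H\<^esub> U = C (K #>\<^bsub>G\<^esub> (inv\<^bsub>G\<^esub> (\<iota> \<beta>) \<cdot> g))" if "\<beta> \<in> carrier H" for \<beta>
    proof -
      have "inv \<beta> \<otimes> \<beta>' \<in> U \<longleftrightarrow> K #>\<^bsub>G\<^esub> (inv\<^bsub>G\<^esub> (\<iota> \<beta>) \<cdot> g) = K #>\<^bsub>G\<^esub> (inv\<^bsub>G\<^esub> (\<iota> \<beta>') \<cdot> g)"
        if "\<beta>' \<in> carrier H" for \<beta>'
        using that \<open>\<beta> \<in> _\<close> g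
        by (simp add: G.r_coset_eq_iff[OF K_subgroup] mem_U_iff iota_mult iota_inv G.inv_mult_group G.m_assoc)
      then show ?thesis using that level_subset[OF U_level] by (auto simp: C_def mem_l_coset_iff)
    qed
    then have "coset_supp H U f \<subseteq> C ` (\<lambda>g. K #>\<^bsub>G\<^esub> g) ` {g \<in> carrier G. \<hh> g \<noteq> 0}"
      using g by (auto simp: coset_supp_def f)
    then show ?thesis using hecke_finite_right by (meson finite_imageI finite_subset)
  qed
  define F0 where "F0 \<beta> = \<phi> (f \<beta>) \<odot> act \<beta> w" for \<beta>
  note F0 = dcoset_act_eq_coset_sum[OF P U_level f_inv f_fin w_lim w(2), folded F0_def]
  have F0_lim: "F0 \<beta> \<in> lim" if "\<beta> \<in> carrier H" for \<beta>
    using that w_lim by (auto simp: F0_def intro!: lim_scale act_lim)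
  have F0_fin: "finite (coset_supp H U F0)"
    by (rule finite_subset[OF coset_supp_mono f_fin]) (auto simp: F0_def)
  have tw: "twisted g = coset_sum H U F0" using F0(2) by (simp add: twisted_def f_def w_def)
  note U_sub = level_subgroup[OF U_level]
  have tw_lim: "twisted g \<in> lim"
    unfolding tw by (rule coset_sum_additive(2)[OF F0(1) U_sub F0_fin F0_lim, where t = "\<lambda>x. x"])
       (auto intro: lim_add)
  \<comment> \<open>Acting by \<gamma> only permutes the summands, the coefficient being left
    invariant under the stabiliser.\<close>
  have tw_inv: "act \<gamma> (twisted g) = twisted g" if \<gamma>: "\<gamma> \<in> stab g" for \<gamma>
  proof -
    have c: "\<gamma> \<in> carrier H" using \<gamma> stab_carrier g by blast
    have "act \<gamma> (twisted g) = coset_sum H U (\<lambda>\<beta>. act \<gamma> (F0 \<beta>))"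
      unfolding tw
      by (rule coset_sum_additive(1)[OF F0(1) U_sub F0_fin F0_lim, symmetric])
         (use c in \<open>auto intro: lim_add simp: act_zero act_add\<close>)
    also have "\<dots> = coset_sum H U (\<lambda>\<beta>. F0 (\<gamma> \<otimes> \<beta>))"
    proof (rule coset_sum_cong[OF _ U_sub])
      show "right_inv H U (\<lambda>\<beta>. act \<gamma> (F0 \<beta>))" using F0(1) by (simp add: right_inv_def)
      fix \<beta> assume \<beta>: "\<beta> \<in> carrier H"
      have "f (\<gamma> \<otimes> \<beta>) = f \<beta>"
        using f_inv[OF \<gamma> \<beta> subgroup.one_closed[OF U_sub]] c \<beta> by simp
      then show "act \<gamma> (F0 \<beta>) = F0 (\<gamma> \<otimes> \<beta>)"
        using c \<beta> w_lim by (simp add: F0_def act_scale act_mult act_lim)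
    qed
    also have "\<dots> = twisted g" using coset_sum_translate[OF F0(1) U_sub c] tw by simp
    finally show ?thesis .
  qed
  \<comment> \<open>The summand \<open>F0\<close> is equivariant under the stabiliser, whereas
    \<open>coset_sum_inverse\<close> asks for invariance. Averaging each summand provides it, and
    the sum does not change because it is already invariant.\<close>
  define F where "F \<beta> = average (stab g) (F0 \<beta>)" for \<beta>
  have F_sum: "coset_sum H U F = twisted g"
  proof -
    have "coset_sum H U F = average (stab g) (coset_sum H U F0)"
      unfolding F_def
      by (rule coset_sum_additive(1)[OF F0(1) U_sub F0_fin F0_lim])
         (auto intro: lim_add simp: average_zero[OF P] average_add[OF P])
    then show ?thesis using average_invariant[OF P tw_lim tw_inv] tw by simp
  qed
  have F_coord: "F (inv h) = coord_fun g source h" if "h \<in> carrier H" for h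
    using that g w_lim by (simp add: F_def F0_def coord_fun_def f iota_inv act_scale flip: w_def)
  have "index U (stab g) \<odot> coset_sum H U F = coset_sum H (stab g) (\<lambda>h. F (inv h))"
  proof (rule coset_sum_inverse[OF W.vector_space_axioms U_level P])
    show "right_inv H U F" using F0(1) by (simp add: right_inv_def F_def)
    show "finite (coset_supp H U F)"
      by (rule finite_subset[OF coset_supp_mono F0_fin]) (auto simp: F_def average_zero[OF P])
    show "right_inv H (stab g) (\<lambda>h. F (inv h))"
      using coord_fun_right_inv[OF source_cfun g] stab_carrier[OF g] F_coord
      unfolding right_inv_def by (metis m_closed)
    have "coset_supp H (stab g) (\<lambda>h. F (inv h)) \<subseteq> coset_supp H (stab g) (coord_fun g source)"
      by (rule coset_supp_mono) (simp add: F_coord)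
    then show "finite (coset_supp H (stab g) (\<lambda>h. F (inv h)))"
      using coord_fun_finite[OF source_cfun g] finite_subset by blast
  qed
  also have "coset_sum H (stab g) (\<lambda>h. F (inv h)) = coord g source"
    unfolding coord_def
    by (rule coset_sum_cong[OF coord_fun_right_inv[OF source_cfun g] stab_subgroup[OF g], symmetric])
       (simp add: F_coord)
  finally show ?thesis using F_sum by simp
qed

section \<open>Transport of classes inside a double coset\<close>

abbreviation sublevel :: "'g \<Rightarrow> 'h set" where "sublevel g \<equiv> trace_on H \<iota> (conj_by G g L)"

lemma L_subset: "L \<subseteq> K"
proof -
  interpret N: normal L "G\<lparr>carrier := K\<rparr>" by (rule L_normal)
  show ?thesis using N.subset by simp
qed

lemma L_carrier: "L \<subseteq> carrier G"
  using L_subset K_subset by blast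

lemma L_conj: "k \<in> K \<Longrightarrow> l \<in> L \<Longrightarrow> k \<cdot> l \<cdot> inv\<^bsub>G\<^esub> k \<in> L"
  using G.conj_by_normal[OF K_subgroup L_normal, of k] G.mem_conj_by_iff[of k L "k \<cdot> l \<cdot> inv\<^bsub>G\<^esub> k"]
    L_carrier subsetD[OF L_carrier, of l] by (simp add: G.m_assoc)

lemma sublevel_level: "g \<in> carrier G \<Longrightarrow> sublevel g \<in> \<Upsilon>H"
  using trace_level G.T1 L by blast

lemma sublevel_subset: "sublevel g \<subseteq> stab g"
  using G.conj_by_mono[OF L_subset] by (auto simp: trace_on_def)

lemma conj_shift:
  assumes "g \<in> carrier G" "h \<in> carrier H" "k \<in> K" "a \<in> carrier G"
  shows "inv\<^bsub>G\<^esub> g \<cdot> (inv\<^bsub>G\<^esub> (\<iota> h) \<cdot> a \<cdot> \<iota> h) \<cdot> g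
    = k \<cdot> (inv\<^bsub>G\<^esub> (\<iota> h \<cdot> g \<cdot> k) \<cdot> a \<cdot> (\<iota> h \<cdot> g \<cdot> k)) \<cdot> inv\<^bsub>G\<^esub> k"
  using assms by (simp add: G.inv_mult_group G.m_assoc)

context
  fixes V y g h k
  assumes V: "V \<in> \<Upsilon>H" and y: "y \<in> val MH V" and g: "g \<in> carrier G" and h: "h \<in> carrier H"
    and k: "k \<in> K" and VL: "\<iota> ` V \<subseteq> conj_by G (\<iota> h \<cdot> g \<cdot> k) L"
begin

text \<open>Conjugating \<open>V\<close> by \<open>h\<close> leads into
  \<open>g k L k\<^sup>-\<^sup>1 g\<^sup>-\<^sup>1\<close>, and \<open>k\<close> disappears because
  \<open>L\<close> is normal in \<open>K\<close>.\<close>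

lemma is_mor_transport: "is_mor H V (sublevel g) h"
proof -
  let ?g = "\<iota> h \<cdot> g \<cdot> k"
  have "inv h \<otimes> v \<otimes> h \<in> sublevel g" if v: "v \<in> V" for v
  proof -
    have c: "v \<in> carrier H" using v level_subset V by blast
    have "inv\<^bsub>G\<^esub> ?g \<cdot> \<iota> v \<cdot> ?g \<in> L"
      using VL v g h k L_carrier by (auto simp: G.mem_conj_by_iff image_subset_iff)
    from L_conj[OF k this] show ?thesis
      using c g h L_carrier conj_shift[OF g h k iota_closed[OF c]]
      by (simp add: trace_on_def G.mem_conj_by_iff iota_mult iota_inv)
  qed
  then show ?thesis using h level_subset[OF V] by (simp add: is_mor_iff)
qed

text \<open>The action of the inverse of \<open>h\<close> on \<open>j V y\<close> is a pushforward
  along \<open>h\<close>, and the average is a trace with factor \<open>[V : H_g]\<close>. The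
  weight \<open>[U : V]\<close> turns this factor into \<open>[U : H_g]\<close>, and the trace can
  be routed through level \<open>sublevel g\<close>, whatever \<open>V\<close> was.\<close>

lemma coord_delta_j:
  "coord g (delta G K (index U V \<odot> j V y) (\<iota> h \<cdot> g \<cdot> k))
    = index U (stab g) \<odot> j (stab g) (push MH (sublevel g) (stab g) \<one> (push MH V (sublevel g) h y))"
proof -
  define V' where "V' = conj_by H (inv h) V"
  note lev = stab_level[OF g] sublevel_level[OF g]
  have V': "V' \<in> \<Upsilon>H" "conj_by H h V' = V" using T1 V h level_subset[OF V] conj_by_inv_cancel
    by (auto simp: V'_def)
  have V'_sub: "V' \<subseteq> sublevel g" using is_mor_transport by (simp add: is_mor_def V'_def)
  then have V'_stab: "V' \<subseteq> stab g" using sublevel_subset by blast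
  have mor: "is_mor H V V' h" using is_mor_conj[OF V'(1) h] V'(2) by simp
  have "act (inv h) (j V y) = j V' (pull MH V' V (inv h) y)"
    using h V y by (simp add: act_j V'_def)
  also have "pull MH V' V (inv h) y = push MH V V' h y"
    using pull_eq_push[OF V'(1) V _ _ y, of "inv h"] h V'(2) by simp
  finally have "average (stab g) (act (inv h) (j V y))
      = index V' (stab g) \<odot> j (stab g) (push MH V' (stab g) \<one> (push MH V V' h y))"
    using V' V y mor lev V'_stab by (simp add: average_j push_in)
  also have "push MH V' (stab g) \<one> (push MH V V' h y) = push MH V (stab g) (h \<otimes> \<one>) y"
    using V V' y mor lev V'_stab by (intro push_comp[symmetric] is_mor_one)
  also have "\<dots> = push MH (sublevel g) (stab g) \<one> (push MH V (sublevel g) h y)"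
    using V y lev by (intro push_comp is_mor_one is_mor_transport sublevel_subset)
  also have "index V' (stab g) = index V (stab g)"
    using V h lev by (simp add: V'_def haar_index_conj)
  finally have av: "average (stab g) (act (inv h) (j V y)) = index V (stab g) \<odot>
      j (stab g) (push MH (sublevel g) (stab g) \<one> (push MH V (sublevel g) h y))" .
  have "coord g (delta G K (index U V \<odot> j V y) (\<iota> h \<cdot> g \<cdot> k))
      = index U V \<odot> average (stab g) (act (inv h) (j V y))"
    using V y g h k lev by (simp add: coord_delta lim_scale lim_j act_scale average_scale act_lim)
  then show ?thesis using av index_mult[OF U_level V lev(1)] by simp
qed

text \<open>Both sides push \<open>p V S y\<close> to level \<open>K\<close> along
  \<open>\<iota> h \<cdot> g\<close>. On the way through \<open>L\<close> there is an additional
  factor \<open>k\<close>, which is inner at level \<open>K\<close>; on the way through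
  \<open>g K g\<^sup>-\<^sup>1\<close> the map \<open>p\<close> exchanges the pushforward along
  \<open>\<iota> h\<close> in \<open>G\<close> for the one along \<open>h\<close> in
  \<open>H\<close>.\<close>

lemma push_mixed_hecke:
  assumes MG: "ric_functor G TG \<Upsilon>G MG" and p: "pushforward H \<Upsilon>H MH \<Upsilon>G G MG \<iota> p"
  shows "mixed_hecke H MH G MG \<iota> p V (\<iota> h \<cdot> g \<cdot> k) L y \<in> val MG L"
    and "push MG L K \<one>\<^bsub>G\<^esub> (mixed_hecke H MH G MG \<iota> p V (\<iota> h \<cdot> g \<cdot> k) L y)
      = push MG (conj_by G g K) K g (p (sublevel g) (conj_by G g K) (push MH V (sublevel g) h y))"
proof -
  interpret MG: ric_functor G TG \<Upsilon>G MG by (rule MG)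
  define g' where "g' = \<iota> h \<cdot> g \<cdot> k"
  define S where "S = conj_by G g' L"
  define B where "B = conj_by G g K"
  have g': "g' \<in> carrier G" using g h k by (simp add: g'_def)
  have lev: "S \<in> \<Upsilon>G" "B \<in> \<Upsilon>G" using G.T1 L K g g' by (auto simp: S_def B_def)
  \<comment> \<open>The level already lies in the conjugate of \<open>L\<close>, so the restriction
    inside \<open>mixed_hecke\<close> is the identity.\<close>
  have "V \<inter> trace_on H \<iota> S = V" using VL level_subset[OF V] by (auto simp: trace_on_def S_def g'_def)
  then have mixed: "mixed_hecke H MH G MG \<iota> p V g' L y = push MG S L g' (p V S y)"
    using V y by (simp add: mixed_hecke_def S_def[symmetric] Let_def pull_id)
  have VS: "\<iota> ` V \<subseteq> S" using VL by (simp add: S_def g'_def)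
  define z where "z = p V S y"
  have z: "z \<in> val MG S"
    using p V lev VS y unfolding pushforward_def linear_between_def z_def by blast
  have mor: "is_mor G S L g'" using MG.is_mor_conj[OF L g'] by (simp add: S_def)
  show "mixed_hecke H MH G MG \<iota> p V (\<iota> h \<cdot> g \<cdot> k) L y \<in> val MG L"
    using MG.push_in[OF lev(1) L mor z] mixed by (simp add: g'_def z_def)
  have morB: "is_mor G S B (\<iota> h)"
  proof -
    have "inv\<^bsub>G\<^esub> (\<iota> h) \<cdot> a \<cdot> \<iota> h \<in> B" if a: "a \<in> S" for a
    proof -
      have c: "a \<in> carrier G" "inv\<^bsub>G\<^esub> g' \<cdot> a \<cdot> g' \<in> K"
        using a g' L_carrier L_subset by (auto simp: S_def G.mem_conj_by_iff)
      have "k \<cdot> (inv\<^bsub>G\<^esub> g' \<cdot> a \<cdot> g') \<cdot> inv\<^bsub>G\<^esub> k \<in> K"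
        by (intro K_mult k c K_inv)
      then show ?thesis using conj_shift[OF g h k c(1)] c g h K_subset
        by (simp add: B_def G.mem_conj_by_iff g'_def)
    qed
    then show ?thesis using h lev by (simp add: G.is_mor_iff MG.level_subset_carrier)
  qed
  have morBK: "is_mor G B K g" using MG.is_mor_conj[OF K g] by (simp add: B_def)
  have morK: "is_mor G K K k" using MG.is_mor_self[OF K k] .
  have morSK: "is_mor G S K (\<iota> h \<cdot> g)"
  proof -
    have "inv\<^bsub>G\<^esub> (\<iota> h \<cdot> g) \<cdot> a \<cdot> (\<iota> h \<cdot> g) \<in> K" if a: "a \<in> S" for a
    proof -
      have "a \<in> carrier G" using a MG.level_subset_carrier[OF lev(1)] by blast
      then have "inv\<^bsub>G\<^esub> (\<iota> h \<cdot> g) \<cdot> a \<cdot> (\<iota> h \<cdot> g)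
          = inv\<^bsub>G\<^esub> g \<cdot> (inv\<^bsub>G\<^esub> (\<iota> h) \<cdot> a \<cdot> \<iota> h) \<cdot> g"
        using g h by (simp add: G.inv_mult_group G.m_assoc)
      moreover have "inv\<^bsub>G\<^esub> (\<iota> h) \<cdot> a \<cdot> \<iota> h \<in> B"
        using morB a MG.level_subset_carrier[OF lev(1)] by (simp add: G.is_mor_iff)
      ultimately show ?thesis
        using morBK MG.level_subset_carrier[OF lev(2)] by (simp add: G.is_mor_iff)
    qed
    then show ?thesis using g h MG.level_subset_carrier[OF lev(1)] by (simp add: G.is_mor_iff)
  qed
  have "p (sublevel g) B (push MH V (sublevel g) h y) = push MG S B (\<iota> h) z"
  proof -
    have "\<iota> ` sublevel g \<subseteq> B" using sublevel_subset[of g] by (auto simp: B_def trace_on_def)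
    then show ?thesis
      using p V lev VS y morB is_mor_transport sublevel_level[OF g] unfolding pushforward_def z_def by metis
  qed
  then have "push MG B K g (p (sublevel g) B (push MH V (sublevel g) h y)) = push MG S K (\<iota> h \<cdot> g) z"
    using MG.push_comp[OF lev K morB morBK z] by simp
  also have "\<dots> = push MG K K k (push MG S K (\<iota> h \<cdot> g) z)"
    using MG.push_inner[OF K k MG.push_in[OF lev(1) K morSK z]] by simp
  also have "\<dots> = push MG S K (g' \<cdot> \<one>\<^bsub>G\<^esub>) z"
    using MG.push_comp[OF lev(1) K K morSK morK z] g' by (simp add: g'_def)
  also have "\<dots> = push MG L K \<one>\<^bsub>G\<^esub> (push MG S L g' z)"
    by (rule MG.push_comp[OF lev(1) L K mor MG.is_mor_one[OF L L_subset] z])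
  finally show "push MG L K \<one>\<^bsub>G\<^esub> (mixed_hecke H MH G MG \<iota> p V (\<iota> h \<cdot> g \<cdot> k) L y)
      = push MG (conj_by G g K) K g (p (sublevel g) (conj_by G g K) (push MH V (sublevel g) h y))"
    using mixed by (simp add: g'_def B_def z_def)
qed

end

end

section \<open>Presentations of integral functions\<close>

context hecke_setup begin

definition elementary :: "'h set \<times> 'm \<times> 'g \<Rightarrow> 'g \<Rightarrow> 'w" where
  "elementary = (\<lambda>(V, y, g). delta G K (index U V \<odot> j V y) g)"

definition admissible :: "('h set \<times> 'm \<times> 'g) list \<Rightarrow> bool" where
  "admissible bs \<longleftrightarrow> (\<forall>(V, y, g)\<in>set bs.
     V \<in> \<Upsilon>H \<and> g \<in> carrier G \<and> \<iota> ` V \<subseteq> conj_by G g L \<and> y \<in> val MH V)"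

lemma admissibleD:
  assumes "admissible bs" "(V, y, g) \<in> set bs"
  shows "V \<in> \<Upsilon>H" "g \<in> carrier G" "\<iota> ` V \<subseteq> conj_by G g L" "y \<in> val MH V"
  using bspec[OF assms(1)[unfolded admissible_def] assms(2)] by simp_all

lemma elementary_cfun: "admissible bs \<Longrightarrow> b \<in> set bs \<Longrightarrow> elementary b \<in> cfun"
  by (cases b) (auto simp: elementary_def dest: admissibleD intro!: delta_cfun lim_scale lim_j)

lemma presentation_cfun: "admissible bs \<Longrightarrow> (\<Sum>b\<leftarrow>bs. elementary b) \<in> cfun"
  using fn.subspace_0[OF cfun_subspace] fn.subspace_add[OF cfun_subspace]
  by (rule additive_sum_list(1)[where f = "\<lambda>x. x"]) (auto intro: elementary_cfun)

text \<open>\<open>L\<close> being normal in \<open>K\<close>, the condition of integrality at \<open>g\<close> depends on \<open>g K\<close> only.\<close>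

lemma conj_L_coset:
  assumes "g \<in> carrier G" "g' \<in> g <#\<^bsub>G\<^esub> K"
  shows "conj_by G g' L = conj_by G g L"
proof -
  obtain k where k: "k \<in> K" "g' = g \<cdot> k" using assms(2) by (auto simp: l_coset_def)
  then show ?thesis
    using assms(1) G.conj_by_normal[OF K_subgroup L_normal k(1)] L_carrier by (simp add: G.conj_by_mult)
qed

lemma integral_presentation:
  assumes "admissible bs"
  shows "is_integral G \<iota> \<Upsilon>H MH W \<mu> U L (\<Sum>b\<leftarrow>bs. elementary b)"
  unfolding is_integral_def
proof
  fix g assume g: "g \<in> carrier G"
  define vs where "vs = map (\<lambda>(V, y, g'). (V, y)) (filter (\<lambda>(V, y, g'). g \<in> g' <#\<^bsub>G\<^esub> K) bs)"
  have "V \<in> \<Upsilon>H \<and> \<iota> ` V \<subseteq> conj_by G g L \<and> y \<in> val MH V" if Vy: "(V, y) \<in> set vs" for V y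
  proof -
    obtain g' where "(V, y, g') \<in> set bs" "g \<in> g' <#\<^bsub>G\<^esub> K" using Vy by (auto simp: vs_def)
    then show ?thesis using admissibleD[OF assms] conj_L_coset by metis
  qed
  moreover have "(\<Sum>b\<leftarrow>bs. elementary b) g = (\<Sum>(V, y)\<leftarrow>vs. index U V \<odot> j V y)"
    unfolding vs_def sum_list_fun_apply
    by (induction bs) (auto simp: elementary_def delta_def)
  ultimately show "\<exists>vs. (\<forall>(V, y)\<in>set vs. V \<in> \<Upsilon>H \<and> \<iota> ` V \<subseteq> conj_by G g L \<and> y \<in> val MH V) \<and>
      (\<Sum>b\<leftarrow>bs. elementary b) g = (\<Sum>(V, y)\<leftarrow>vs. index U V \<odot> j V y)"
    by blast
qed

text \<open>Integrality is a pointwise condition. One representative is taken from each of the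
  finitely many cosets in the support, and the expressions chosen there are concatenated.\<close>

lemma exists_presentation:
  assumes "\<zeta> \<in> cfun" "is_integral G \<iota> \<Upsilon>H MH W \<mu> U L \<zeta>"
  obtains bs where "admissible bs" "\<zeta> = (\<Sum>b\<leftarrow>bs. elementary b)"
proof -
  define rep where "rep B = (SOME g. g \<in> B)" for B :: "'g set"
  have rep: "rep B \<in> carrier G" if B: "B \<in> coset_supp G K \<zeta>" for B
  proof -
    obtain g where g: "g \<in> carrier G" "B = g <#\<^bsub>G\<^esub> K" using B by (auto simp: coset_supp_def)
    obtain k where "k \<in> K" "rep B = g \<cdot> k"
      using G.l_coset_rep[OF K_subgroup g(1)] unfolding g(2) rep_def by blast
    then show ?thesis using g by simp
  qed
  have "\<exists>vs. \<forall>B\<in>coset_supp G K \<zeta>. (\<forall>(V, y)\<in>set (vs B). V \<in> \<Upsilon>H \<and> \<iota> ` V \<subseteq> conj_by G (rep B) L \<and> y \<in> val MH V) \<and>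
      \<zeta> (rep B) = (\<Sum>(V, y)\<leftarrow>vs B. index U V \<odot> j V y)"
  proof (rule bchoice, rule ballI)
    fix B assume "B \<in> coset_supp G K \<zeta>"
    from bspec[OF assms(2)[unfolded is_integral_def] rep[OF this]]
    show "\<exists>vs. (\<forall>(V, y)\<in>set vs. V \<in> \<Upsilon>H \<and> \<iota> ` V \<subseteq> conj_by G (rep B) L \<and> y \<in> val MH V) \<and>
      \<zeta> (rep B) = (\<Sum>(V, y)\<leftarrow>vs. index U V \<odot> j V y)" .
  qed
  then obtain vs where vs': "\<forall>B\<in>coset_supp G K \<zeta>. (\<forall>(V, y)\<in>set (vs B). V \<in> \<Upsilon>H \<and> \<iota> ` V \<subseteq> conj_by G (rep B) L \<and> y \<in> val MH V) \<and>
      \<zeta> (rep B) = (\<Sum>(V, y)\<leftarrow>vs B. index U V \<odot> j V y)"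
    by (rule exE)
  have vs: "V \<in> \<Upsilon>H \<and> \<iota> ` V \<subseteq> conj_by G (rep B) L \<and> y \<in> val MH V"
    if "B \<in> coset_supp G K \<zeta>" "(V, y) \<in> set (vs B)" for B V y
    using bspec[OF conjunct1[OF bspec[OF vs' that(1)]] that(2)] by simp
  have vs_sum: "\<zeta> (rep B) = (\<Sum>(V, y)\<leftarrow>vs B. index U V \<odot> j V y)" if "B \<in> coset_supp G K \<zeta>" for B
    using bspec[OF vs' that] by (rule conjunct2)
  have "finite (coset_supp G K \<zeta>)" using assms(1) by (simp add: cfun_iff)
  then obtain Bs where Bs: "set Bs = coset_supp G K \<zeta>" "distinct Bs" using finite_distinct_list by blast
  define bs where "bs = concat (map (\<lambda>B. map (\<lambda>(V, y). (V, y, rep B)) (vs B)) Bs)"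
  have "admissible bs"
    unfolding admissible_def
  proof
    fix b assume "b \<in> set bs"
    then obtain B V y where B: "B \<in> coset_supp G K \<zeta>" "(V, y) \<in> set (vs B)" "b = (V, y, rep B)"
      using Bs(1) by (auto simp: bs_def)
    then show "case b of (V, y, g) \<Rightarrow> V \<in> \<Upsilon>H \<and> g \<in> carrier G \<and> \<iota> ` V \<subseteq> conj_by G g L \<and> y \<in> val MH V"
      using vs[OF B(1,2)] rep[OF B(1)] by simp
  qed
  have block: "(\<Sum>b\<leftarrow>map (\<lambda>(V, y). (V, y, g)) us. elementary b)
      = delta G K (\<Sum>(V, y)\<leftarrow>us. index U V \<odot> j V y) g" for us g
    by (induction us) (auto simp: elementary_def delta_add delta_zero)
  have "(\<Sum>b\<leftarrow>bs. elementary b) = (\<Sum>B\<leftarrow>Bs. \<Sum>b\<leftarrow>map (\<lambda>(V, y). (V, y, rep B)) (vs B). elementary b)"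
    unfolding bs_def by (induction Bs) auto
  also have "\<dots> = (\<Sum>B\<leftarrow>Bs. delta G K (\<zeta> (rep B)) (rep B))"
    unfolding block using vs_sum Bs(1) by (intro arg_cong[of _ _ sum_list] map_cong) auto
  also have "\<dots> = (\<Sum>B\<in>coset_supp G K \<zeta>. delta G K (\<zeta> (rep B)) (rep B))"
    using Bs by (simp add: sum_list_distinct_conv_sum_set)
  also have "\<dots> = \<zeta>" using cfun_decomposition[OF assms(1)] by (simp add: rep_def)
  finally show ?thesis using that[OF \<open>admissible bs\<close>] by simp
qed

text \<open>If \<open>g' = h g k\<close>, a class of level \<open>V \<subseteq> H \<inter> g' L g'\<^sup>-\<^sup>1\<close> is carried by
  \<open>h\<close> to level \<open>H \<inter> g L g\<^sup>-\<^sup>1\<close>; the sum of the transported classes of a presentation over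
  the double coset of \<open>g\<close> is the class in the restriction identity.\<close>

definition orbit_rep :: "'g \<Rightarrow> 'g \<Rightarrow> 'h" where
  "orbit_rep g g' = (SOME h. h \<in> carrier H \<and> (\<exists>k\<in>K. g' = \<iota> h \<cdot> g \<cdot> k))"

lemma orbit_rep:
  assumes "g \<in> carrier G" "g' \<in> orbit g"
  obtains k where "orbit_rep g g' \<in> carrier H" "k \<in> K" "g' = \<iota> (orbit_rep g g') \<cdot> g \<cdot> k"
proof -
  have "\<exists>h. h \<in> carrier H \<and> (\<exists>k\<in>K. g' = \<iota> h \<cdot> g \<cdot> k)"
    using assms by (auto simp: mem_dcoset_iota)
  then have "orbit_rep g g' \<in> carrier H \<and> (\<exists>k\<in>K. g' = \<iota> (orbit_rep g g') \<cdot> g \<cdot> k)"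
    unfolding orbit_rep_def by (rule someI_ex)
  then show ?thesis using that by blast
qed

definition transport :: "'g \<Rightarrow> 'h set \<times> 'm \<times> 'g \<Rightarrow> 'm" where
  "transport g = (\<lambda>(V, y, g'). push MH V (sublevel g) (orbit_rep g g') y)"

definition gathered :: "'g \<Rightarrow> ('h set \<times> 'm \<times> 'g) list \<Rightarrow> 'm" where
  "gathered g bs =
     (\<Sum>b\<leftarrow>filter (\<lambda>(V, y, g'). g' \<in> orbit g) bs. transport g b)"

lemma transport_val:
  assumes "admissible bs" "(V, y, g') \<in> set bs" "g \<in> carrier G" "g' \<in> orbit g"
  shows "transport g (V, y, g') \<in> val MH (sublevel g)"
proof -
  note b = admissibleD[OF assms(1,2)]
  obtain k where k: "orbit_rep g g' \<in> carrier H" "k \<in> K" "g' = \<iota> (orbit_rep g g') \<cdot> g \<cdot> k"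
    using orbit_rep[OF assms(3,4)] by blast
  have "is_mor H V (sublevel g) (orbit_rep g g')"
    by (rule is_mor_transport[OF b(1,4) assms(3) k(1,2)]) (use b(3) k(3) in simp)
  then show ?thesis
    using b sublevel_level[OF assms(3)] by (simp add: transport_def push_in)
qed

lemma gathered_val:
  assumes "admissible bs" "g \<in> carrier G"
  shows "gathered g bs \<in> val MH (sublevel g)"
  unfolding gathered_def
  by (rule additive_sum_list(1)[where f = "\<lambda>x. x"])
     (use assms transport_val sublevel_level[OF assms(2)] in \<open>auto simp: val_add\<close>)

text \<open>Every entry in the double coset of \<open>g\<close> contributes with the same factor, so
  the contributions add up inside one trace; entries elsewhere contribute nothing.\<close>

lemma coord_presentation:
  assumes bs: "admissible bs" and g: "g \<in> carrier G"
  shows "coord g (\<Sum>b\<leftarrow>bs. elementary b)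
    = index U (stab g) \<odot> j (stab g) (push MH (sublevel g) (stab g) \<one> (gathered g bs))"
proof -
  let ?in = "\<lambda>(V, y, g'). g' \<in> orbit g"
  let ?f = "\<lambda>z. index U (stab g) \<odot> j (stab g) (push MH (sublevel g) (stab g) \<one> z)"
  note lev = stab_level[OF g] sublevel_level[OF g]
  note mor = is_mor_one[OF lev(2) sublevel_subset]
  have "coord g (\<Sum>b\<leftarrow>bs. elementary b) = (\<Sum>b\<leftarrow>bs. coord g (elementary b))"
    by (rule additive_sum_list(2)[of cfun, OF fn.subspace_0[OF cfun_subspace]
          fn.subspace_add[OF cfun_subspace] coord_add[OF _ _ g] elementary_cfun[OF bs]])
  also have "\<dots> = (\<Sum>b\<leftarrow>bs. if ?in b then ?f (transport g b) else 0)"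
  proof (intro arg_cong[of _ _ sum_list] map_cong refl)
    fix b assume "b \<in> set bs"
    moreover obtain V y g' where b: "b = (V, y, g')" by (cases b) auto
    ultimately have adm: "V \<in> \<Upsilon>H" "g' \<in> carrier G" "\<iota> ` V \<subseteq> conj_by G g' L" "y \<in> val MH V"
      using admissibleD[OF bs] by auto
    show "coord g (elementary b) = (if ?in b then ?f (transport g b) else 0)"
    proof (cases "g' \<in> orbit g")
      case True
      then obtain k where k: "orbit_rep g g' \<in> carrier H" "k \<in> K" "g' = \<iota> (orbit_rep g g') \<cdot> g \<cdot> k"
        using orbit_rep[OF g] by blast
      have "\<iota> ` V \<subseteq> conj_by G (\<iota> (orbit_rep g g') \<cdot> g \<cdot> k) L" using adm(3) k(3) by simp
      from coord_delta_j[OF adm(1,4) g k(1,2) this] show ?thesis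
        using True by (simp add: b elementary_def transport_def flip: k(3))
    next
      case False
      then show ?thesis using coord_delta_other[OF g adm(2)] by (simp add: b elementary_def)
    qed
  qed
  also have "\<dots> = (\<Sum>b\<leftarrow>filter ?in bs. ?f (transport g b))"
    by (simp only: sum_list_map_filter')
  also have "\<dots> = ?f (gathered g bs)"
    unfolding gathered_def
  proof (rule additive_sum_list(2)[symmetric])
    show "0 \<in> val MH (sublevel g)" using lev by simp
    fix u v assume "u \<in> val MH (sublevel g)" "v \<in> val MH (sublevel g)"
    then show "u + v \<in> val MH (sublevel g)" "?f (u + v) = ?f u + ?f v"
      using lev mor by (simp_all add: val_add push_add push_in j_add W.scale_right_distrib)
  next
    fix b assume "b \<in> set (filter ?in bs)"
    then show "transport g b \<in> val MH (sublevel g)" using transport_val[OF bs _ g] by auto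
  qed
  finally show ?thesis .
qed

text \<open>Congruent functions have equal coordinates, and the common factor
  \<open>[U : H_g]\<close> is invertible. No relation between \<open>g\<close> and the support of
  \<hh> is assumed, which gives the vanishing of traces outside it.\<close>

lemma twisted_eq_gathered:
  assumes bs: "admissible bs" and g: "g \<in> carrier G"
    and "(\<Sum>b\<leftarrow>bs. elementary b) - source \<in> kernel"
  shows "twisted g = j (stab g) (push MH (sublevel g) (stab g) \<one> (gathered g bs))"
proof -
  have "coord g (\<Sum>b\<leftarrow>bs. elementary b) = coord g source"
    using coord_kernel[OF assms(3) g] coord_diff[OF presentation_cfun[OF bs] source_cfun g] by simp
  then show ?thesis
    using index_nonzero[OF U_level stab_level[OF g]]
    by (simp add: coord_presentation[OF bs g] coord_source[OF g])
qed

section \<open>The double cosets in the support\<close>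

abbreviation orbits :: "'g set set" where "orbits \<equiv> support_dcosets H G \<iota> K \<hh>"

lemma iota_subgroup: "subgroup (\<iota> ` carrier H) G"
  using group_hom.img_is_subgroup[OF iota_group_hom] .

lemmas orbit_eq = G.dcoset_eq[OF iota_subgroup K_subgroup]
  and orbit_self = G.dcoset_self[OF iota_subgroup K_subgroup]
  and orbit_subset = G.dcoset_subset_carrier[OF iota_subgroup K_subgroup]

lemma orbits_iff:
  "\<alpha> \<in> orbits \<longleftrightarrow> (\<exists>g\<in>carrier G. \<hh> g \<noteq> 0 \<and> \<alpha> = orbit g)"
proof
  assume "\<alpha> \<in> orbits"
  then obtain h g where g: "h \<in> carrier H" "g \<in> carrier G" "\<hh> g \<noteq> 0"
    "\<alpha> = orbit (\<iota> h \<cdot> g)"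
    by (auto simp: support_dcosets_def set_mult_def)
  have "\<iota> h \<cdot> g \<cdot> \<one>\<^bsub>G\<^esub> \<in> orbit g"
    using g K_one unfolding mem_dcoset_iota[OF g(2)] by blast
  then have "\<alpha> = orbit g" using g orbit_eq by simp
  with g show "\<exists>g\<in>carrier G. \<hh> g \<noteq> 0 \<and> \<alpha> = orbit g" by blast
next
  assume "\<exists>g\<in>carrier G. \<hh> g \<noteq> 0 \<and> \<alpha> = orbit g"
  then obtain g where g: "g \<in> carrier G" "\<hh> g \<noteq> 0" "\<alpha> = orbit g" by blast
  have "\<iota> \<one> \<cdot> g \<in> (\<iota> ` carrier H) <#>\<^bsub>G\<^esub> {g \<in> carrier G. \<hh> g \<noteq> 0}"
    using g(1,2) one_closed unfolding set_mult_def by blast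
  then show "\<alpha> \<in> orbits" using g by (auto simp: support_dcosets_def)
qed

lemma orbit_mem:
  assumes "\<alpha> \<in> orbits" "g \<in> \<alpha>"
  shows "g \<in> carrier G" "\<alpha> = orbit g"
  using assms orbit_subset orbit_eq unfolding orbits_iff by (blast, metis)

lemma orbits_disjoint: "\<alpha> \<in> orbits \<Longrightarrow> \<beta> \<in> orbits \<Longrightarrow> \<alpha> \<noteq> \<beta> \<Longrightarrow> \<alpha> \<inter> \<beta> = {}"
  using orbit_mem(2) by blast

lemma finite_orbits: "finite orbits"
proof -
  define D where "D B = orbit (SOME g. g \<in> B)" for B
  have "D (g <#\<^bsub>G\<^esub> K) = orbit g" if g: "g \<in> carrier G" for g
  proof -
    obtain k where k: "k \<in> K" "(SOME x. x \<in> g <#\<^bsub>G\<^esub> K) = g \<cdot> k"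
      using G.l_coset_rep[OF K_subgroup g] by blast
    have "\<iota> \<one> \<cdot> g \<cdot> k \<in> orbit g"
      using k one_closed unfolding mem_dcoset_iota[OF g] by blast
    then show ?thesis using orbit_eq[OF g] k g by (simp add: D_def)
  qed
  then have "orbits \<subseteq> D ` coset_supp G K \<hh>" by (force simp: orbits_iff coset_supp_def)
  then show ?thesis using hecke_finite_left finite_surj by blast
qed

lemma twisted_outside:
  assumes "g \<in> carrier G" "orbit g \<notin> orbits"
  shows "twisted g = 0"
proof (rule twisted_zero, rule ccontr)
  fix h assume h: "h \<in> carrier H" "\<hh> (\<iota> h \<cdot> g) \<noteq> 0"
  have "\<iota> h \<cdot> g \<cdot> \<one>\<^bsub>G\<^esub> \<in> orbit g"
    using h K_one unfolding mem_dcoset_iota[OF assms(1)] by blast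
  then have "orbit (\<iota> h \<cdot> g) = orbit g"
    using orbit_eq[OF assms(1)] h assms(1) by simp
  then show False using assms h orbits_iff iota_closed G.m_closed by metis
qed

lemma restriction_identity_iff:
  "restriction_identity H G \<iota> \<Upsilon>H MH \<phi> W K x \<hh> L g z
    \<longleftrightarrow> twisted g = j (stab g) (push MH (sublevel g) (stab g) \<one> z)"
  by (simp add: restriction_identity_def twisted_def Let_def)

section \<open>Zeta elements from classes, and traces of associated classes\<close>

lemma zeta_iff:
  "is_zeta_element H G TG \<iota> \<Upsilon>H MH \<phi> W \<mu> K x \<hh> L \<zeta>
    \<longleftrightarrow> \<zeta> \<in> cfun \<and> is_integral G \<iota> \<Upsilon>H MH W \<mu> U L \<zeta> \<and> \<zeta> - source \<in> kernel"
  by (simp add: is_zeta_element_def Let_def)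

text \<open>The witness has one entry for each double coset: the given class, weighted by
  \<open>[U : V_\<alpha>]\<close>, at the chosen representative. Its coordinates are by construction
  those of the source.\<close>

lemma zeta_of_classes:
  assumes r: "\<And>\<alpha>. \<alpha> \<in> orbits \<Longrightarrow> r \<alpha> \<in> \<alpha>"
    and z: "\<And>\<alpha>. \<alpha> \<in> orbits \<Longrightarrow> z \<alpha> \<in> val MH (sublevel (r \<alpha>))"
    and tw: "\<And>\<alpha>. \<alpha> \<in> orbits \<Longrightarrow>
      twisted (r \<alpha>) = j (stab (r \<alpha>)) (push MH (sublevel (r \<alpha>)) (stab (r \<alpha>)) \<one> (z \<alpha>))"
  shows "\<exists>\<zeta>. is_zeta_element H G TG \<iota> \<Upsilon>H MH \<phi> W \<mu> K x \<hh> L \<zeta>"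
proof -
  obtain As where As: "set As = orbits" "distinct As" using finite_distinct_list[OF finite_orbits] by blast
  define bs where "bs = map (\<lambda>\<alpha>. (sublevel (r \<alpha>), z \<alpha>, r \<alpha>)) As"
  define \<zeta> where "\<zeta> = (\<Sum>b\<leftarrow>bs. elementary b)"
  have rc: "r \<alpha> \<in> carrier G" "\<alpha> = orbit (r \<alpha>)" if "\<alpha> \<in> orbits" for \<alpha>
    using orbit_mem[OF that r[OF that]] .
  have adm: "admissible bs"
    using rc(1) z sublevel_level As(1) by (auto simp: admissible_def bs_def trace_on_def)
  note \<zeta>_cfun = presentation_cfun[OF adm, folded \<zeta>_def]
  have sum: "\<zeta> = (\<Sum>\<alpha>\<in>orbits. elementary (sublevel (r \<alpha>), z \<alpha>, r \<alpha>))"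
    using As by (simp add: \<zeta>_def bs_def o_def sum_list_distinct_conv_sum_set)
  have el: "elementary (sublevel (r \<alpha>), z \<alpha>, r \<alpha>) \<in> cfun" if "\<alpha> \<in> orbits" for \<alpha>
    using elementary_cfun[OF adm] that As(1) by (simp add: bs_def)
  have "\<zeta> - source \<in> kernel"
  proof (rule mem_kernel_if_coords_zero[OF _ finite_orbits, where r = r])
    show "\<zeta> - source \<in> cfun" using fn.subspace_diff[OF cfun_subspace \<zeta>_cfun source_cfun] .
    show "r \<alpha> \<in> carrier G \<and> \<alpha> = orbit (r \<alpha>)" if "\<alpha> \<in> orbits" for \<alpha>
      using rc[OF that] by blast
    show "\<alpha> \<inter> \<beta> = {}" if "\<alpha> \<in> orbits" "\<beta> \<in> orbits" "\<alpha> \<noteq> \<beta>" for \<alpha> \<beta>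
      using orbits_disjoint that .
    show "g \<in> \<Union>orbits" if g: "g \<in> carrier G" "(\<zeta> - source) g \<noteq> 0" for g
    proof (cases "\<hh> g = 0")
      case True
      then have "\<zeta> g \<noteq> 0" using g by simp
      then obtain \<alpha> where \<alpha>: "\<alpha> \<in> orbits" "elementary (sublevel (r \<alpha>), z \<alpha>, r \<alpha>) g \<noteq> 0"
        unfolding sum sum_fun_apply by (meson sum.neutral)
      then have "g \<in> r \<alpha> <#\<^bsub>G\<^esub> K" by (simp add: elementary_def delta_def split: if_splits)
      then obtain k where k: "k \<in> K" "g = r \<alpha> \<cdot> k" by (auto simp: l_coset_def)
      have "\<iota> \<one> \<cdot> r \<alpha> \<cdot> k \<in> orbit (r \<alpha>)"
        using k one_closed unfolding mem_dcoset_iota[OF rc(1)[OF \<alpha>(1)]] by blast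
      then have "g \<in> \<alpha>" using k rc[OF \<alpha>(1)] by simp
      then show ?thesis using \<alpha>(1) by blast
    next
      case False
      then have "orbit g \<in> orbits" using g(1) orbits_iff by blast
      then show ?thesis using orbit_self[OF g(1)] by blast
    qed
    fix \<alpha> assume \<alpha>: "\<alpha> \<in> orbits"
    note lev = sublevel_level[OF rc(1)[OF \<alpha>]] stab_level[OF rc(1)[OF \<alpha>]]
    have "coord (r \<alpha>) \<zeta> = (\<Sum>\<beta>\<in>orbits. coord (r \<alpha>) (elementary (sublevel (r \<beta>), z \<beta>, r \<beta>)))"
      unfolding sum using el by (rule coord_sum[OF rc(1)[OF \<alpha>]])
    also have "\<dots> = (\<Sum>\<beta>\<in>orbits. if \<alpha> = \<beta> then index U (stab (r \<alpha>)) \<odot> twisted (r \<alpha>) else 0)"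
    proof (rule sum.cong[OF refl])
      fix \<beta> assume \<beta>: "\<beta> \<in> orbits"
      show "coord (r \<alpha>) (elementary (sublevel (r \<beta>), z \<beta>, r \<beta>))
          = (if \<alpha> = \<beta> then index U (stab (r \<alpha>)) \<odot> twisted (r \<alpha>) else 0)"
      proof (cases "\<alpha> = \<beta>")
        case True
        \<comment> \<open>The entry sits at the base point itself, so \<open>h\<close> and
          \<open>k\<close> are the identities and the transport is trivial.\<close>
        have "\<iota> ` sublevel (r \<alpha>) \<subseteq> conj_by G (\<iota> \<one> \<cdot> r \<alpha> \<cdot> \<one>\<^bsub>G\<^esub>) L"
          using rc(1)[OF \<alpha>] by (auto simp: trace_on_def)
        from coord_delta_j[OF lev(1) z[OF \<alpha>] rc(1)[OF \<alpha>] one_closed K_one this] show ?thesis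
          using True rc(1)[OF \<alpha>] tw[OF \<alpha>] lev z[OF \<alpha>] by (simp add: elementary_def push_id)
      next
        case False
        then have "r \<beta> \<notin> orbit (r \<alpha>)"
          using orbits_disjoint[OF \<alpha> \<beta>] r[OF \<beta>] rc(2)[OF \<alpha>] by blast
        then show ?thesis
          using coord_delta_other[OF rc(1)[OF \<alpha>] rc(1)[OF \<beta>]] False by (simp add: elementary_def)
      qed
    qed
    also have "\<dots> = coord (r \<alpha>) source"
      using \<alpha> finite_orbits coord_source[OF rc(1)[OF \<alpha>]] by simp
    finally show "coord (r \<alpha>) (\<zeta> - source) = 0"
      using coord_diff[OF \<zeta>_cfun source_cfun rc(1)[OF \<alpha>]] by simp
  qed
  then show ?thesis
    using \<zeta>_cfun integral_presentation[OF adm, folded \<zeta>_def] unfolding zeta_iff by blast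
qed

text \<open>The entries are sorted by double coset. Within each, \<open>push_mixed_hecke\<close>
  expresses the trace of every entry through its transport to a common base point, and additivity
  produces the gathered class.\<close>

lemma associated_class_trace:
  assumes MG: "ric_functor G TG \<Upsilon>G MG" and p: "pushforward H \<Upsilon>H MH \<Upsilon>G G MG \<iota> p"
    and tf: "torsion_free \<Upsilon>H MH"
    and bs: "admissible bs" and ker: "(\<Sum>b\<leftarrow>bs. elementary b) - source \<in> kernel"
    and r: "\<And>\<alpha>. \<alpha> \<in> orbits \<Longrightarrow> r \<alpha> \<in> \<alpha>"
  shows "push MG L K \<one>\<^bsub>G\<^esub> (\<Sum>(V, y, g)\<leftarrow>bs. mixed_hecke H MH G MG \<iota> p V g L y)
    = (\<Sum>\<alpha>\<in>orbits. mixed_hecke H MH G MG \<iota> p (sublevel (r \<alpha>)) (r \<alpha>) K (gathered (r \<alpha>) bs))"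
proof -
  interpret MG: ric_functor G TG \<Upsilon>G MG by (rule MG)
  define \<Psi> where "\<Psi> g z = push MG (conj_by G g K) K g (p (sublevel g) (conj_by G g K) z)" for g z
  define t where "t = (\<lambda>(V, y, g). mixed_hecke H MH G MG \<iota> p V g L y)"
  define d where "d b = orbit (snd (snd b))" for b :: "'h set \<times> 'm \<times> 'g"
  \<comment> \<open>A presentation may involve double cosets outside the support of \<hh>. On those
    the base point is arbitrary; on the others it is the prescribed one.\<close>
  define \<Delta> where "\<Delta> = orbits \<union> d ` set bs"
  define s where "s D = (if D \<in> orbits then r D else (SOME g. g \<in> D))" for D
  have s: "s D \<in> carrier G \<and> orbit (s D) = D" if D: "D \<in> \<Delta>" for D
  proof (cases "D \<in> orbits")
    case True
    then show ?thesis using orbit_mem[OF True r[OF True]] by (simp add: s_def)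
  next
    case False
    then obtain V y g where b: "(V, y, g) \<in> set bs" "D = orbit g"
      using D by (auto simp: \<Delta>_def d_def)
    note g = admissibleD(2)[OF bs b(1)]
    have "s D \<in> D" using False orbit_self[OF g] b(2) by (auto simp: s_def intro: someI)
    then show ?thesis using orbit_subset[OF g] orbit_eq[OF g] b(2) by auto
  qed
  have each: "t b \<in> val MG L \<and> push MG L K \<one>\<^bsub>G\<^esub> (t b) = \<Psi> (s (d b)) (transport (s (d b)) b)"
    if b: "b \<in> set bs" for b
  proof -
    obtain V y g' where b': "b = (V, y, g')" by (cases b) auto
    note adm = admissibleD[OF bs b[unfolded b']]
    have "d b \<in> \<Delta>" using imageI[OF b, of d] by (simp add: \<Delta>_def)
    moreover have "g' \<in> d b" using orbit_self[OF adm(2)] by (simp add: d_def b')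
    ultimately have sd: "s (d b) \<in> carrier G" "g' \<in> orbit (s (d b))"
      using s[of "d b"] by auto
    obtain k where k: "orbit_rep (s (d b)) g' \<in> carrier H" "k \<in> K"
        "g' = \<iota> (orbit_rep (s (d b)) g') \<cdot> s (d b) \<cdot> k"
      using orbit_rep[OF sd] by blast
    have "\<iota> ` V \<subseteq> conj_by G (\<iota> (orbit_rep (s (d b)) g') \<cdot> s (d b) \<cdot> k) L"
      using adm(3) k(3) by simp
    from push_mixed_hecke[OF adm(1,4) sd(1) k(1,2) this MG p] show ?thesis
      by (simp add: b' t_def \<Psi>_def transport_def flip: k(3)[unfolded b'])
  qed
  have \<Psi>_add: "\<Psi> g (u + v) = \<Psi> g u + \<Psi> g v"
    if g: "g \<in> carrier G" and uv: "u \<in> val MH (sublevel g)" "v \<in> val MH (sublevel g)" for g u v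
  proof -
    have B: "conj_by G g K \<in> \<Upsilon>G" "\<iota> ` sublevel g \<subseteq> conj_by G g K"
      using G.T1[OF K g] sublevel_subset[of g] by (auto simp: trace_on_def)
    have "linear_between (smul MH) (smul MG) (val MH (sublevel g)) (val MG (conj_by G g K))
        (p (sublevel g) (conj_by G g K))"
      using p sublevel_level[OF g] B unfolding pushforward_def by blast
    then show ?thesis
      using uv MG.push_add[OF B(1) K MG.is_mor_conj[OF K g]] by (simp add: \<Psi>_def linear_between_def)
  qed
  have group: "(\<Sum>b\<leftarrow>filter (\<lambda>b. d b = D) bs. push MG L K \<one>\<^bsub>G\<^esub> (t b)) = \<Psi> (s D) (gathered (s D) bs)"
    if D: "D \<in> \<Delta>" for D
  proof -
    have filt: "filter (\<lambda>b. d b = D) bs = filter (\<lambda>(V, y, g'). g' \<in> orbit (s D)) bs"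
    proof (rule filter_cong[OF refl])
      fix b assume "b \<in> set bs"
      moreover obtain V y g' where b: "b = (V, y, g')" by (cases b) auto
      ultimately have g': "g' \<in> carrier G" using admissibleD(2)[OF bs] by blast
      have "g' \<in> D \<longleftrightarrow> orbit g' = D"
        using s[OF D] orbit_eq[of "s D" g'] orbit_self[OF g'] by auto
      then show "d b = D \<longleftrightarrow> (case b of (V, y, g') \<Rightarrow> g' \<in> orbit (s D))"
        using s[OF D] by (simp add: b d_def)
    qed
    have "(\<Sum>b\<leftarrow>filter (\<lambda>b. d b = D) bs. push MG L K \<one>\<^bsub>G\<^esub> (t b))
        = (\<Sum>b\<leftarrow>filter (\<lambda>b. d b = D) bs. \<Psi> (s D) (transport (s D) b))"
      using each by (intro arg_cong[of _ _ sum_list] map_cong) auto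
    also have "\<dots> = \<Psi> (s D) (gathered (s D) bs)"
      unfolding gathered_def filt
    proof (rule additive_sum_list(2)[symmetric, of "val MH (sublevel (s D))"])
      fix b assume "b \<in> set (filter (\<lambda>(V, y, g'). g' \<in> orbit (s D)) bs)"
      then show "transport (s D) b \<in> val MH (sublevel (s D))" using transport_val[OF bs] s[OF D] by auto
    qed (use s[OF D] sublevel_level in \<open>auto simp: val_add \<Psi>_add\<close>)
    finally show ?thesis .
  qed
  have zero: "\<Psi> (s D) (gathered (s D) bs) = 0" if D: "D \<in> \<Delta>" "D \<notin> orbits" for D
  proof -
    let ?g = "s D" let ?B = "conj_by G (s D) K"
    have g: "?g \<in> carrier G" "orbit ?g \<notin> orbits" using s[OF D(1)] D(2) by auto
    note lev = stab_level[OF g(1)] sublevel_level[OF g(1)] G.T1[OF K g(1)]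
    note mor = is_mor_one[OF lev(2) sublevel_subset]
    note val = gathered_val[OF bs g(1)]
    have "j (stab ?g) (push MH (sublevel ?g) (stab ?g) \<one> (gathered ?g bs)) = 0"
      using twisted_eq_gathered[OF bs g(1) ker] twisted_outside[OF g] by simp
    then have z0: "push MH (sublevel ?g) (stab ?g) \<one> (gathered ?g bs) = 0"
      using j_inject[OF tf lev(1)] push_in[OF lev(2,1) mor val] by blast
    have sub: "\<iota> ` stab ?g \<subseteq> ?B" "\<iota> ` sublevel ?g \<subseteq> ?B"
      using sublevel_subset[of ?g] by (auto simp: trace_on_def)
    have lin: "linear_between (smul MH) (smul MG) (val MH V) (val MG ?B) (p V ?B)"
      if "V \<in> \<Upsilon>H" "\<iota> ` V \<subseteq> ?B" for V
      using p that lev(3) unfolding pushforward_def by blast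
    have p0: "p (stab ?g) ?B 0 = 0"
      using lin[OF lev(1) sub(1)] val_zero[OF lev(1)] unfolding linear_between_def
      by (metis add_cancel_right_right)
    have "p (sublevel ?g) ?B (gathered ?g bs) \<in> val MG ?B"
      using lin[OF lev(2) sub(2)] val unfolding linear_between_def by blast
    \<comment> \<open>Writing the identity at level \<open>g K g\<^sup>-\<^sup>1\<close> as the
      pushforward along \<open>\<iota> \<one>\<close> lets \<open>p\<close> at the sublevel factor
      through the trace to the stabiliser, which has just been shown to vanish on the gathered
      class.\<close>
    then have "p (sublevel ?g) ?B (gathered ?g bs)
        = push MG ?B ?B (\<iota> \<one>) (p (sublevel ?g) ?B (gathered ?g bs))"
      using MG.push_id[OF lev(3)] by simp
    also have "\<dots> = p (stab ?g) ?B (push MH (sublevel ?g) (stab ?g) \<one> (gathered ?g bs))"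
      using p lev mor sub val MG.is_mor_one[OF lev(3) subset_refl] unfolding pushforward_def by (metis iota_one)
    finally have "p (sublevel ?g) ?B (gathered ?g bs) = 0" using z0 p0 by simp
    moreover have "push MG ?B K ?g 0 = 0"
      using MG.push_add[OF lev(3) K MG.is_mor_conj[OF K g(1)] MG.val_zero[OF lev(3)] MG.val_zero[OF lev(3)]]
      by simp
    ultimately show ?thesis by (simp add: \<Psi>_def)
  qed
  have "push MG L K \<one>\<^bsub>G\<^esub> (\<Sum>b\<leftarrow>bs. t b) = (\<Sum>b\<leftarrow>bs. push MG L K \<one>\<^bsub>G\<^esub> (t b))"
    by (rule additive_sum_list(2)[of "val MG L"])
       (use L K each MG.push_add[OF L K MG.is_mor_one[OF L L_subset]] in \<open>auto simp: MG.val_add\<close>)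
  also have "\<dots> = (\<Sum>D\<in>\<Delta>. \<Sum>b\<leftarrow>filter (\<lambda>b. d b = D) bs. push MG L K \<one>\<^bsub>G\<^esub> (t b))"
    by (rule sum_list_group) (auto simp: \<Delta>_def finite_orbits)
  also have "\<dots> = (\<Sum>D\<in>\<Delta>. \<Psi> (s D) (gathered (s D) bs))" using group by (rule sum.cong[OF refl])
  also have "\<dots> = (\<Sum>\<alpha>\<in>orbits. \<Psi> (s \<alpha>) (gathered (s \<alpha>) bs))"
    by (rule sum.mono_neutral_right) (auto simp: \<Delta>_def finite_orbits intro: zero)
  also have "\<dots> = (\<Sum>\<alpha>\<in>orbits. mixed_hecke H MH G MG \<iota> p (sublevel (r \<alpha>)) (r \<alpha>) K (gathered (r \<alpha>) bs))"
  proof (rule sum.cong[OF refl])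
    fix \<alpha> assume \<alpha>: "\<alpha> \<in> orbits"
    have g: "r \<alpha> \<in> carrier G" using orbit_mem(1)[OF \<alpha> r[OF \<alpha>]] .
    have "sublevel (r \<alpha>) \<inter> stab (r \<alpha>) = sublevel (r \<alpha>)" using sublevel_subset by blast
    then show "\<Psi> (s \<alpha>) (gathered (s \<alpha>) bs)
        = mixed_hecke H MH G MG \<iota> p (sublevel (r \<alpha>)) (r \<alpha>) K (gathered (r \<alpha>) bs)"
      using \<alpha> gathered_val[OF bs g] sublevel_level[OF g]
      by (simp add: s_def \<Psi>_def mixed_hecke_def Let_def pull_id)
  qed
  finally show ?thesis by (simp add: t_def)
qed

end

section \<open>The equivalence and the trace of an associated class\<close>

theorem theorem3p2p3:
  fixes G :: "'g monoid" and TG :: "'g topology" and \<Upsilon>G :: "'g set set"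
    and H :: "'h monoid" and TH :: "'h topology" and \<Upsilon>H :: "'h set set"
    and \<iota> :: "'h \<Rightarrow> 'g" and \<mu> :: "'h measure"
    and MG :: "('g, 'o::{idom,ring_char_0}, 'n::ab_group_add) ric"
    and MH :: "('h, 'o, 'm::ab_group_add) ric"
    and p :: "'h set \<Rightarrow> 'g set \<Rightarrow> 'm \<Rightarrow> 'n"
    and \<phi> :: "'o \<Rightarrow> 'f::field_char_0"
    and W :: "('h, 'm, 'f, 'w::ab_group_add) realisation"
    and K L :: "'g set" and xU :: 'm and \<hh> :: "'g \<Rightarrow> 'o" and g\<alpha> :: "'g set \<Rightarrow> 'g"
  assumes "unimodular G TG" and "unimodular H TH"
    and "closed_immersion H TH G TG \<iota>"
    and "comack_functor G TG \<Upsilon>G MG" and "comack_functor H TH \<Upsilon>H MH"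
    and "\<And>K'. K' \<in> \<Upsilon>G \<Longrightarrow> trace_on H \<iota> K' \<in> \<Upsilon>H"
    and "pushforward H \<Upsilon>H MH \<Upsilon>G G MG \<iota> p"
    and "left_haar_measure H TH \<mu>"
    and "inj \<phi>" and "\<phi> 1 = 1"
    and "\<And>a b. \<phi> (a + b) = \<phi> a + \<phi> b" and "\<And>a b. \<phi> (a * b) = \<phi> a * \<phi> b"
    and "is_completion H \<Upsilon>H MH \<phi> W"
    and "K \<in> \<Upsilon>G" and "xU \<in> val MH (trace_on H \<iota> K)"
    and "is_hecke_function G K \<hh>" and "\<hh> \<noteq> (\<lambda>_. 0)"
    and "L \<in> \<Upsilon>G" and "L \<lhd> G\<lparr>carrier := K\<rparr>"
    and "\<And>\<alpha>. \<alpha> \<in> support_dcosets H G \<iota> K \<hh> \<Longrightarrow> g\<alpha> \<alpha> \<in> \<alpha>"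
  shows
    "((\<exists>\<zeta>. is_zeta_element H G TG \<iota> \<Upsilon>H MH \<phi> W \<mu> K xU \<hh> L \<zeta>) \<longleftrightarrow>
      (\<exists>x. \<forall>\<alpha>\<in>support_dcosets H G \<iota> K \<hh>.
         x \<alpha> \<in> val MH (trace_on H \<iota> (conj_by G (g\<alpha> \<alpha>) L)) \<and>
         restriction_identity H G \<iota> \<Upsilon>H MH \<phi> W K xU \<hh> L (g\<alpha> \<alpha>) (x \<alpha>))) \<and>
     (\<forall>\<zeta> y. is_zeta_element H G TG \<iota> \<Upsilon>H MH \<phi> W \<mu> K xU \<hh> L \<zeta> \<longrightarrow>
        is_associated_class H G \<iota> \<Upsilon>H MH MG p W \<mu> K L \<zeta> y \<longrightarrow>
        torsion_free \<Upsilon>H MH \<longrightarrow>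
        (\<exists>x. (\<forall>\<alpha>\<in>support_dcosets H G \<iota> K \<hh>.
                x \<alpha> \<in> val MH (trace_on H \<iota> (conj_by G (g\<alpha> \<alpha>) L)) \<and>
                restriction_identity H G \<iota> \<Upsilon>H MH \<phi> W K xU \<hh> L (g\<alpha> \<alpha>) (x \<alpha>)) \<and>
             push MG L K \<one>\<^bsub>G\<^esub> y =
               (\<Sum>\<alpha>\<in>support_dcosets H G \<iota> K \<hh>.
                  mixed_hecke H MH G MG \<iota> p (trace_on H \<iota> (conj_by G (g\<alpha> \<alpha>) L)) (g\<alpha> \<alpha>) K (x \<alpha>))))"
proof -
  interpret CG: comack_functor G TG \<Upsilon>G MG by fact
  interpret CH: comack_functor H TH \<Upsilon>H MH by fact
  interpret N: normal L "G\<lparr>carrier := K\<rparr>" by fact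
  interpret hecke_setup H TH \<Upsilon>H \<mu> MH \<phi> W G TG \<Upsilon>G \<iota> K \<hh> xU L
    by unfold_locales
       (assumption | rule assms | rule assms(3)[unfolded closed_immersion_def, THEN conjunct1])+
  have g\<alpha>: "g\<alpha> \<alpha> \<in> carrier G" if "\<alpha> \<in> orbits" for \<alpha>
    using orbit_mem(1)[OF that assms(20)[OF that]] .
  show ?thesis
  proof (intro conjI iffI allI impI)
    assume "\<exists>\<zeta>. is_zeta_element H G TG \<iota> \<Upsilon>H MH \<phi> W \<mu> K xU \<hh> L \<zeta>"
    then obtain \<zeta> where \<zeta>: "\<zeta> \<in> cfun" "is_integral G \<iota> \<Upsilon>H MH W \<mu> U L \<zeta>" "\<zeta> - source \<in> kernel"
      by (auto simp: zeta_iff)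
    then obtain bs where "admissible bs" "\<zeta> = (\<Sum>b\<leftarrow>bs. elementary b)" using exists_presentation by blast
    then show "\<exists>x. \<forall>\<alpha>\<in>orbits. x \<alpha> \<in> val MH (sublevel (g\<alpha> \<alpha>)) \<and>
        restriction_identity H G \<iota> \<Upsilon>H MH \<phi> W K xU \<hh> L (g\<alpha> \<alpha>) (x \<alpha>)"
      using \<zeta>(3) g\<alpha> gathered_val twisted_eq_gathered
      by (intro exI[of _ "\<lambda>\<alpha>. gathered (g\<alpha> \<alpha>) bs"]) (simp add: restriction_identity_iff)
  next
    assume "\<exists>x. \<forall>\<alpha>\<in>orbits. x \<alpha> \<in> val MH (sublevel (g\<alpha> \<alpha>)) \<and>
        restriction_identity H G \<iota> \<Upsilon>H MH \<phi> W K xU \<hh> L (g\<alpha> \<alpha>) (x \<alpha>)"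
    then show "\<exists>\<zeta>. is_zeta_element H G TG \<iota> \<Upsilon>H MH \<phi> W \<mu> K xU \<hh> L \<zeta>"
      unfolding restriction_identity_iff using zeta_of_classes[of g\<alpha>] assms(20) by blast
  next
    fix \<zeta> y
    assume \<zeta>: "is_zeta_element H G TG \<iota> \<Upsilon>H MH \<phi> W \<mu> K xU \<hh> L \<zeta>"
      and y: "is_associated_class H G \<iota> \<Upsilon>H MH MG p W \<mu> K L \<zeta> y" and tf: "torsion_free \<Upsilon>H MH"
    obtain bs where bs: "admissible bs"
      and \<zeta>_eq: "\<zeta> = (\<lambda>g'. \<Sum>(V, x, g)\<leftarrow>bs. if g' \<in> g <#\<^bsub>G\<^esub> K then index U V \<odot> j V x else 0)"
      and y_eq: "y = (\<Sum>(V, x, g)\<leftarrow>bs. mixed_hecke H MH G MG \<iota> p V g L x)"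
      using y unfolding is_associated_class_def admissible_def by blast
    have "\<zeta> = (\<Sum>b\<leftarrow>bs. elementary b)"
      unfolding \<zeta>_eq fun_eq_iff sum_list_fun_apply
      by (intro allI arg_cong[of _ _ sum_list] map_cong refl) (auto simp: elementary_def delta_def)
    then have ker: "(\<Sum>b\<leftarrow>bs. elementary b) - source \<in> kernel" using \<zeta> by (simp add: zeta_iff)
    \<comment> \<open>The classes are gathered from the presentation that defines \<open>y\<close>,
      so that the two sides of the trace formula come from the same entries.\<close>
    show "\<exists>x. (\<forall>\<alpha>\<in>orbits. x \<alpha> \<in> val MH (sublevel (g\<alpha> \<alpha>)) \<and>
          restriction_identity H G \<iota> \<Upsilon>H MH \<phi> W K xU \<hh> L (g\<alpha> \<alpha>) (x \<alpha>)) \<and>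
        push MG L K \<one>\<^bsub>G\<^esub> y =
          (\<Sum>\<alpha>\<in>orbits. mixed_hecke H MH G MG \<iota> p (sublevel (g\<alpha> \<alpha>)) (g\<alpha> \<alpha>) K (x \<alpha>))"
      using associated_class_trace[OF CG.ric_functor_axioms assms(7) tf bs ker assms(20)]
        g\<alpha> gathered_val[OF bs] twisted_eq_gathered[OF bs _ ker]
      by (intro exI[of _ "\<lambda>\<alpha>. gathered (g\<alpha> \<alpha>) bs"]) (simp add: restriction_identity_iff y_eq)
  qed
qed

end
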